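(* For every pair of positive integers $r,t$, the class of graphs that do not contain an induced subgraph isomorphic to a subdivision of $K_{r,t}$ is polynomially $\chi$-bounded; that is, there is a polynomial $f$ such that $\chi(G)\le f(\omega(G))$ for every graph $G$ with no induced subdivision of $K_{r,t}$.
   Context: A subdivision of a graph $H$ is any graph obtained from $H$ by replacing edges by (possibly) longer paths. $\chi(G)$ is the chromatic number and $\omega(G)$ the clique number of $G$. *)

theory Defs
  imports "Graph_Theory.Graph_Theory" "HOL-Computational_Algebra.Polynomial"
begin

text \<open>
  A finite simple graph is a \<^const>\<open>pair_graph\<close>: a finite, loopless, symmetric digraph whose arcs
  are pairs of vertices, an undirected edge being the two opposite arcs between its ends.
\<close>

definition proper_colouring :: "('a,'b) pre_digraph \<Rightarrow> ('a \<Rightarrow> 'c) \<Rightarrow> bool" where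
  "proper_colouring G c \<longleftrightarrow> (\<forall>u\<in>verts G. \<forall>v\<in>verts G. u \<rightarrow>\<^bsub>G\<^esub> v \<longrightarrow> c u \<noteq> c v)"

definition chromatic_number :: "('a,'b) pre_digraph \<Rightarrow> nat" where
  "chromatic_number G = (LEAST k. \<exists>c :: 'a \<Rightarrow> nat. proper_colouring G c \<and> c ` verts G \<subseteq> {..<k})"

definition clique :: "('a,'b) pre_digraph \<Rightarrow> 'a set \<Rightarrow> bool" where
  "clique G S \<longleftrightarrow> S \<subseteq> verts G \<and> (\<forall>u\<in>S. \<forall>v\<in>S. u \<noteq> v \<longrightarrow> u \<rightarrow>\<^bsub>G\<^esub> v)"

definition clique_number :: "('a,'b) pre_digraph \<Rightarrow> nat" where
  "clique_number G = Max (card ` {S. clique G S})"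

text \<open>
  \<^const>\<open>subdivision\<close> is the reflexive-transitive closure of replacing one edge by a path of length
  two through a new vertex. Taking \<open>K\<close> and \<open>S\<close> over the vertex type of \<open>G\<close> loses no generality:
  the vertices of \<open>S\<close> are in bijection with vertices of \<open>G\<close>, those of \<open>K\<close> are among those of \<open>S\<close>,
  and \<open>K\<close> ranges over all complete bipartite graphs with sides of size \<open>r\<close> and \<open>t\<close>.
\<close>

definition has_induced_subdivision_of_Krt :: "nat \<Rightarrow> nat \<Rightarrow> 'a pair_pre_digraph \<Rightarrow> bool" where
  "has_induced_subdivision_of_Krt r t G \<longleftrightarrow>
     (\<exists>H K S :: 'a pair_pre_digraph.
        induced_subgraph (with_proj H) (with_proj G) \<and>
        complete_bipartite_digraph r t (with_proj K) \<and>
        subdivision_pair K S \<and>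
        digraph_iso (with_proj S) (with_proj H))"

text \<open>
  At vertex type \<^typ>\<open>nat\<close> every finite graph occurs up to isomorphism, so there a single polynomial
  serves all finite graphs of the class.
\<close>

definition polynomially_chi_bounded :: "'a pair_pre_digraph set \<Rightarrow> bool" where
  "polynomially_chi_bounded \<G> \<longleftrightarrow>
     (\<exists>f :: real poly. \<forall>G\<in>\<G>.
        real (chromatic_number (with_proj G)) \<le> poly f (real (clique_number (with_proj G))))"

end

theory Submission
  imports Defs
begin

text \<open>
  Let \<open>G\<close> have clique number \<open>\<omega>\<close> and no induced subdivision of \<open>K\<^sub>r\<^sub>,\<^sub>t\<close>. By Ramsey's theorem \<open>G\<close> has no
  biclique \<open>K\<^sub>s\<^sub>,\<^sub>s\<close> (induced or not) for some \<open>s\<close> polynomial in \<open>\<omega>\<close>, so it suffices to bound the degeneracy \<open>D\<close>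
  of \<open>G\<close> polynomially in \<open>s\<close>. Suppose \<open>D\<close> is large and all degrees are at least \<open>D\<close>.

  The bound in the theorem of Kovari, Sos and Turan becomes polynomial here: if polynomially many vertices each see a
  constant fraction of a set \<open>Y\<close>, then their traces on a small random sample of \<open>Y\<close> shatter a large
  set unless many of them nearly coincide (which yields \<open>K\<^sub>s\<^sub>,\<^sub>s\<close>), and a robust version of
  shattering gives an induced 1-subdivision of \<open>K\<^sub>r\<^sub>,\<^sub>t\<close>. Hence every vertex \<open>v\<close> of degree \<open>O(D)\<close> has a large
  codegree with only few vertices. Joining such pairs by additional edges keeps the graph free of large cliques, so
  Shearer's method gives an independent set \<open>W\<close> larger than \<open>|V| / D\<close> by an arbitrary constant factor \<open>k\<close>
  whose elements have pairwise small codegree. Finally, keep each other vertex with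
  probability \<open>1 / D\<close>. The kept vertices \<open>a\<close>, \<open>a'\<close> that are exactly the kept neighbours of some \<open>w\<close> in \<open>W\<close> become the
  edges of a graph of average degree proportional to \<open>k\<close>, whose 1-subdivision is induced in \<open>G\<close>. By Mader's
  theorem that graph contains a subdivision of \<open>K\<^sub>r\<^sub>,\<^sub>t\<close>.
\<close>

section \<open>Polynomially bounded functions\<close>

text \<open>The constant gain \<open>k\<close> is the crux. Keeping vertices with probability 1 / D
  costs a fixed factor \<open>6 ^ 6\<close>, and Mader's theorem asks for an average degree
  exponential in \<open>r * t\<close>. A greedy independent set, of size about |V| / D, gives an
  average vertex only a bounded number of neighbours in it, too few for these constants. Shearer's
  method gains any constant factor because every large vertex set has more independent subsets than
  it has subsets of bounded size, so that a typical independent subset is large. Small codegrees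
  inside \<open>W\<close> ensure that the \<open>k\<close> neighbours in \<open>W\<close> of a
  vertex lead to almost disjoint sets, hence to about k D different vertices. Degrees far above
  \<open>D\<close> cannot be excluded. Therefore the graph is first replaced by a subgraph whose
  minimum degree equals its degeneracy; an orientation with outdegrees at most \<open>D\<close> then
  limits what must be discarded. The bounds stay polynomial because, for fixed \<open>r\<close> and
  \<open>t\<close>, the shattered sets have constant size, and so have the independent sets sought
  by the Ramsey argument.\<close>

definition poly_bounded :: "(nat \<Rightarrow> nat) \<Rightarrow> bool" where
  "poly_bounded f \<longleftrightarrow> (\<exists>C. \<forall>s\<ge>2. f s \<le> s ^ C)"

lemma poly_boundedI: "(\<And>s. 2 \<le> s \<Longrightarrow> f s \<le> s ^ C) \<Longrightarrow> poly_bounded f"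
  by (auto simp: poly_bounded_def)

text \<open>The restriction to arguments at least 2 in \<open>poly_bounded\<close> matters here: a
  power of \<open>s\<close> then dominates any constant, so one exponent absorbs constant factors as
  well.\<close>

lemma poly_bounded_const: "poly_bounded (\<lambda>s. c)"
proof (rule poly_boundedI)
  fix s :: nat assume "2 \<le> s"
  then have "(2::nat) ^ c \<le> s ^ c" by (rule power_mono) simp
  then show "c \<le> s ^ c" using less_exp[of c] by linarith
qed

lemma poly_bounded_id: "poly_bounded (\<lambda>s. s)"
  by (rule poly_boundedI[of _ 1]) simp

lemma poly_bounded_mult:
  assumes "poly_bounded f" "poly_bounded g" shows "poly_bounded (\<lambda>s. f s * g s)"
proof -
  obtain C D where *: "\<forall>s\<ge>2. f s \<le> s ^ C" "\<forall>s\<ge>2. g s \<le> s ^ D"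
    using assms by (auto simp: poly_bounded_def)
  show ?thesis
    by (rule poly_boundedI[of _ "C + D"]) (use * in \<open>auto simp: power_add intro!: mult_mono\<close>)
qed

lemma poly_bounded_add:
  assumes "poly_bounded f" "poly_bounded g" shows "poly_bounded (\<lambda>s. f s + g s)"
proof -
  obtain C D where *: "\<forall>s\<ge>2. f s \<le> s ^ C" "\<forall>s\<ge>2. g s \<le> s ^ D"
    using assms by (auto simp: poly_bounded_def)
  show ?thesis
  proof (rule poly_boundedI[of _ "Suc (C + D)"])
    fix s :: nat assume s: "2 \<le> s"
    have "s ^ C \<le> s ^ (C + D)" "s ^ D \<le> s ^ (C + D)" using s by (auto intro: power_increasing)
    then have "f s + g s \<le> 2 * s ^ (C + D)" using * s by (metis add_mono le_trans mult_2)
    also have "\<dots> \<le> s * s ^ (C + D)" using s by (intro mult_right_mono) auto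
    finally show "f s + g s \<le> s ^ Suc (C + D)" by simp
  qed
qed

lemma poly_bounded_power:
  assumes "poly_bounded f" shows "poly_bounded (\<lambda>s. f s ^ n)"
  by (induction n) (auto intro: poly_bounded_const poly_bounded_mult assms)

lemmas poly_bounded_intros =
  poly_bounded_const poly_bounded_id poly_bounded_mult poly_bounded_add poly_bounded_power

text \<open>Serves the union bound over polynomially many pairs, each of which fails with
  probability at most 1 / 2 ^ s.\<close>

lemma poly_bounded_le_exp:
  assumes "poly_bounded f"
  obtains s0 where "\<And>s. s \<ge> s0 \<Longrightarrow> f s \<le> 2 ^ s"
proof -
  obtain C where C: "\<forall>s\<ge>2. f s \<le> s ^ C" using assms by (auto simp: poly_bounded_def)
  have C': "\<forall>s\<ge>2. f s \<le> s ^ Suc C"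
    using C by (metis le_trans numeral_2_eq_2 power_increasing Suc_leD One_nat_def lessI less_imp_le)
  \<comment> \<open>With \<open>x ^ Suc C = 1 / 2\<close>, the power \<open>Suc C\<close> of
    \<open>s * x ^ s \<le> 1\<close> is the inequality wanted.\<close>
  define x :: real where "x = root (Suc C) (1 / 2)"
  have x: "x ^ Suc C = 1 / 2" "0 < x" "x < 1" by (auto simp: x_def real_root_pow_pos2 simp del: power_Suc)
  have "(\<lambda>n. real n * x ^ n) \<longlonglongrightarrow> 0" by (rule powser_times_n_limit_0) (use x in auto)
  then have "eventually (\<lambda>n. real n * x ^ n < 1) sequentially" by (rule order_tendstoD) simp
  then obtain N where N: "\<And>n. n \<ge> N \<Longrightarrow> real n * x ^ n < 1" by (auto simp: eventually_sequentially)
  show thesis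
  proof (rule that[of "max N 2"])
    fix s assume s: "s \<ge> max N 2"
    have "(real s * x ^ s) ^ Suc C \<le> 1" using N[of s] s x(2) by (intro power_le_one) (auto intro: less_imp_le)
    then have "real s ^ Suc C * (x ^ Suc C) ^ s \<le> 1"
      by (simp add: power_mult_distrib power_mult[symmetric] mult.commute del: power_Suc)
    then have "real s ^ Suc C \<le> 2 ^ s" unfolding x(1) by (simp add: power_one_over field_simps)
    then have "s ^ Suc C \<le> 2 ^ s" by (metis of_nat_le_iff of_nat_numeral of_nat_power)
    then show "f s \<le> 2 ^ s" using C' s by (meson le_trans max.bounded_iff)
  qed
qed

section \<open>Shattering\<close>

definition shatters :: "'b set set \<Rightarrow> 'b set \<Rightarrow> bool" where
  "shatters F Z \<longleftrightarrow> (\<forall>S\<subseteq>Z. \<exists>A\<in>F. A \<inter> Z = S)"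

lemma shattersE:
  assumes "shatters F Z" "S \<subseteq> Z" obtains A where "A \<in> F" "A \<inter> Z = S"
  using assms unfolding shatters_def by blast

text \<open>Pajor's form of the Sauer-Shelah lemma. Split the family by membership of
  \<open>x\<close>. What either half shatters is shattered by \<open>F\<close>, and a set shattered
  by both halves stays shattered after adding \<open>x\<close>, so it counts twice.\<close>

lemma pajor:
  assumes "finite X" "\<And>A. A \<in> F \<Longrightarrow> A \<subseteq> X"
  shows "card F \<le> card {Z. Z \<subseteq> X \<and> shatters F Z}"
  using assms
proof (induction X arbitrary: F rule: finite_induct)
  case empty
  then have "F \<subseteq> {{}}" by auto
  show ?case
  proof (cases "F = {}")
    case False
    then have "F = {{}}" using \<open>F \<subseteq> {{}}\<close> by auto
    then have "{Z. Z \<subseteq> {} \<and> shatters F Z} = {{}}" by (auto simp: shatters_def)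
    then show ?thesis using \<open>F = {{}}\<close> by simp
  qed simp
next
  case (insert x X)
  define F0 where "F0 = {A\<in>F. x \<notin> A}"
  define F1 where "F1 = {A. x \<notin> A \<and> insert x A \<in> F}"
  define Z0 where "Z0 = {Z. Z \<subseteq> X \<and> shatters F0 Z}"
  define Z1 where "Z1 = {Z. Z \<subseteq> X \<and> shatters F1 Z}"
  have finF: "finite F" using insert by (meson finite.insertI finite_Pow_iff finite_subset PowI subsetI)
  have "F = F0 \<union> (insert x) ` F1"
  proof (intro equalityI subsetI)
    fix A assume A: "A \<in> F"
    show "A \<in> F0 \<union> insert x ` F1"
    proof (cases "x \<in> A")
      case True
      then have "A = insert x (A - {x})" "A - {x} \<in> F1" using A by (auto simp: F1_def insert_absorb)
      then show ?thesis by blast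
    qed (use A in \<open>simp add: F0_def\<close>)
  qed (auto simp: F0_def F1_def)
  moreover have "inj_on (insert x) F1" by (auto simp: inj_on_def F1_def)
  moreover have "F0 \<inter> (insert x) ` F1 = {}" by (auto simp: F0_def)
  ultimately have cF: "card F = card F0 + card F1"
    by (metis card_Un_disjoint card_image finF finite_Un)
  have c0: "card F0 \<le> card Z0" unfolding Z0_def by (rule insert.IH) (use insert.prems in \<open>auto simp: F0_def\<close>)
  have c1: "card F1 \<le> card Z1" unfolding Z1_def by (rule insert.IH) (use insert.prems in \<open>auto simp: F1_def\<close>)
  have finZ: "finite Z0" "finite Z1" using insert.hyps(1) by (auto simp: Z0_def Z1_def)
  let ?S = "{Z. Z \<subseteq> insert x X \<and> shatters F Z}"
  have "Z0 \<union> Z1 \<subseteq> ?S"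
  proof
    fix Z assume "Z \<in> Z0 \<union> Z1"
    then show "Z \<in> ?S"
    proof
      assume "Z \<in> Z0" then show ?thesis unfolding Z0_def shatters_def F0_def by blast
    next
      assume Z: "Z \<in> Z1"
      have "\<exists>A\<in>F. A \<inter> Z = S" if "S \<subseteq> Z" for S
      proof -
        obtain A where "A \<in> F1" "A \<inter> Z = S"
          using Z \<open>S \<subseteq> Z\<close> shattersE[of F1 Z S] unfolding Z1_def by blast
        moreover have "x \<notin> Z" using Z insert.hyps by (auto simp: Z1_def)
        ultimately show ?thesis by (intro bexI[of _ "insert x A"]) (auto simp: F1_def)
      qed
      then have "shatters F Z" unfolding shatters_def by blast
      then show ?thesis using Z by (simp add: Z1_def subset_insertI2)
    qed
  qed
  moreover have "insert x ` (Z0 \<inter> Z1) \<subseteq> ?S"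
  proof
    fix Z' assume "Z' \<in> insert x ` (Z0 \<inter> Z1)"
    then obtain Z where Z: "Z \<in> Z0" "Z \<in> Z1" "Z' = insert x Z" by auto
    have xZ: "x \<notin> Z" using Z insert.hyps by (auto simp: Z1_def)
    have "\<exists>A\<in>F. A \<inter> Z' = S" if "S \<subseteq> Z'" for S
    proof (cases "x \<in> S")
      case True
      have "shatters F1 Z" "S - {x} \<subseteq> Z" using Z(2,3) that by (auto simp: Z1_def)
      then obtain A where "A \<in> F1" "A \<inter> Z = S - {x}" by (rule shattersE)
      then have "insert x A \<in> F" "insert x A \<inter> Z' = S" using True Z(3) by (auto simp: F1_def)
      then show ?thesis by blast
    next
      case False
      have "shatters F0 Z" "S \<subseteq> Z" using Z(1,3) that False by (auto simp: Z0_def)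
      then obtain A where "A \<in> F0" "A \<inter> Z = S" by (rule shattersE)
      then have "A \<in> F" "A \<inter> Z' = S" using Z(3) by (auto simp: F0_def)
      then show ?thesis by blast
    qed
    then have "shatters F Z'" unfolding shatters_def by blast
    then show "Z' \<in> ?S" using Z by (auto simp: Z1_def)
  qed
  ultimately have "(Z0 \<union> Z1) \<union> insert x ` (Z0 \<inter> Z1) \<subseteq> ?S" by blast
  then have "card ((Z0 \<union> Z1) \<union> insert x ` (Z0 \<inter> Z1)) \<le> card ?S"
    by (intro card_mono) (use insert.hyps in auto)
  moreover have "card ((Z0 \<union> Z1) \<union> insert x ` (Z0 \<inter> Z1)) = card (Z0 \<union> Z1) + card (insert x ` (Z0 \<inter> Z1))"
    using finZ insert.hyps by (intro card_Un_disjoint) (auto simp: Z0_def Z1_def)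
  moreover have "card (insert x ` (Z0 \<inter> Z1)) = card (Z0 \<inter> Z1)"
  proof (rule card_image, rule inj_onI)
    fix A B assume "A \<in> Z0 \<inter> Z1" "B \<in> Z0 \<inter> Z1" and eq: "insert x A = insert x B"
    then have "x \<notin> A" "x \<notin> B" using insert.hyps by (auto simp: Z0_def)
    then show "A = B" using eq by (simp add: insert_ident)
  qed
  moreover have "card (Z0 \<union> Z1) + card (Z0 \<inter> Z1) = card Z0 + card Z1"
    using finZ by (metis card_Un_Int)
  ultimately show ?case using cF c0 c1 by simp
qed

lemma card_small_subsets:
  assumes "finite X"
  shows "card {Z. Z \<subseteq> X \<and> card Z \<le> v} \<le> (card X + 1) ^ v"
proof (induction v)
  case 0
  have "{Z. Z \<subseteq> X \<and> card Z \<le> 0} = {{}}" using assms finite_subset by fastforce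
  then show ?case by simp
next
  case (Suc v)
  let ?A = "{Z. Z \<subseteq> X \<and> card Z \<le> v}"
  have fin: "finite ?A" using assms by simp
  have "{Z. Z \<subseteq> X \<and> card Z \<le> Suc v} \<subseteq> ?A \<union> (\<lambda>(x, Z). insert x Z) ` (X \<times> ?A)"
  proof
    fix Z assume Z: "Z \<in> {Z. Z \<subseteq> X \<and> card Z \<le> Suc v}"
    show "Z \<in> ?A \<union> (\<lambda>(x, Z). insert x Z) ` (X \<times> ?A)"
    proof (cases "card Z \<le> v")
      case True then show ?thesis using Z by auto
    next
      case False
      then obtain x where x: "x \<in> Z" by fastforce
      have "card (Z - {x}) \<le> v" using Z x by (auto simp: card_Diff_singleton le_diff_conv)
      then have "(x, Z - {x}) \<in> X \<times> ?A" using Z x by auto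
      moreover have "Z = (\<lambda>(x, Z). insert x Z) (x, Z - {x})" using x by auto
      ultimately show ?thesis by blast
    qed
  qed
  then have "card {Z. Z \<subseteq> X \<and> card Z \<le> Suc v} \<le> card (?A \<union> (\<lambda>(x, Z). insert x Z) ` (X \<times> ?A))"
    using assms fin by (intro card_mono) auto
  also have "\<dots> \<le> card ?A + card (X \<times> ?A)"
  proof -
    have "card ((\<lambda>(x, Z). insert x Z) ` (X \<times> ?A)) \<le> card (X \<times> ?A)"
      by (rule card_image_le) (use assms fin in blast)
    then show ?thesis using card_Un_le[of ?A "(\<lambda>(x, Z). insert x Z) ` (X \<times> ?A)"] by linarith
  qed
  also have "\<dots> = (card X + 1) * card ?A" by (simp add: card_cartesian_product)
  also have "\<dots> \<le> (card X + 1) * (card X + 1) ^ v" using Suc by (intro mult_left_mono) auto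
  finally show ?case by simp
qed

lemma pigeonhole_fiber':
  assumes "finite J" "finite B" "f ` J \<subseteq> B" "B \<noteq> {}"
  shows "\<exists>b\<in>B. card J \<le> card B * card {j\<in>J. f j = b}"
proof (rule ccontr)
  assume "\<not> ?thesis"
  then have less: "card B * card {j\<in>J. f j = b} < card J" if "b \<in> B" for b using that by auto
  have "card B * card J = (\<Sum>b\<in>B. card B * card {j\<in>J. f j = b})"
    using sum.group[of J B f "\<lambda>_. 1::nat"] assms by (simp add: sum_distrib_left[symmetric])
  also have "\<dots> < (\<Sum>b\<in>B. card J)" using less assms by (intro sum_strict_mono) auto
  finally show False by simp
qed

lemma pigeonhole_fiber:
  assumes "finite J" "finite B" "f ` J \<subseteq> B" "L * card B \<le> card J" "B \<noteq> {}"
  shows "\<exists>b\<in>B. L \<le> card {j\<in>J. f j = b}"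
proof -
  obtain b where b: "b \<in> B" "card J \<le> card B * card {j\<in>J. f j = b}"
    using pigeonhole_fiber'[of J B f] assms by blast
  then have "card B * L \<le> card B * card {j\<in>J. f j = b}" using assms(4) by (metis le_trans mult.commute)
  moreover have "0 < card B" using assms by (simp add: card_gt_0_iff)
  ultimately have "L \<le> card {j\<in>J. f j = b}" by (metis mult_le_cancel1)
  then show ?thesis using b(1) by blast
qed

text \<open>A family with many members is cut into many pieces, each large enough to shatter some set of
  size \<open>v\<close>; a set shattered by \<open>L\<close> of the pieces has every trace attained \<open>L\<close> times.\<close>

lemma sauer_shelah_robust:
  fixes tr :: "'a \<Rightarrow> 'b set"
  assumes "finite X" "X \<noteq> {}" and inj: "inj_on tr A" and tr: "\<And>a. a \<in> A \<Longrightarrow> tr a \<subseteq> X" and finA: "finite A"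
    and v: "v \<ge> 1" and L: "L \<ge> 1" and big: "L * (card X + 1) ^ (2 * v) \<le> card A"
  shows "\<exists>Z\<subseteq>X. card Z = v \<and> (\<forall>S\<subseteq>Z. L \<le> card {a\<in>A. tr a \<inter> Z = S})"
proof -
  \<comment> \<open>\<open>q\<close> exceeds the number of subsets smaller than \<open>v\<close>, so
    \<open>q\<close> distinct traces shatter a set of size \<open>v\<close>. It also bounds the
    number of candidates for that set, so among \<open>L * q\<close> pieces some candidate occurs
    \<open>L\<close> times.\<close>
  define q where "q = (card X + 1) ^ v"
  define B where "B = {Z. Z \<subseteq> X \<and> card Z \<le> v}"
  have cX: "card X \<ge> 1" using assms by (simp add: Suc_le_eq card_gt_0_iff)
  have q: "q \<ge> 1" by (simp add: q_def)
  have "(L * q) * q \<le> card A" using big by (simp add: q_def mult_2 power_add mult.assoc)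
  then obtain h where h: "inj_on h {..<(L * q) * q}" "h ` {..<(L * q) * q} \<subseteq> A"
    by (metis card_le_inj card_lessThan finA finite_lessThan)
  define part where "part i = h ` {i * q..<(i + 1) * q}" for i
  have lt: "{i * q..<(i + 1) * q} \<subseteq> {..<(L * q) * q}" if "i < L * q" for i
  proof -
    have "(i + 1) * q \<le> (L * q) * q" using that by (intro mult_right_mono) auto
    then show ?thesis by auto
  qed
  have partA: "part i \<subseteq> A" if "i < L * q" for i using lt[OF that] h(2) by (auto simp: part_def)
  have card_part: "card (part i) = q" if "i < L * q" for i
    unfolding part_def using inj_on_subset[OF h(1) lt[OF that]] by (simp add: card_image)
  have part_inj: "i = j" if "a \<in> part i" "a \<in> part j" "i < L * q" "j < L * q" for a i j
  proof -
    obtain x y where xy: "x \<in> {i * q..<(i + 1) * q}" "h x = a" "y \<in> {j * q..<(j + 1) * q}" "h y = a"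
      using \<open>a \<in> part i\<close> \<open>a \<in> part j\<close> by (auto simp: part_def)
    have "x \<in> {..<(L * q) * q}" "y \<in> {..<(L * q) * q}" using lt[OF that(3)] lt[OF that(4)] xy(1,3) by blast+
    then have "x = y" using h(1) xy(2,4) by (auto dest: inj_onD)
    moreover have "x div q = i" "y div q = j" using xy q by (auto intro!: div_nat_eqI simp: mult.commute)
    ultimately show ?thesis by simp
  qed
  have "\<exists>Z\<in>B. card Z = v \<and> shatters (tr ` part i) Z" if i: "i < L * q" for i
  proof -
    have sub: "\<And>Y. Y \<in> tr ` part i \<Longrightarrow> Y \<subseteq> X" using tr partA[OF i] by auto
    have "card (tr ` part i) = q" using card_part[OF i] inj_on_subset[OF inj partA[OF i]] by (simp add: card_image)
    then have *: "q \<le> card {Z. Z \<subseteq> X \<and> shatters (tr ` part i) Z}" using pajor[of X "tr ` part i"] sub \<open>finite X\<close> by simp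
    have "\<exists>Z\<subseteq>X. shatters (tr ` part i) Z \<and> v \<le> card Z"
    proof (rule ccontr)
      assume "\<not> ?thesis"
      then have "\<not> v \<le> card Z" if "Z \<subseteq> X" "shatters (tr ` part i) Z" for Z using that by blast
      then have sub: "{Z. Z \<subseteq> X \<and> shatters (tr ` part i) Z} \<subseteq> {Z. Z \<subseteq> X \<and> card Z \<le> v - 1}"
        using v by (simp add: subset_iff not_le less_eq_Suc_le le_diff_conv2)
      have "finite {Z. Z \<subseteq> X \<and> card Z \<le> v - 1}" using \<open>finite X\<close> by simp
      from * card_mono[OF this sub] have "q \<le> card {Z. Z \<subseteq> X \<and> card Z \<le> v - 1}" by linarith
      also have "\<dots> \<le> (card X + 1) ^ (v - 1)" by (rule card_small_subsets) fact
      also have "\<dots> < q" unfolding q_def using cX v by (intro power_strict_increasing) auto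
      finally show False by simp
    qed
    then obtain Z where Z: "Z \<subseteq> X" "shatters (tr ` part i) Z" "v \<le> card Z" by blast
    then obtain Z' where Z': "Z' \<subseteq> Z" "card Z' = v" by (meson obtain_subset_with_card_n)
    have "shatters (tr ` part i) Z'" unfolding shatters_def
    proof (intro allI impI)
      fix S assume S: "S \<subseteq> Z'"
      then obtain Y where Y: "Y \<in> tr ` part i" "Y \<inter> Z = S" using Z(2) Z'(1) by (meson order_trans shattersE)
      then show "\<exists>Y\<in>tr ` part i. Y \<inter> Z' = S" using S Z'(1) by (intro bexI[of _ Y]) auto
    qed
    then show ?thesis using Z Z' by (auto simp: B_def)
  qed
  then obtain Zf where Zf: "\<And>i. i < L * q \<Longrightarrow> Zf i \<in> B \<and> card (Zf i) = v \<and> shatters (tr ` part i) (Zf i)" by metis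
  have finB: "finite B" using \<open>finite X\<close> by (simp add: B_def)
  have "card B \<le> q" unfolding B_def q_def by (rule card_small_subsets) fact
    then have "\<exists>Z\<in>B. L \<le> card {i\<in>{..<L * q}. Zf i = Z}"
      using finB Zf by (intro pigeonhole_fiber) (auto simp: B_def)
    then obtain Z where Z: "Z \<in> B" "L \<le> card {i\<in>{..<L * q}. Zf i = Z}" by blast
    let ?J = "{i\<in>{..<L * q}. Zf i = Z}"
    have "?J \<noteq> {}" using Z(2) L by (metis card.empty not_one_le_zero le_trans)
    then obtain i where "i < L * q" "Zf i = Z" by blast
    then have cZ: "card Z = v" "Z \<subseteq> X" using Zf[of i] Z(1) by (auto simp: B_def)
    have "L \<le> card {a\<in>A. tr a \<inter> Z = S}" if S: "S \<subseteq> Z" for S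
    proof -
      have "\<exists>a\<in>part i. tr a \<inter> Z = S" if "i \<in> ?J" for i
      proof -
        have "shatters (tr ` part i) Z" using Zf[of i] that by auto
        then obtain Y where "Y \<in> tr ` part i" "Y \<inter> Z = S" using S by (rule shattersE)
        then show ?thesis by blast
      qed
      then obtain g where g: "\<And>i. i \<in> ?J \<Longrightarrow> g i \<in> part i \<and> tr (g i) \<inter> Z = S" by metis
      have "inj_on g ?J" using g part_inj by (intro inj_onI) (metis (no_types, lifting) lessThan_iff mem_Collect_eq)
      moreover have "g ` ?J \<subseteq> {a\<in>A. tr a \<inter> Z = S}" using g partA by blast
      ultimately have "card ?J \<le> card {a\<in>A. tr a \<inter> Z = S}" using finA by (intro card_inj_on_le) auto
      then show ?thesis using Z(2) by simp
    qed
    then show ?thesis using cZ by blast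
qed

section \<open>Bicliques and shattered neighbourhoods\<close>

lemma ex_maximizer:
  fixes f :: "'b \<Rightarrow> 'c :: linorder"
  assumes "finite S" "S \<noteq> {}" shows "\<exists>x\<in>S. \<forall>y\<in>S. f y \<le> f x"
proof -
  have "Max (f ` S) \<in> f ` S" using assms by (intro Max_in) auto
  then obtain x where x: "x \<in> S" "Max (f ` S) = f x" by blast
  have "f y \<le> f x" if "y \<in> S" for y unfolding x(2)[symmetric] using assms that by (intro Max_ge) auto
  then show ?thesis using x(1) by blast
qed

text \<open>A bare relation rather than a digraph, because the locale is interpreted again for
  auxiliary graphs on the same vertices: the enlarged relation \<open>U\<close> to which Shearer's
  method is applied, and the sampled relation \<open>F g\<close>.\<close>

locale sym_rel =
  fixes E :: "'a \<Rightarrow> 'a \<Rightarrow> bool"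
  assumes sym: "E x y \<Longrightarrow> E y x" and irrefl: "\<not> E x x"
begin

definition nb :: "'a set \<Rightarrow> 'a \<Rightarrow> 'a set" where "nb Y x = {y\<in>Y. E x y}"

definition indep :: "'a set \<Rightarrow> bool" where "indep S \<longleftrightarrow> (\<forall>x\<in>S. \<forall>y\<in>S. \<not> E x y)"

text \<open>By irreflexivity two completely joined sets are disjoint, so \<open>P\<close> and
  \<open>Q\<close> may range over all sets of size \<open>s\<close>.\<close>

definition biclique_free :: "nat \<Rightarrow> bool" where
  "biclique_free s \<longleftrightarrow> (\<forall>P Q. card P = s \<longrightarrow> card Q = s \<longrightarrow> (\<exists>p\<in>P. \<exists>q\<in>Q. \<not> E p q))"

lemma nb_subset: "nb Y x \<subseteq> Y" by (auto simp: nb_def)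

lemma finite_nb [simp, intro]: "finite Y \<Longrightarrow> finite (nb Y x)" by (simp add: nb_def)

lemma biclique_freeD:
  assumes "biclique_free s" "s \<le> card P" "s \<le> card Q"
  shows "\<exists>p\<in>P. \<exists>q\<in>Q. \<not> E p q"
proof -
  obtain P' where P': "P' \<subseteq> P" "card P' = s" using assms(2) by (meson obtain_subset_with_card_n)
  obtain Q' where Q': "Q' \<subseteq> Q" "card Q' = s" using assms(3) by (meson obtain_subset_with_card_n)
  have "\<exists>p\<in>P'. \<exists>q\<in>Q'. \<not> E p q" using assms(1) P'(2) Q'(2) unfolding biclique_free_def by blast
  then show ?thesis using P'(1) Q'(1) by blast
qed

text \<open>If \<open>s\<close> vertices each missed less than a fraction 1 / (2 s) of
  \<open>X\<close>, they would have half of \<open>X\<close>, hence at least \<open>s\<close>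
  elements, as common neighbours.\<close>

lemma few_dominating:
  assumes bf: "biclique_free s" and s: "s \<ge> 1" and fin: "finite V" "finite X" and big: "2 * s \<le> card X"
  shows "card {v\<in>V. 2 * s * card (X - nb X v) < card X} < s"
proof (rule ccontr)
  assume "\<not> ?thesis"
  then obtain D where D: "D \<subseteq> {v\<in>V. 2 * s * card (X - nb X v) < card X}" "card D = s"
    by (meson not_less obtain_subset_with_card_n)
  define Q where "Q = X - (\<Union>v\<in>D. X - nb X v)"
  have finD: "finite D" using D s by (metis card.infinite not_one_le_zero)
  have "2 * s * card (\<Union>v\<in>D. X - nb X v) \<le> 2 * s * (\<Sum>v\<in>D. card (X - nb X v))"
    using finD by (intro mult_left_mono card_UN_le) auto
  also have "\<dots> = (\<Sum>v\<in>D. 2 * s * card (X - nb X v))" by (simp add: sum_distrib_left)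
  also have "\<dots> \<le> (\<Sum>v\<in>D. card X)" using D by (intro sum_mono) auto
  also have "\<dots> = s * card X" using D by simp
  finally have "2 * card (\<Union>v\<in>D. X - nb X v) \<le> card X" using s by simp
  moreover have "card Q \<ge> card X - card (\<Union>v\<in>D. X - nb X v)"
    unfolding Q_def by (intro diff_card_le_card_Diff) (use finD fin in auto)
  ultimately have "s \<le> card Q" using big by linarith
  then obtain p q where "p \<in> D" "q \<in> Q" "\<not> E p q" using biclique_freeD[OF bf, of D Q] D by auto
  then show False by (auto simp: Q_def nb_def)
qed

text \<open>Greedy choice: for each remaining set fewer than \<open>s\<close> candidates are bad,
  and a good candidate leaves at least a fraction 1 / (2 s) of every remaining set. The chosen
  elements may coincide; where distinctness matters it is read off from adjacencies.\<close>

lemma indep_transversal: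
  assumes bf: "biclique_free s" and s: "s \<ge> 1"
    and "finite I" "\<And>i. i \<in> I \<Longrightarrow> finite (X i)" "\<And>i. i \<in> I \<Longrightarrow> card I * (2 * s) ^ card I \<le> card (X i)"
  shows "\<exists>x. (\<forall>i\<in>I. x i \<in> X i) \<and> (\<forall>i\<in>I. \<forall>j\<in>I. \<not> E (x i) (x j))"
  using assms(3-)
proof (induction I arbitrary: X rule: finite_induct)
  case empty
  then show ?case by simp
next
  case (insert i I)
  define m where "m = card I"
  have cI: "card (insert i I) = Suc m" using insert by (simp add: m_def)
  define bad where "bad j = {v\<in>X i. 2 * s * card (X j - nb (X j) v) < card (X j)}" for j
  have large: "Suc m * (2 * s) ^ Suc m \<le> card (X j)" if "j \<in> insert i I" for j
    using insert.prems(2)[OF that] by (simp add: cI)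
  have fin: "finite (X j)" if "j \<in> insert i I" for j using insert.prems that by blast
  have p1: "1 \<le> (2 * s) ^ m" using s by simp
  have "2 * s \<le> (2 * s) ^ Suc m" using p1 unfolding power_Suc by (metis mult_le_mono2 mult.right_neutral)
  also have "\<dots> \<le> Suc m * (2 * s) ^ Suc m" by (simp only: mult_Suc le_add1)
  finally have "2 * s \<le> Suc m * (2 * s) ^ Suc m" .
  then have badc: "card (bad j) < s" if "j \<in> I" for j
    unfolding bad_def using large[of j] that by (intro few_dominating bf s fin) auto
  have "card (\<Union>j\<in>I. bad j) \<le> (\<Sum>j\<in>I. card (bad j))" using insert.hyps by (intro card_UN_le)
  also have "\<dots> \<le> m * s" unfolding m_def using badc by (intro sum_bounded_above[THEN order_trans]) (auto intro: less_imp_le)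
  also have "\<dots> < Suc m * (2 * s) ^ Suc m"
  proof -
    have "m * s < Suc m * (2 * s)" using s by simp
    also have "\<dots> \<le> Suc m * (2 * s) ^ Suc m"
      using p1 unfolding power_Suc by (metis mult_le_mono2 mult.right_neutral)
    finally show ?thesis .
  qed
  also have "\<dots> \<le> card (X i)" by (rule large) simp
  finally have "card (\<Union>j\<in>I. bad j) < card (X i)" .
  moreover have "finite (\<Union>j\<in>I. bad j)" using insert.hyps fin by (auto simp: bad_def)
  ultimately obtain v where v: "v \<in> X i" "v \<notin> (\<Union>j\<in>I. bad j)" by (metis card_mono not_less subsetI)
  define X' where "X' j = X j - nb (X j) v" for j
  have "m * (2 * s) ^ m \<le> card (X' j)" if j: "j \<in> I" for j
  proof -
    have "card (X j) \<le> 2 * s * card (X' j)" using v j by (auto simp: bad_def X'_def)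
    then have "2 * s * (Suc m * (2 * s) ^ m) \<le> 2 * s * card (X' j)" using large[of j] j by (simp add: algebra_simps)
    then have "Suc m * (2 * s) ^ m \<le> card (X' j)" using s by simp
    then show ?thesis by simp
  qed
  then have "\<exists>x. (\<forall>i\<in>I. x i \<in> X' i) \<and> (\<forall>i\<in>I. \<forall>j\<in>I. \<not> E (x i) (x j))"
    using insert.prems by (intro insert.IH) (auto simp: X'_def m_def)
  then obtain x where x: "\<And>j. j \<in> I \<Longrightarrow> x j \<in> X' j" "\<And>j k. j \<in> I \<Longrightarrow> k \<in> I \<Longrightarrow> \<not> E (x j) (x k)" by blast
  have xv: "\<not> E v (x j)" "\<not> E (x j) v" if "j \<in> I" for j using x(1)[OF that] sym by (auto simp: X'_def nb_def)
  have ne: "j \<noteq> i" if "j \<in> I" for j using that insert.hyps by auto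
  show ?case
  proof (intro exI[of _ "x(i := v)"] conjI ballI)
    fix j assume "j \<in> insert i I"
    then show "(x(i := v)) j \<in> X j" using v x(1)[of j] by (auto simp: X'_def)
  next
    fix j k assume "j \<in> insert i I" "k \<in> insert i I"
    then show "\<not> E ((x(i := v)) j) ((x(i := v)) k)"
      using x(2)[of j k] xv[of j] xv[of k] irrefl[of v] by auto
  qed
qed

text \<open>\<open>F\<close> is the edge relation of a graph on \<open>A\<close> whose 1-subdivision is induced in \<open>E\<close>, with \<open>w a b\<close>
  the vertex on the edge \<open>ab\<close>. The \<open>w a b\<close> of distinct edges are distinct, as their neighbourhoods in \<open>A\<close> differ.\<close>

definition subdivided :: "'a set \<Rightarrow> ('a \<Rightarrow> 'a \<Rightarrow> bool) \<Rightarrow> ('a \<Rightarrow> 'a \<Rightarrow> 'a) \<Rightarrow> bool" where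
  "subdivided A F w \<longleftrightarrow> indep A \<and>
     (\<forall>a b. F a b \<longrightarrow> a \<in> A \<and> b \<in> A \<and> a \<noteq> b \<and> F b a \<and> w a b = w b a \<and> nb A (w a b) = {a, b}) \<and>
     (\<forall>a b c d. F a b \<longrightarrow> F c d \<longrightarrow> \<not> E (w a b) (w c d))"

text \<open>\<open>S\<close> is only a subgraph of the graph \<open>F\<close>, not an induced one.
  Edges of \<open>F\<close> outside \<open>S\<close> disappear by leaving out their vertices
  \<open>w a b\<close>, so subdividing every edge of \<open>S\<close> once more gives an induced
  subgraph of \<open>E\<close>.\<close>

definition has_Krt :: "nat \<Rightarrow> nat \<Rightarrow> 'a set \<Rightarrow> bool" where
  "has_Krt r t V \<longleftrightarrow> (\<exists>A F w K S. finite A \<and> A \<subseteq> V \<and> (\<forall>a b. F a b \<longrightarrow> w a b \<in> V) \<and> subdivided A F w \<and>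
     complete_bipartite_digraph r t (with_proj K) \<and> subdivision_pair K S \<and>
     pverts S \<subseteq> A \<and> parcs S \<subseteq> {(a, b). F a b})"

text \<open>Let \<open>B\<close> be a maximal family with pairwise distant traces; every member of
  \<open>A\<close> is then close to some \<open>b\<close> in \<open>B\<close>. At most
  \<open>s\<close> are close to the same \<open>b\<close>: otherwise \<open>s\<close> of them would
  have half of \<open>nb Y b\<close> in common, which is at least \<open>s\<close> elements.\<close>

lemma separated_subfamily:
  assumes bf: "biclique_free s" and s: "s \<ge> 1" and c: "c \<ge> 1" and fin: "finite A" "finite Y"
    and dense: "\<And>a. a \<in> A \<Longrightarrow> card Y \<le> c * card (nb Y a)" and big: "2 * c * s \<le> card Y"
  defines "D \<equiv> \<lambda>a b. (nb Y a - nb Y b) \<union> (nb Y b - nb Y a)"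
  shows "\<exists>B\<subseteq>A. card A \<le> s * card B \<and> (\<forall>a\<in>B. \<forall>b\<in>B. a \<noteq> b \<longrightarrow> card Y \<le> 2 * c * s * card (D a b))"
proof -
  define sep where "sep B \<longleftrightarrow> B \<subseteq> A \<and> (\<forall>a\<in>B. \<forall>b\<in>B. a \<noteq> b \<longrightarrow> card Y \<le> 2 * c * s * card (D a b))" for B
  have "finite {B. sep B}" by (rule finite_subset[of _ "Pow A"]) (auto simp: sep_def fin)
  moreover have "sep {}" by (simp add: sep_def)
  ultimately obtain B where B: "sep B" "\<And>B'. sep B' \<Longrightarrow> card B' \<le> card B"
    using ex_maximizer[of "{B. sep B}" card] by blast
  have BA: "B \<subseteq> A" "finite B" using B(1) fin by (auto simp: sep_def intro: finite_subset)
  define cl where "cl b = {a\<in>A. a = b \<or> 2 * c * s * card (D b a) < card Y}" for b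
  have symD: "D a b = D b a" for a b by (auto simp: D_def)
  have "A \<subseteq> (\<Union>b\<in>B. cl b)"
  proof
    fix a assume a: "a \<in> A"
    show "a \<in> (\<Union>b\<in>B. cl b)"
    proof (rule ccontr)
      assume na: "a \<notin> (\<Union>b\<in>B. cl b)"
      then have "a \<notin> B" using a by (auto simp: cl_def)
      have far: "card Y \<le> 2 * c * s * card (D b a)" if "b \<in> B" for b
        using na a that by (auto simp: cl_def)
      then have "sep (insert a B)"
        using a B(1) unfolding sep_def by (metis insertE insert_subset symD)
      then show False using B(2) \<open>a \<notin> B\<close> BA by fastforce
    qed
  qed
  then have "card A \<le> card (\<Union>b\<in>B. cl b)" using BA fin by (intro card_mono) (auto simp: cl_def)
  also have "\<dots> \<le> (\<Sum>b\<in>B. card (cl b))" using BA by (intro card_UN_le)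
  also have "\<dots> \<le> (\<Sum>b\<in>B. s)"
  proof (rule sum_mono)
    fix b assume b: "b \<in> B"
    show "card (cl b) \<le> s"
    proof (rule ccontr)
      assume "\<not> ?thesis"
      then obtain P where P: "P \<subseteq> cl b" "card P = s" by (meson nat_le_linear obtain_subset_with_card_n)
      have finP: "finite P" using P s by (metis card.infinite not_one_le_zero)
      define Q where "Q = nb Y b - (\<Union>a\<in>P. nb Y b - nb Y a)"
      have "2 * c * s * card (nb Y b - nb Y a) \<le> card Y" if "a \<in> P" for a
      proof (cases "a = b")
        case False
        then have "2 * c * s * card (D b a) < card Y" using P that by (auto simp: cl_def)
        moreover have "card (nb Y b - nb Y a) \<le> card (D b a)" using fin by (intro card_mono) (auto simp: D_def)
        ultimately show ?thesis by (meson le_trans less_imp_le mult_le_mono2)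
      qed simp
      then have "(\<Sum>a\<in>P. 2 * c * s * card (nb Y b - nb Y a)) \<le> s * card Y"
        using sum_bounded_above[of P "\<lambda>a. 2 * c * s * card (nb Y b - nb Y a)" "card Y"] P by simp
      then have "s * (2 * c * (\<Sum>a\<in>P. card (nb Y b - nb Y a))) \<le> s * card Y"
        by (simp add: sum_distrib_left algebra_simps)
      then have "2 * c * (\<Sum>a\<in>P. card (nb Y b - nb Y a)) \<le> card Y" using s by simp
      moreover have "card (\<Union>a\<in>P. nb Y b - nb Y a) \<le> (\<Sum>a\<in>P. card (nb Y b - nb Y a))"
        using finP by (intro card_UN_le)
      ultimately have u: "2 * c * card (\<Union>a\<in>P. nb Y b - nb Y a) \<le> card Y"
        by (meson le_trans mult_le_mono2)
      have "card (nb Y b) - card (\<Union>a\<in>P. nb Y b - nb Y a) \<le> card Q"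
        unfolding Q_def by (intro diff_card_le_card_Diff) (use finP fin in auto)
      then have "2 * c * card (nb Y b) \<le> 2 * c * card Q + 2 * c * card (\<Union>a\<in>P. nb Y b - nb Y a)"
        by (metis le_diff_conv distrib_left mult_le_mono2)
      moreover have "2 * card Y \<le> 2 * c * card (nb Y b)" using dense[of b] b BA by auto
      ultimately have "card Y \<le> 2 * c * card Q" using u by linarith
      then have "2 * c * s \<le> 2 * c * card Q" using big by linarith
      then have "s \<le> card Q" using c by simp
      then obtain p q where "p \<in> P" "q \<in> Q" "\<not> E p q" using biclique_freeD[OF bf, of P Q] P by auto
      then show False by (auto simp: Q_def nb_def)
    qed
  qed
  also have "\<dots> = s * card B" by simp
  finally show ?thesis using B(1) by (auto simp: sep_def)
qed

end

section \<open>Random samples that separate neighbourhoods\<close>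

lemma two_mult_pred_power_le:
  assumes "x \<ge> (2::nat)" shows "2 * (x - 1) ^ x \<le> x ^ x"
proof -
  have "1 + real x * (1 / real (x - 1)) \<le> (1 + 1 / real (x - 1)) ^ x"
    by (rule Bernoulli_inequality) (simp add: order_trans[of _ 0])
  moreover have "1 + 1 / real (x - 1) = real x / real (x - 1)" using assms by (simp add: field_simps of_nat_diff)
  moreover have "2 \<le> 1 + real x * (1 / real (x - 1))" using assms by (simp add: field_simps of_nat_diff)
  ultimately have "2 \<le> (real x / real (x - 1)) ^ x" by simp
  then have "2 * real (x - 1) ^ x \<le> real x ^ x" using assms by (simp add: power_divide field_simps)
  then have "real (2 * (x - 1) ^ x) \<le> real (x ^ x)" by simp
  then show ?thesis using of_nat_le_iff by blast
qed

text \<open>\<open>f\<close> is a sample of \<open>x * s\<close> points with repetition. It misses a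
  set of density at least 1 / x with probability at most (1 - 1 / x) ^ (x s), which is at most 1 / 2
  ^ s, and a union bound over the pairs leaves half of the samples.\<close>

lemma sampling_separates:
  fixes Y :: "'a set"
  assumes fin: "finite Y" "finite B" and x: "x \<ge> 2"
    and D: "\<And>a b. a \<in> B \<Longrightarrow> b \<in> B \<Longrightarrow> a \<noteq> b \<Longrightarrow> D a b \<subseteq> Y \<and> card Y \<le> x * card (D a b)"
    and large: "2 * (card B)\<^sup>2 \<le> 2 ^ s"
  shows "card Y ^ (x * s) \<le> 2 * card {f \<in> PiE {..<x * s} (\<lambda>_. Y). \<forall>a\<in>B. \<forall>b\<in>B. a \<noteq> b \<longrightarrow> (\<exists>i<x * s. f i \<in> D a b)}"
    (is "_ \<le> 2 * card ?G")
proof -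
  define m where "m = x * s"
  define P where "P = PiE {..<m} (\<lambda>_. Y)"
  have cP: "card P = card Y ^ m" by (simp add: P_def card_PiE)
  have finP: "finite P" unfolding P_def by (intro finite_PiE) (use fin in auto)
  define bad where "bad = (\<lambda>(a, b). PiE {..<m} (\<lambda>_. Y - D a b))"
  define I where "I = {(a, b) \<in> B \<times> B. a \<noteq> b}"
  have finI: "finite I" using fin by (auto simp: I_def intro: finite_subset[of _ "B \<times> B"])
  have cI: "card I \<le> (card B)\<^sup>2"
    using card_mono[of "B \<times> B" I] fin by (auto simp: I_def card_cartesian_product power2_eq_square)
  have bad: "x ^ m * card (bad p) \<le> (x - 1) ^ m * card Y ^ m" if "p \<in> I" for p
  proof -
    obtain a b where p: "p = (a, b)" by (cases p)
    then have ab: "p = (a, b)" "a \<in> B" "b \<in> B" "a \<noteq> b" using that by (auto simp: I_def)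
    have "card (bad p) = (card (Y - D a b)) ^ m" by (simp add: bad_def ab card_PiE)
    moreover have "x * card (Y - D a b) \<le> (x - 1) * card Y"
    proof -
      have "card (Y - D a b) = card Y - card (D a b)"
        using D[OF ab(2-4)] fin by (intro card_Diff_subset) (auto intro: finite_subset)
      then show ?thesis using D[OF ab(2-4)] by (auto simp: diff_mult_distrib diff_mult_distrib2 intro!: diff_le_mono2)
    qed
    ultimately show ?thesis by (metis power_mono power_mult_distrib zero_le)
  qed
  have "P - ?G \<subseteq> (\<Union>p\<in>I. bad p)"
  proof
    fix f assume f: "f \<in> P - ?G"
    then obtain a b where ab: "a \<in> B" "b \<in> B" "a \<noteq> b" "\<forall>i<m. f i \<notin> D a b" by (auto simp: P_def m_def)
    then have "f \<in> bad (a, b)" using f by (auto simp: bad_def P_def PiE_iff)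
    moreover have "(a, b) \<in> I" using ab by (simp add: I_def)
    ultimately show "f \<in> (\<Union>p\<in>I. bad p)" by blast
  qed
  then have "card (P - ?G) \<le> card (\<Union>p\<in>I. bad p)"
    by (intro card_mono) (use finI fin in \<open>auto simp: bad_def intro!: finite_PiE\<close>)
  also have "\<dots> \<le> (\<Sum>p\<in>I. card (bad p))" using finI by (rule card_UN_le)
  finally have "x ^ m * card (P - ?G) \<le> (\<Sum>p\<in>I. x ^ m * card (bad p))"
    by (simp add: sum_distrib_left[symmetric])
  also have "\<dots> \<le> (\<Sum>p\<in>I. (x - 1) ^ m * card Y ^ m)" using bad by (rule sum_mono)
  also have "\<dots> \<le> (card B)\<^sup>2 * ((x - 1) ^ m * card Y ^ m)" using cI by simp
  finally have "2 * (x ^ m * card (P - ?G)) \<le> (2 * (card B)\<^sup>2) * (x - 1) ^ m * card Y ^ m" by simp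
  also have "\<dots> \<le> 2 ^ s * (x - 1) ^ m * card Y ^ m" using large by (intro mult_right_mono) auto
  also have "2 ^ s * (x - 1) ^ m = (2 * (x - 1) ^ x) ^ s" by (simp add: m_def power_mult power_mult_distrib)
  also have "\<dots> \<le> (x ^ x) ^ s" using two_mult_pred_power_le[OF x] by (rule power_mono) simp
  also have "\<dots> = x ^ m" by (simp add: m_def power_mult)
  finally have "x ^ m * (2 * card (P - ?G)) \<le> x ^ m * card Y ^ m" by (simp add: mult_right_mono mult.left_commute)
  then have "2 * card (P - ?G) \<le> card Y ^ m" using x by simp
  moreover have "card (P - ?G) = card P - card ?G"
    using finP by (intro card_Diff_subset) (auto simp: P_def m_def intro: finite_subset)
  ultimately show ?thesis using cP unfolding m_def by linarith
qed

context sym_rel begin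

text \<open>\<open>T\<close> lists the branch vertices, the first \<open>r\<close> forming one side,
  and \<open>x\<close> the subdividing vertices; here \<open>K\<close> serves as its own subdivision
  \<open>S\<close>.\<close>

lemma has_Krt_clique:
  assumes T: "inj_on T {..<r + t}" "T ` {..<r + t} \<subseteq> V" "indep (T ` {..<r + t})"
    and x: "\<And>i j. i < r \<Longrightarrow> r \<le> j \<Longrightarrow> j < r + t \<Longrightarrow> x (i, j) \<in> V \<and> (\<forall>k<r + t. E (x (i, j)) (T k) \<longleftrightarrow> k = i \<or> k = j)"
    and ind: "\<And>i j i' j'. i < r \<Longrightarrow> r \<le> j \<Longrightarrow> j < r + t \<Longrightarrow> i' < r \<Longrightarrow> r \<le> j' \<Longrightarrow> j' < r + t \<Longrightarrow> \<not> E (x (i, j)) (x (i', j'))"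
  shows "has_Krt r t V"
proof -
  define A where "A = T ` {..<r + t}"
  define ix where "ix = the_inv_into {..<r + t} T"
  have ix: "ix (T k) = k" if "k < r + t" for k unfolding ix_def using T(1) that by (simp add: the_inv_into_f_f)
  define U W where "U = T ` {..<r}" and "W = T ` {r..<r + t}"
  define F where "F a b \<longleftrightarrow> (a, b) \<in> U \<times> W \<union> W \<times> U" for a b
  \<comment> \<open>Sorting the indices makes \<open>w\<close> symmetric and puts the index from the
    side of size \<open>r\<close> first.\<close>
  define w where "w a b = x (min (ix a) (ix b), max (ix a) (ix b))" for a b
  define K where "K = \<lparr>pverts = A, parcs = U \<times> W \<union> W \<times> U\<rparr>"
  have UW: "U \<inter> W = {}" using T(1) by (auto simp: U_def W_def inj_on_def) fastforce
  have A: "A = U \<union> W" unfolding A_def U_def W_def image_Un[symmetric] by (rule arg_cong[where f = "\<lambda>X. T ` X"]) auto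
  have cU: "card U = r" unfolding U_def using card_image[OF inj_on_subset[OF T(1), of "{..<r}"]] by simp
  have cW: "card W = t" unfolding W_def using card_image[OF inj_on_subset[OF T(1), of "{r..<r + t}"]] by (simp add: subset_iff)
  have K: "complete_bipartite_digraph r t (with_proj K)"
    unfolding complete_bipartite_digraph_pair_def
  proof
    show "finite (pverts K)" by (simp add: K_def A_def)
    show "\<exists>U V. pverts K = U \<union> V \<and> U \<inter> V = {} \<and> card U = r \<and> card V = t \<and> parcs K = U \<times> V \<union> V \<times> U"
      by (rule exI[of _ U], rule exI[of _ W]) (use UW A cU cW in \<open>simp add: K_def\<close>)
  qed
  have "pair_bidirected_digraph K"
  proof -
    interpret pair_graph K by (rule pair_graphI_complete_bipartite[OF K])
    show ?thesis by unfold_locales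
  qed
  then have S: "subdivision_pair K K" by (rule subdivision_pair_base)
  have Fcases: "\<exists>i j. i < r \<and> r \<le> j \<and> j < r + t \<and> w a b = x (i, j) \<and> w b a = x (i, j) \<and> {a, b} = {T i, T j}" if F: "F a b" for a b
  proof -
    have "\<exists>i j. i < r \<and> r \<le> j \<and> j < r + t \<and> ((a = T i \<and> b = T j) \<or> (a = T j \<and> b = T i))"
    proof -
      consider i j where "i < r" "r \<le> j" "j < r + t" "a = T i" "b = T j"
        | i j where "i < r" "r \<le> j" "j < r + t" "a = T j" "b = T i"
        using F by (auto simp: F_def U_def W_def)
      then show ?thesis by cases blast+
    qed
    then obtain i j where ij: "i < r" "r \<le> j" "j < r + t" "(a = T i \<and> b = T j) \<or> (a = T j \<and> b = T i)" by blast
    then have "w a b = x (i, j)" "w b a = x (i, j)" using ix[of i] ix[of j] by (auto simp: w_def)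
    then show ?thesis using ij by blast
  qed
  have nbF: "nb A (w a b) = {a, b}" if F: "F a b" for a b
  proof -
    obtain i j where ij: "i < r" "r \<le> j" "j < r + t" "w a b = x (i, j)" "{a, b} = {T i, T j}" using Fcases[OF F] by blast
    have "nb A (x (i, j)) = {T i, T j}" using x[OF ij(1-3)] ij(1-3) by (auto simp: nb_def A_def)
    then show ?thesis using ij by simp
  qed
  have wV: "w a b \<in> V" if "F a b" for a b using Fcases[OF that] x by metis
  have "w a b = w b a" if "F a b" for a b using Fcases[OF that] by metis
  moreover have "\<not> E (w a b) (w c d)" if "F a b" "F c d" for a b c d
    using Fcases[OF that(1)] Fcases[OF that(2)] ind by metis
  moreover have "a \<in> A \<and> b \<in> A \<and> a \<noteq> b \<and> F b a" if "F a b" for a b using that UW A by (auto simp: F_def)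
  ultimately have "subdivided A F w" unfolding subdivided_def using T(3) nbF by (auto simp: A_def)
  moreover have "finite A" "A \<subseteq> V" using T(2) by (auto simp: A_def)
  moreover have "pverts K \<subseteq> A" "parcs K \<subseteq> {(a, b). F a b}" by (auto simp: K_def F_def)
  ultimately show ?thesis unfolding has_Krt_def using K S wV by blast
qed

text \<open>In each separating sample, shattering yields positions \<open>z\<close> and branch
  vertices \<open>T\<close> with the adjacencies of a subdivided clique, but the sample points at
  these positions may be adjacent to each other. As there are few pairs \<open>(z, T)\<close>, one
  of them serves a large fraction of all samples. Hence for every \<open>i\<close> and
  \<open>j\<close> many vertices of \<open>Y\<close> have the prescribed adjacencies to
  \<open>T\<close>, and pairwise non-adjacent ones can be chosen.\<close>

lemma has_Krt_of_dense_nbs: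
  fixes c r t s :: nat
  defines "n \<equiv> r + t" and "v \<equiv> (r + t)\<^sup>2" and "m \<equiv> 2 * c * s * s" and "L \<equiv> (r + t) * (2 * s) ^ (r + t)"
  defines "M \<equiv> L * (m + 1) ^ (2 * v)"
  assumes bf: "biclique_free s" and pos: "s \<ge> 1" "c \<ge> 1" "r \<ge> 1" "t \<ge> 1"
    and exp: "2 * M\<^sup>2 \<le> 2 ^ s"
    and fin: "finite A" "finite Y" and sub: "A \<subseteq> V" "Y \<subseteq> V"
    and dense: "\<And>a. a \<in> A \<Longrightarrow> card Y \<le> c * card (nb Y a)"
    and bigA: "s * M \<le> card A"
    and bigY: "2 * c * s \<le> card Y" "2 * (m ^ v * M ^ n) * (r * t * (2 * s) ^ (r * t)) \<le> card Y"
  shows "has_Krt r t V"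
proof -
  define x where "x = 2 * c * s"
  define D where "D a b = (nb Y a - nb Y b) \<union> (nb Y b - nb Y a)" for a b
  obtain B0 where B0: "B0 \<subseteq> A" "card A \<le> s * card B0" "\<forall>a\<in>B0. \<forall>b\<in>B0. a \<noteq> b \<longrightarrow> card Y \<le> 2 * c * s * card (D a b)"
    using separated_subfamily[OF bf pos(1,2) fin dense bigY(1)] unfolding D_def by blast
  have "s * M \<le> s * card B0" using bigA B0(2) by linarith
  then have "M \<le> card B0" using pos by simp
  then obtain B where B: "B \<subseteq> B0" "card B = M" by (meson obtain_subset_with_card_n)
  have finB: "finite B" using B B0 fin by (meson finite_subset)
  have m: "m = x * s" "m \<ge> 1" using pos by (auto simp: m_def x_def)
  have Ypos: "0 < card Y" using bigY(1) pos by (metis less_le_trans mult_pos_pos zero_less_numeral less_le_trans zero_less_one)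
  define P where "P = PiE {..<m} (\<lambda>_. Y)"
  define G where "G = {f \<in> P. \<forall>a\<in>B. \<forall>b\<in>B. a \<noteq> b \<longrightarrow> (\<exists>i<m. f i \<in> D a b)}"
  have finP: "finite P" unfolding P_def by (intro finite_PiE) (use fin in auto)
  then have finG: "finite G" by (simp add: G_def)
  have cG: "card Y ^ m \<le> 2 * card G"
    unfolding G_def P_def m(1)
  proof (rule sampling_separates)
    show "2 \<le> x" using pos by (simp add: x_def)
    show "D a b \<subseteq> Y \<and> card Y \<le> x * card (D a b)" if "a \<in> B" "b \<in> B" "a \<noteq> b" for a b
      using B0(3) B that by (auto simp: D_def nb_def x_def)
    show "2 * (card B)\<^sup>2 \<le> 2 ^ s" using exp B by simp
  qed (use fin finB in auto)
  have n: "n \<ge> 2" "v \<ge> 1" "v = n * n" using pos by (auto simp: n_def v_def power2_eq_square)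
  have L: "L \<ge> 1" "L = n * (2 * s) ^ n" using pos by (auto simp: L_def n_def Suc_le_eq)
  define ZZ where "ZZ = PiE ({..<n} \<times> {..<n}) (\<lambda>_. {..<m})"
  define TT where "TT = PiE {..<n} (\<lambda>_. B)"
  define good where "good f z T \<longleftrightarrow> (\<forall>k<n. \<forall>k'<n. \<not> E (T k) (T k')) \<and>
      (\<forall>i<n. \<forall>j<n. \<forall>k<n. E (T k) (f (z (i, j))) \<longleftrightarrow> k = i \<or> k = j)" for f :: "nat \<Rightarrow> 'a" and z :: "nat \<times> nat \<Rightarrow> nat" and T :: "nat \<Rightarrow> 'a"
  have ex: "\<exists>p\<in>ZZ \<times> TT. good f (fst p) (snd p)" if f: "f \<in> G" for f
  proof -
    define tr where "tr a = {i\<in>{..<m}. E a (f i)}" for a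
    have fY: "f i \<in> Y" if "i < m" for i using f that by (auto simp: G_def P_def)
    have "inj_on tr B"
    proof (rule inj_onI, rule ccontr)
      fix a b assume ab: "a \<in> B" "b \<in> B" "tr a = tr b" "a \<noteq> b"
      then have "\<exists>i<m. f i \<in> D a b" using f unfolding G_def by blast
      then obtain i where i: "i < m" "f i \<in> D a b" by blast
      have "E a (f i) \<longleftrightarrow> E b (f i)" using ab(3) i(1) unfolding tr_def by blast
      then show False using i(2) by (auto simp: D_def nb_def)
    qed
    moreover have "tr a \<subseteq> {..<m}" for a by (auto simp: tr_def)
    ultimately have "\<exists>Z\<subseteq>{..<m}. card Z = v \<and> (\<forall>S\<subseteq>Z. L \<le> card {a\<in>B. tr a \<inter> Z = S})"
      using m(2) finB n(2) L(1) B(2) by (intro sauer_shelah_robust) (auto simp: M_def lessThan_empty_iff)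
    then obtain Z where Z: "Z \<subseteq> {..<m}" "card Z = v" "\<And>S. S \<subseteq> Z \<Longrightarrow> L \<le> card {a\<in>B. tr a \<inter> Z = S}" by blast
    have "finite Z" using Z(1) finite_subset by blast
    then obtain e where e: "bij_betw e ({..<n} \<times> {..<n}) Z"
      using finite_same_card_bij[of "{..<n} \<times> {..<n}" Z] Z(2) n(3) by (auto simp: card_cartesian_product)
    \<comment> \<open>Branch vertex \<open>k\<close> is to see exactly these positions. The diagonal
      positions \<open>(i, i)\<close> will show that the branch vertices are distinct.\<close>
    define S where "S k = {(i, j). i < n \<and> j < n \<and> (k = i \<or> k = j)}" for k
    define X where "X k = {a\<in>B. tr a \<inter> Z = e ` S k}" for k
    have SZ: "e ` S k \<subseteq> Z" for k using e by (auto simp: S_def bij_betw_def)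
    have "\<exists>x. (\<forall>i\<in>{..<n}. x i \<in> X i) \<and> (\<forall>i\<in>{..<n}. \<forall>j\<in>{..<n}. \<not> E (x i) (x j))"
    proof (rule indep_transversal[OF bf pos(1)])
      show "card {..<n} * (2 * s) ^ card {..<n} \<le> card (X k)" for k using Z(3)[OF SZ[of k]] L(2) by (simp add: X_def)
    qed (use finB in \<open>auto simp: X_def\<close>)
    then obtain T where T: "\<And>k. k < n \<Longrightarrow> T k \<in> X k" "\<And>k k'. k < n \<Longrightarrow> k' < n \<Longrightarrow> \<not> E (T k) (T k')" by auto
    define z where "z = restrict e ({..<n} \<times> {..<n})"
    have eZ: "e (i, j) \<in> Z" if "i < n" "j < n" for i j using e that by (auto simp: bij_betw_def)
    have "z \<in> ZZ" using eZ Z(1) by (fastforce simp: z_def ZZ_def)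
    moreover have "restrict T {..<n} \<in> TT" using T(1) by (auto simp: TT_def X_def)
    moreover have "good f z (restrict T {..<n})"
    proof -
      have "E (T k) (f (e (i, j))) \<longleftrightarrow> k = i \<or> k = j" if ij: "i < n" "j < n" "k < n" for i j k
      proof -
        have "E (T k) (f (e (i, j))) \<longleftrightarrow> e (i, j) \<in> tr (T k) \<inter> Z" using eZ[OF ij(1,2)] Z(1) by (auto simp: tr_def)
        also have "\<dots> \<longleftrightarrow> e (i, j) \<in> e ` S k" using T(1)[OF ij(3)] by (simp add: X_def)
        also have "\<dots> \<longleftrightarrow> (i, j) \<in> S k" using e ij
          by (intro inj_on_image_mem_iff[of e "{..<n} \<times> {..<n}"]) (auto simp: bij_betw_def S_def)
        also have "\<dots> \<longleftrightarrow> k = i \<or> k = j" using ij by (simp add: S_def)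
        finally show ?thesis .
      qed
      then show ?thesis using T(2) by (simp add: good_def z_def)
    qed
    ultimately show ?thesis by (intro bexI[of _ "(z, restrict T {..<n})"]) auto
  qed
  then obtain h where h: "\<And>f. f \<in> G \<Longrightarrow> h f \<in> ZZ \<times> TT \<and> good f (fst (h f)) (snd (h f))" by metis
  have cW: "card (ZZ \<times> TT) = m ^ v * M ^ n" using n(3) B(2) by (simp add: ZZ_def TT_def card_PiE card_cartesian_product)
  have finW: "finite (ZZ \<times> TT)" unfolding ZZ_def TT_def using finB by (intro finite_cartesian_product finite_PiE) auto
  have Gpos: "0 < card G" using cG Ypos by (metis gr0I mult_0_right not_le zero_less_power)
  then obtain f0 where "f0 \<in> G" by (metis card_gt_0_iff ex_in_conv)
  then have Wne: "ZZ \<times> TT \<noteq> {}" using h by blast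
  then obtain p where p: "p \<in> ZZ \<times> TT" "card G \<le> card (ZZ \<times> TT) * card {f\<in>G. h f = p}"
    using pigeonhole_fiber'[of G "ZZ \<times> TT" h] finG finW h by blast
  obtain z T where zT: "p = (z, T)" "z \<in> ZZ" "T \<in> TT" using p(1) by auto
  define J where "J = {f\<in>G. h f = p}"
  have J: "good f z T" "f \<in> P" if "f \<in> J" for f using that h[of f] zT by (auto simp: J_def G_def)
  have "J \<noteq> {}" using p(2) Gpos unfolding J_def by (metis card.empty mult_0_right not_le)
  then obtain f1 where f1: "f1 \<in> J" by blast
  define W where "W i j = {y\<in>Y. \<forall>k<n. E (T k) y \<longleftrightarrow> k = i \<or> k = j}" for i j
  have zm: "z (i, j) < m" if "i < n" "j < n" for i j using zT(2) that by (auto simp: ZZ_def)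
  have Wbig: "r * t * (2 * s) ^ (r * t) \<le> card (W i j)" if ij: "i < n" "j < n" for i j
  proof -
    define l where "l = z (i, j)"
    have l: "l \<in> {..<m}" using zm[OF ij] by (simp add: l_def)
    \<comment> \<open>Fixing one coordinate to lie in \<open>W i j\<close> costs a factor
      \<open>card (W i j)\<close> / \<open>card Y\<close>; since \<open>J\<close> is a large
      fraction of all samples, \<open>W i j\<close> must be large.\<close>
    have "J \<subseteq> PiE {..<m} (\<lambda>q. if q = l then W i j else Y)"
    proof
      fix f assume f: "f \<in> J"
      have "f l \<in> Y" using J(2)[OF f] l by (auto simp: P_def)
      then have "f l \<in> W i j" using J(1)[OF f] ij by (simp add: good_def W_def l_def)
      then show "f \<in> PiE {..<m} (\<lambda>q. if q = l then W i j else Y)" using J(2)[OF f] by (auto simp: P_def PiE_iff)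
    qed
    then have "card J \<le> card (PiE {..<m} (\<lambda>q. if q = l then W i j else Y))"
      using fin by (intro card_mono finite_PiE) (auto simp: W_def)
    also have "\<dots> = (\<Prod>q\<in>{..<m}. card (if q = l then W i j else Y))" by (simp add: card_PiE)
    also have "\<dots> = card (W i j) * (\<Prod>q\<in>{..<m} - {l}. card (if q = l then W i j else Y))"
      using l by (subst prod.remove[of _ l]) auto
    also have "(\<Prod>q\<in>{..<m} - {l}. card (if q = l then W i j else Y)) = (\<Prod>q\<in>{..<m} - {l}. card Y)"
      by (rule prod.cong) auto
    also have "\<dots> = card Y ^ (m - 1)" using l by simp
    finally have Jle: "card J \<le> card (W i j) * card Y ^ (m - 1)" .
    have "card Y * card Y ^ (m - 1) = card Y ^ m" using m(2) by (metis One_nat_def Suc_pred less_eq_Suc_le power_Suc)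
    also have "\<dots> \<le> 2 * (card (ZZ \<times> TT) * card J)" using cG p(2) unfolding J_def by linarith
    also have "\<dots> \<le> 2 * (card (ZZ \<times> TT) * (card (W i j) * card Y ^ (m - 1)))" using Jle by (intro mult_left_mono) auto
    finally have "card Y * card Y ^ (m - 1) \<le> (2 * card (ZZ \<times> TT) * card (W i j)) * card Y ^ (m - 1)"
      by (simp only: mult.assoc)
    then have *: "card Y \<le> 2 * card (ZZ \<times> TT) * card (W i j)" using Ypos by (metis mult_le_cancel2 zero_less_power)
    have "(2 * card (ZZ \<times> TT)) * (r * t * (2 * s) ^ (r * t)) \<le> (2 * card (ZZ \<times> TT)) * card (W i j)"
      by (rule order_trans[OF bigY(2)[folded cW] *])
    moreover have "0 < 2 * card (ZZ \<times> TT)" using Wne finW by (simp add: card_gt_0_iff)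
    ultimately show ?thesis by (metis mult_le_cancel1)
  qed
  define I where "I = {..<r} \<times> {r..<n}"
  have cI: "card I = r * t" by (simp add: I_def n_def card_cartesian_product)
  have "\<exists>x. (\<forall>i\<in>I. x i \<in> (case i of (i, j) \<Rightarrow> W i j)) \<and> (\<forall>i\<in>I. \<forall>j\<in>I. \<not> E (x i) (x j))"
  proof (rule indep_transversal[OF bf pos(1)])
    fix i assume "i \<in> I"
    then show "card I * (2 * s) ^ card I \<le> card (case i of (i, j) \<Rightarrow> W i j)"
      unfolding cI using Wbig by (auto simp: I_def n_def)
  qed (use fin in \<open>auto simp: I_def W_def\<close>)
  then obtain x where x0: "\<forall>i\<in>I. x i \<in> (case i of (i, j) \<Rightarrow> W i j)" "\<forall>i\<in>I. \<forall>j\<in>I. \<not> E (x i) (x j)"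
    by (elim exE conjE) (rule that)
  have x: "x (i, j) \<in> W i j" if "(i, j) \<in> I" for i j using bspec[OF x0(1) that] by simp
  have xx: "\<not> E (x p) (x q)" if "p \<in> I" "q \<in> I" for p q using x0(2) that by blast
  have Tg: "\<not> E (T k) (T k')" if "k < n" "k' < n" for k k' using J(1)[OF f1] that by (simp add: good_def)
  have Tp: "E (T k) (f1 (z (i, j))) \<longleftrightarrow> k = i \<or> k = j" if "i < n" "j < n" "k < n" for i j k
    using J(1)[OF f1] that by (simp add: good_def)
  show ?thesis
  proof (rule has_Krt_clique)
    show "inj_on T {..<r + t}"
    proof (rule inj_onI)
      fix i j assume ij: "i \<in> {..<r + t}" "j \<in> {..<r + t}" "T i = T j"
      then have n: "i < n" "j < n" by (simp_all add: n_def)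
      have "E (T i) (f1 (z (i, i)))" using Tp[OF n(1) n(1) n(1)] by blast
      then have "E (T j) (f1 (z (i, i)))" unfolding ij(3) .
      then show "i = j" using Tp[OF n(1) n(1) n(2)] by blast
    qed
    have "T k \<in> V" if "k < n" for k
    proof -
      have "T k \<in> B" using zT(3) that unfolding TT_def by (auto dest: PiE_mem)
      then show ?thesis using B(1) B0(1) sub by blast
    qed
    then show "T ` {..<r + t} \<subseteq> V" by (auto simp: n_def)
    show "indep (T ` {..<r + t})" using Tg by (auto simp: indep_def n_def)
  next
    fix i j assume ij: "i < r" "r \<le> j" "j < r + t"
    then have "x (i, j) \<in> W i j" using x by (simp add: I_def n_def)
    then show "x (i, j) \<in> V \<and> (\<forall>k<r + t. E (x (i, j)) (T k) \<longleftrightarrow> k = i \<or> k = j)"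
      using sub sym unfolding W_def n_def by blast
  next
    fix i j i' j' assume "i < r" "r \<le> j" "j < r + t" "i' < r" "r \<le> j'" "j' < r + t"
    then show "\<not> E (x (i, j)) (x (i', j'))" using xx by (simp add: I_def n_def)
  qed
qed

end

section \<open>Subdivisions in dense graphs\<close>

lemma pair_bidirected_digraphI:
  assumes "\<And>u v. (u, v) \<in> parcs G \<Longrightarrow> u \<in> pverts G \<and> v \<in> pverts G \<and> u \<noteq> v \<and> (v, u) \<in> parcs G"
  shows "pair_bidirected_digraph G"
  using assms by unfold_locales (auto simp: symmetric_def intro!: symI)

lemma pair_bidirected_digraphD:
  assumes "pair_bidirected_digraph G" "(u, v) \<in> parcs G"
  shows "u \<in> pverts G" "v \<in> pverts G" "u \<noteq> v" "(v, u) \<in> parcs G"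
proof -
  interpret pair_bidirected_digraph G by fact
  show "u \<in> pverts G" "v \<in> pverts G" "u \<noteq> v" "(v, u) \<in> parcs G"
    using assms(2) in_arcsD1 in_arcsD2 no_loops' arcs_symmetric by blast+
qed

lemma subdivision_pair_trans:
  "subdivision_pair G H \<Longrightarrow> subdivision_pair H I \<Longrightarrow> subdivision_pair G I"
  by (rule subdivision_trans)

lemma subdivision_pair_pverts: "subdivision_pair G H \<Longrightarrow> pverts G \<subseteq> pverts H"
  by (induct rule: subdivision_pair_induct) (auto simp: subdivide.simps)

text \<open>Arcs of \<open>X\<close> all touch the new vertices \<open>Q\<close>, so they are not affected by subdividing arcs of \<open>H\<close>.\<close>

lemma subdivision_pair_extend:
  assumes "subdivision_pair G H" "Q \<inter> pverts H = {}"
    and X: "\<And>u v. (u, v) \<in> X \<Longrightarrow> (u \<in> Q \<or> v \<in> Q) \<and> u \<in> Q \<union> pverts G \<and> v \<in> Q \<union> pverts G \<and> u \<noteq> v \<and> (v, u) \<in> X"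
  shows "subdivision_pair \<lparr>pverts = pverts G \<union> Q, parcs = parcs G \<union> X\<rparr> \<lparr>pverts = pverts H \<union> Q, parcs = parcs H \<union> X\<rparr>"
  using assms(1,2)
proof (induct rule: subdivision_pair_induct)
  case base
  show ?case
  proof (rule subdivision_pair_base, rule pair_bidirected_digraphI)
    fix u v assume "(u, v) \<in> parcs \<lparr>pverts = pverts G \<union> Q, parcs = parcs G \<union> X\<rparr>"
    then show "u \<in> pverts \<lparr>pverts = pverts G \<union> Q, parcs = parcs G \<union> X\<rparr> \<and>
        v \<in> pverts \<lparr>pverts = pverts G \<union> Q, parcs = parcs G \<union> X\<rparr> \<and> u \<noteq> v \<and>
        (v, u) \<in> parcs \<lparr>pverts = pverts G \<union> Q, parcs = parcs G \<union> X\<rparr>"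
      using pair_bidirected_digraphD[OF base(1), of u v] X[of u v] by (cases "(u, v) \<in> X") auto
  qed
next
  case (divide e w H)
  obtain u v where e: "e = (u, v)" by (cases e)
  let ?H = "\<lparr>pverts = pverts H \<union> Q, parcs = parcs H \<union> X\<rparr>"
  have dis: "Q \<inter> pverts H = {}" "w \<notin> Q" using divide.prems by (auto simp: subdivide.simps e)
  have bd: "pair_bidirected_digraph H" using divide.hyps(3) by (rule bidirected_digraphI_subdivision)
  have "subdivision_pair \<lparr>pverts = pverts G \<union> Q, parcs = parcs G \<union> X\<rparr> (subdivide ?H e w)"
    using divide.hyps(1,2) divide.hyps(4)[OF dis(1)] dis by (intro subdivision_pair_divide) auto
  moreover have "(u, v) \<notin> X" "(v, u) \<notin> X"
    using X pair_bidirected_digraphD[OF bd divide.hyps(1)[unfolded e]] dis by blast+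
  then have "subdivide ?H e w = \<lparr>pverts = pverts (subdivide H e w) \<union> Q, parcs = parcs (subdivide H e w) \<union> X\<rparr>"
    by (auto simp: subdivide.simps e)
  ultimately show ?case by simp
qed

fun path_arcs :: "'a list \<Rightarrow> ('a \<times> 'a) set" where
  "path_arcs (x # y # xs) = {(x, y), (y, x)} \<union> path_arcs (y # xs)"
| "path_arcs _ = {}"

lemma path_arcs_subset: "path_arcs p \<subseteq> set p \<times> set p"
  by (induction p rule: path_arcs.induct) auto

lemma path_arcs_sym: "(u, v) \<in> path_arcs p \<Longrightarrow> (v, u) \<in> path_arcs p"
  by (induction p rule: path_arcs.induct) auto

lemma path_arcs_irrefl: "distinct p \<Longrightarrow> (u, v) \<in> path_arcs p \<Longrightarrow> u \<noteq> v"
  by (induction p rule: path_arcs.induct) auto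

lemma path_arcs_append_last: "path_arcs (p @ [x, y]) = path_arcs (p @ [x]) \<union> {(x, y), (y, x)}"
  by (induction p rule: path_arcs.induct) auto

text \<open>Each new vertex subdivides the last arc of the path obtained so far, hence the induction
  from the right.\<close>

lemma subdivision_pair_path:
  assumes "pair_bidirected_digraph \<lparr>pverts = V, parcs = A \<union> {(x, y), (y, x)}\<rparr>"
    and "(x, y) \<notin> A" "(y, x) \<notin> A" "distinct p" "set p \<inter> V = {}"
  shows "subdivision_pair \<lparr>pverts = V, parcs = A \<union> {(x, y), (y, x)}\<rparr>
           \<lparr>pverts = V \<union> set p, parcs = A \<union> path_arcs (x # p @ [y])\<rparr>"
  using assms(4,5)
proof (induction p rule: rev_induct)
  case Nil
  then show ?case using subdivision_pair_base[OF assms(1)] by simp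
next
  case (snoc z p)
  have xyV: "x \<in> V" "y \<in> V" "x \<noteq> y" using pair_bidirected_digraphD[OF assms(1), of x y] by auto
  define l where "l = last (x # p)"
  have AV: "\<And>a b. (a, b) \<in> A \<Longrightarrow> a \<in> V \<and> b \<in> V" using pair_bidirected_digraphD(1,2)[OF assms(1)] by auto
  obtain q where q: "x # p = q @ [l]" unfolding l_def by (metis append_butlast_last_id list.distinct(1))
  have eq1: "path_arcs (x # p @ [y]) = path_arcs (x # p) \<union> {(l, y), (y, l)}"
    using path_arcs_append_last[of q l y] q by (metis append.assoc append_Cons append_Nil)
  have eq2: "path_arcs (x # (p @ [z]) @ [y]) = path_arcs (x # p) \<union> {(l, z), (z, l), (z, y), (y, z)}"
  proof -
    have "x # (p @ [z]) @ [y] = (q @ [l]) @ [z, y]" using q by (metis append_Cons append.assoc append_Nil)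
    then have "path_arcs (x # (p @ [z]) @ [y]) = path_arcs ((q @ [l]) @ [z, y])" by (rule arg_cong)
    also have "\<dots> = path_arcs ((q @ [l]) @ [z]) \<union> {(z, y), (y, z)}" by (rule path_arcs_append_last)
    also have "path_arcs ((q @ [l]) @ [z]) = path_arcs (q @ [l]) \<union> {(l, z), (z, l)}"
      using path_arcs_append_last[of q l z] by simp
    finally show ?thesis using q by auto
  qed
  let ?H = "\<lparr>pverts = V \<union> set p, parcs = A \<union> path_arcs (x # p @ [y])\<rparr>"
  have "subdivision_pair \<lparr>pverts = V, parcs = A \<union> {(x, y), (y, x)}\<rparr> (subdivide ?H (l, y) z)"
    by (rule subdivision_pair_divide) (use snoc eq1 in auto)
  moreover have "subdivide ?H (l, y) z = \<lparr>pverts = V \<union> set (p @ [z]), parcs = A \<union> path_arcs (x # (p @ [z]) @ [y])\<rparr>"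
  proof -
    have ypl: "y \<notin> set p" using snoc.prems xyV by auto
    have ly: "(l, y) \<notin> path_arcs (x # p)" "(y, l) \<notin> path_arcs (x # p)"
      using path_arcs_subset[of "x # p"] ypl xyV by auto
    have "(l, y) \<notin> A \<and> (y, l) \<notin> A"
    proof (cases "p = []")
      case True then show ?thesis using assms(2,3) by (simp add: l_def)
    next
      case False
      then have "l \<in> set p" by (simp add: l_def)
      then have "l \<notin> V" using snoc.prems by auto
      then show ?thesis using AV by blast
    qed
    then show ?thesis unfolding subdivide.simps eq1 eq2 using ly by auto
  qed
  ultimately show ?case by simp
qed

text \<open>First the new edge becomes the path while the rest of the small graph stays whole; then
  that rest is subdivided with the path in place. As \<open>p\<close> is nonempty, every arc of the
  path meets a new vertex, which \<open>subdivision_pair_extend\<close> demands.\<close>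

lemma subdivision_pair_add_path:
  assumes sd: "subdivision_pair \<lparr>pverts = V, parcs = A\<rparr> S"
    and xy: "x \<in> V" "y \<in> V" "x \<noteq> y" "(x, y) \<notin> A"
    and p: "distinct p" "set p \<inter> pverts S = {}" "p \<noteq> []"
  shows "subdivision_pair \<lparr>pverts = V, parcs = A \<union> {(x, y), (y, x)}\<rparr>
           \<lparr>pverts = pverts S \<union> set p, parcs = parcs S \<union> path_arcs (x # p @ [y])\<rparr>"
proof (rule subdivision_pair_trans)
  let ?G = "\<lparr>pverts = V, parcs = A\<rparr>"
  have VS: "V \<subseteq> pverts S" using subdivision_pair_pverts[OF sd] by simp
  then have pV: "set p \<inter> V = {}" using p by auto
  have bd: "pair_bidirected_digraph ?G"
    using sd by (induct rule: subdivision_pair_induct) auto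
  have yx: "(y, x) \<notin> A" using pair_bidirected_digraphD(4)[OF bd, of y x] xy(4) by auto
  show "subdivision_pair \<lparr>pverts = V, parcs = A \<union> {(x, y), (y, x)}\<rparr>
           \<lparr>pverts = V \<union> set p, parcs = A \<union> path_arcs (x # p @ [y])\<rparr>"
  proof (rule subdivision_pair_path)
    show "pair_bidirected_digraph \<lparr>pverts = V, parcs = A \<union> {(x, y), (y, x)}\<rparr>"
    proof (rule pair_bidirected_digraphI)
      fix u v assume "(u, v) \<in> parcs \<lparr>pverts = V, parcs = A \<union> {(x, y), (y, x)}\<rparr>"
      then show "u \<in> pverts \<lparr>pverts = V, parcs = A \<union> {(x, y), (y, x)}\<rparr> \<and>
          v \<in> pverts \<lparr>pverts = V, parcs = A \<union> {(x, y), (y, x)}\<rparr> \<and> u \<noteq> v \<and>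
          (v, u) \<in> parcs \<lparr>pverts = V, parcs = A \<union> {(x, y), (y, x)}\<rparr>"
        using pair_bidirected_digraphD[OF bd, of u v] xy by auto
    qed
  qed (use xy yx p pV in auto)
  have dist: "distinct (x # p @ [y])" using p pV xy by auto
  have xp: "(x, y) \<notin> path_arcs (x # p @ [y])" "(y, x) \<notin> path_arcs (x # p @ [y])"
  proof -
    obtain z q where zq: "p = z # q" using p(3) by (cases p) auto
    have "(x, y) \<notin> path_arcs (p @ [y])" "(y, x) \<notin> path_arcs (p @ [y])"
      using path_arcs_subset[of "p @ [y]"] dist by auto
    then show "(x, y) \<notin> path_arcs (x # p @ [y])" "(y, x) \<notin> path_arcs (x # p @ [y])" using dist by (auto simp: zq)
  qed
  have touch: "u \<in> set p \<or> v \<in> set p" if uv: "(u, v) \<in> path_arcs (x # p @ [y])" for u v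
  proof (rule ccontr)
    assume "\<not> ?thesis"
    moreover have "u \<in> set (x # p @ [y])" "v \<in> set (x # p @ [y])" using path_arcs_subset[of "x # p @ [y]"] uv by blast+
    moreover have "u \<noteq> v" using path_arcs_irrefl[OF dist uv] .
    ultimately have "(u, v) = (x, y) \<or> (u, v) = (y, x)" by auto
    then show False using uv xp by auto
  qed
  have "subdivision_pair \<lparr>pverts = pverts ?G \<union> set p, parcs = parcs ?G \<union> path_arcs (x # p @ [y])\<rparr>
      \<lparr>pverts = pverts S \<union> set p, parcs = parcs S \<union> path_arcs (x # p @ [y])\<rparr>"
  proof (rule subdivision_pair_extend[OF sd p(2)])
    fix u v assume uv: "(u, v) \<in> path_arcs (x # p @ [y])"
    have "u \<in> set (x # p @ [y])" "v \<in> set (x # p @ [y])" using path_arcs_subset[of "x # p @ [y]"] uv by blast+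
    then show "(u \<in> set p \<or> v \<in> set p) \<and> u \<in> set p \<union> pverts ?G \<and> v \<in> set p \<union> pverts ?G \<and> u \<noteq> v \<and> (v, u) \<in> path_arcs (x # p @ [y])"
      using touch[OF uv] path_arcs_irrefl[OF dist uv] path_arcs_sym[OF uv] xy by auto
  qed
  then show "subdivision_pair \<lparr>pverts = V \<union> set p, parcs = A \<union> path_arcs (x # p @ [y])\<rparr>
      \<lparr>pverts = pverts S \<union> set p, parcs = parcs S \<union> path_arcs (x # p @ [y])\<rparr>" by simp
qed

lemma path_arcs_Cons: "p \<noteq> [] \<Longrightarrow> path_arcs (x # p) = {(x, hd p), (hd p, x)} \<union> path_arcs p"
  by (cases p) auto

lemma path_arcs_snoc: "p \<noteq> [] \<Longrightarrow> path_arcs (p @ [y]) = path_arcs p \<union> {(last p, y), (y, last p)}"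
  using path_arcs_append_last[of "butlast p" "last p" y] by (metis append.assoc append_Cons append_Nil append_butlast_last_id)

lemma path_arcs_rev: "path_arcs (rev p) = path_arcs p"
proof (induction p)
  case (Cons x p)
  show ?case
  proof (cases "p = []")
    case False
    then show ?thesis using Cons path_arcs_snoc[of "rev p" x] path_arcs_Cons[of p x] by (auto simp: last_rev)
  qed simp
qed simp

section \<open>Mader's theorem\<close>

context sym_rel begin

definition arcs_on :: "'a set \<Rightarrow> ('a \<times> 'a) set" where "arcs_on V = {(x, y) \<in> V \<times> V. E x y}"

definition path_connected_in :: "'a set \<Rightarrow> bool" where
  "path_connected_in U \<longleftrightarrow> (\<forall>x\<in>U. \<forall>y\<in>U. \<exists>p. p \<noteq> [] \<and> distinct p \<and> set p \<subseteq> U \<and> hd p = x \<and> last p = y \<and>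
     path_arcs p \<subseteq> {(a, b). E a b})"

lemma finite_arcs_on: "finite V \<Longrightarrow> finite (arcs_on V)"
  by (rule finite_subset[of _ "V \<times> V"]) (auto simp: arcs_on_def)

lemma card_arcs_on_eq_sum: "finite V \<Longrightarrow> card (arcs_on V) = (\<Sum>x\<in>V. card (nb V x))"
proof -
  assume fin: "finite V"
  have "arcs_on V = Sigma V (nb V)" by (auto simp: arcs_on_def nb_def)
  then show ?thesis using fin by simp
qed

lemma card_arcs_on_remove:
  assumes fin: "finite R" and x: "x \<in> R"
  shows "card (arcs_on R) = card (arcs_on (R - {x})) + 2 * card (nb R x)"
proof -
  have "arcs_on R = arcs_on (R - {x}) \<union> ({x} \<times> nb R x \<union> nb R x \<times> {x})"
    using x sym irrefl by (auto simp: arcs_on_def nb_def)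
  moreover have "card (arcs_on (R - {x}) \<union> ({x} \<times> nb R x \<union> nb R x \<times> {x})) =
      card (arcs_on (R - {x})) + card ({x} \<times> nb R x \<union> nb R x \<times> {x})"
    using fin by (intro card_Un_disjoint finite_arcs_on) (auto simp: arcs_on_def)
  moreover have "card ({x} \<times> nb R x \<union> nb R x \<times> {x}) = card ({x} \<times> nb R x) + card (nb R x \<times> {x})"
    using fin irrefl by (intro card_Un_disjoint) (auto simp: nb_def)
  ultimately show ?thesis by (simp add: card_cartesian_product)
qed

lemma path_connected_in_singleton: "path_connected_in {x}"
  unfolding path_connected_in_def by (auto intro!: exI[of _ "[x]"])

lemma path_connected_in_insert:
  assumes U: "path_connected_in U" and x: "x \<notin> U" "u \<in> U" "E u x"
  shows "path_connected_in (insert x U)"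
proof -
  have *: "\<exists>p. p \<noteq> [] \<and> distinct p \<and> set p \<subseteq> insert x U \<and> hd p = y \<and> last p = x \<and> path_arcs p \<subseteq> {(a, b). E a b}"
    if y: "y \<in> U" for y
  proof -
    obtain p where p: "p \<noteq> []" "distinct p" "set p \<subseteq> U" "hd p = y" "last p = u" "path_arcs p \<subseteq> {(a, b). E a b}"
      using U y x(2) unfolding path_connected_in_def by blast
    then show ?thesis using x sym by (intro exI[of _ "p @ [x]"]) (auto simp: path_arcs_snoc)
  qed
  show ?thesis unfolding path_connected_in_def
  proof (intro ballI)
    fix y z assume y: "y \<in> insert x U" and z: "z \<in> insert x U"
    consider "y \<in> U" "z \<in> U" | "y \<in> U" "z = x" | "y = x" "z \<in> U" | "y = x" "z = x" using y z by blast
    then show "\<exists>p. p \<noteq> [] \<and> distinct p \<and> set p \<subseteq> insert x U \<and> hd p = y \<and> last p = z \<and> path_arcs p \<subseteq> {(a, b). E a b}"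
    proof cases
      case 1
      then show ?thesis using U unfolding path_connected_in_def by (meson subset_insertI2)
    next
      case 2
      then show ?thesis using * by blast
    next
      case 3
      obtain p where "p \<noteq> []" "distinct p" "set p \<subseteq> insert x U" "hd p = z" "last p = x" "path_arcs p \<subseteq> {(a, b). E a b}"
        using *[OF 3(2)] by blast
      then show ?thesis using 3 by (intro exI[of _ "rev p"]) (auto simp: path_arcs_rev hd_rev last_rev)
    next
      case 4
      then show ?thesis by (intro exI[of _ "[x]"]) auto
    qed
  qed
qed

text \<open>Mader's argument: \<open>U\<close> is a maximal connected set whose contraction keeps the density.\<close>

lemma dense_boundary_of_connected:
  assumes fin: "finite V" and ne: "V \<noteq> {}" and k: "k \<ge> 1" and dense: "2 * k * card V \<le> card (arcs_on V)"
    and min: "\<And>W. W \<subset> V \<Longrightarrow> W \<noteq> {} \<Longrightarrow> card (arcs_on W) < 2 * k * card W"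
  shows "\<exists>U N. U \<subseteq> V \<and> N \<subseteq> V - U \<and> N \<noteq> {} \<and> path_connected_in U \<and> (\<forall>x\<in>N. \<exists>u\<in>U. E u x) \<and> (\<forall>x\<in>N. k \<le> card (nb N x))"
proof -
  define N where "N U = {y\<in>V - U. \<exists>u\<in>U. E u y}" for U
  \<comment> \<open>Contracting \<open>U\<close> to a point leaves \<open>card (V - U) + 1\<close>
    vertices, and the point has degree \<open>card (N U)\<close>. The inequality says that there are
    still at least \<open>k\<close> times as many edges as vertices; arcs count edges twice.\<close>
  define ok where "ok U \<longleftrightarrow> U \<subseteq> V \<and> U \<noteq> {} \<and> path_connected_in U \<and>
      2 * k * (card (V - U) + 1) \<le> card (arcs_on (V - U)) + 2 * card (N U)" for U
  have finN: "finite (N U)" for U using fin by (simp add: N_def)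
  obtain v where v: "v \<in> V" using ne by blast
  have "ok {v}"
  proof -
    have "N {v} = nb V v" using irrefl by (auto simp: N_def nb_def)
    moreover have "card (V - {v}) + 1 = card V" using fin v by (metis Suc_eq_plus1 card_Suc_Diff1)
    ultimately show ?thesis using v dense card_arcs_on_remove[OF fin v] by (simp add: ok_def path_connected_in_singleton)
  qed
  moreover have "finite {U. ok U}" using fin by (auto simp: ok_def intro: finite_subset[of _ "Pow V"])
  ultimately obtain U where U: "ok U" "\<And>U'. ok U' \<Longrightarrow> card U' \<le> card U"
    using ex_maximizer[of "{U. ok U}" card] by blast
  have UV: "U \<subseteq> V" "U \<noteq> {}" "path_connected_in U" and finU: "finite U" using U(1) fin by (auto simp: ok_def finite_subset)
  define R where "R = V - U"
  have finR: "finite R" using fin by (simp add: R_def)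
  have okU: "2 * k * (card R + 1) \<le> card (arcs_on R) + 2 * card (N U)" using U(1) by (simp add: ok_def R_def)
  have "N U \<noteq> {}"
  proof
    assume "N U = {}"
    then have big: "2 * k * (card R + 1) \<le> card (arcs_on R)" using okU by simp
    show False
    proof (cases "R = {}")
      case True
      then show False using big k by (simp add: arcs_on_def)
    next
      case False
      then have "card (arcs_on R) < 2 * k * card R" using UV by (intro min) (auto simp: R_def)
      then show False using big by simp
    qed
  qed
  moreover have "k \<le> card (nb (N U) x)" if x: "x \<in> N U" for x
  proof -
    have xR: "x \<in> R" "x \<notin> U" using x by (auto simp: N_def R_def)
    have R': "V - insert x U = R - {x}" by (auto simp: R_def)
    have "path_connected_in (insert x U)" using x UV(3) xR by (auto simp: N_def intro: path_connected_in_insert)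
    \<comment> \<open>Absorbing \<open>x\<close> into \<open>U\<close> costs one vertex and 1 +
      \<open>card (nb (N U) x)\<close> edges. By maximality the density is then lost, so this number
      exceeds \<open>k\<close>.\<close>
    moreover have "\<not> ok (insert x U)" using U(2)[of "insert x U"] xR finU by auto
    ultimately have less: "card (arcs_on (R - {x})) + 2 * card (N (insert x U)) < 2 * k * (card (R - {x}) + 1)"
      using UV xR unfolding ok_def R' by (auto simp: R_def)
    have "N (insert x U) = (N U - {x}) \<union> (nb R x - nb (N U) x)"
      using irrefl xR sym by (auto simp: N_def R_def nb_def)
    moreover have "(N U - {x}) \<inter> (nb R x - nb (N U) x) = {}" by (auto simp: nb_def)
    ultimately have "card (N (insert x U)) = card (N U - {x}) + card (nb R x - nb (N U) x)"
      using finN finR by (simp add: card_Un_disjoint)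
    moreover have "card (N U - {x}) + 1 = card (N U)" using finN x by (metis Suc_eq_plus1 card_Suc_Diff1)
    moreover have "card (nb R x - nb (N U) x) + card (nb (N U) x) = card (nb R x)"
    proof -
      have "nb (N U) x \<subseteq> nb R x" by (auto simp: nb_def N_def R_def)
      then show ?thesis using finR by (metis card_Diff_subset card_mono finite_nb finite_subset le_add_diff_inverse2)
    qed
    moreover have "card (R - {x}) + 1 = card R" using finR xR by (metis Suc_eq_plus1 card_Suc_Diff1)
    ultimately have "card (arcs_on R) + 2 * card (N U) < 2 * k * card R + 2 + 2 * card (nb (N U) x)"
      using less card_arcs_on_remove[OF finR xR(1)] by simp
    moreover have "2 * k * (card R + 1) = 2 * k * card R + 2 * k" by simp
    ultimately have "2 * k < 2 + 2 * card (nb (N U) x)" using okU by linarith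
    then show ?thesis by linarith
  qed
  ultimately show ?thesis using UV by (intro exI[of _ U] exI[of _ "N U"]) (auto simp: N_def)
qed

text \<open>The edges form a list, so that Mader's theorem can be proved by adding one edge at a
  time; \<open>b\<close> places the branch vertices.\<close>

definition model_graph :: "(nat \<Rightarrow> 'a) \<Rightarrow> nat \<Rightarrow> (nat \<times> nat) list \<Rightarrow> 'a pair_pre_digraph" where
  "model_graph b n es = \<lparr>pverts = b ` {..<n}, parcs = (\<Union>(i, j)\<in>set es. {(b i, b j), (b j, b i)})\<rparr>"

text \<open>Each edge halves the density. The other edges are realized within the boundary
  \<open>N\<close> of a connected set \<open>U\<close>, and the new edge becomes a path through
  \<open>U\<close>, which every vertex of \<open>N\<close> can enter directly. The factor
  \<open>n\<close> makes room for the branch vertices in the edgeless case.\<close>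

lemma dense_has_subdivision:
  assumes "finite V" "V \<noteq> {}" "n \<ge> 1" "2 * (2 ^ length es * n) * card V \<le> card (arcs_on V)"
    and "\<forall>(i, j)\<in>set es. i < n \<and> j < n \<and> i \<noteq> j \<and> (j, i) \<notin> set es" "distinct es"
  shows "\<exists>b S. inj_on b {..<n} \<and> b ` {..<n} \<subseteq> V \<and> subdivision_pair (model_graph b n es) S \<and>
    pverts S \<subseteq> V \<and> parcs S \<subseteq> {(x, y). E x y}"
  using assms
proof (induction es arbitrary: V)
  case Nil
  have "card (arcs_on V) \<le> card (V \<times> V)" using Nil.prems by (intro card_mono) (auto simp: arcs_on_def)
  then have "card (arcs_on V) \<le> card V * card V" by (simp add: card_cartesian_product)
  moreover have "2 * n * card V \<le> card (arcs_on V)" using Nil.prems(4) by simp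
  ultimately have "2 * n * card V \<le> card V * card V" by (rule order_trans[rotated])
  moreover have "0 < card V" using Nil.prems by (simp add: card_gt_0_iff)
  ultimately have "n \<le> card V" by simp
  then obtain b where b: "inj_on b {..<n}" "b ` {..<n} \<subseteq> V"
    using card_le_inj[of "{..<n}" V] Nil.prems by auto
  have "subdivision_pair (model_graph b n []) (model_graph b n [])"
    by (rule subdivision_pair_base, rule pair_bidirected_digraphI) (simp add: model_graph_def)
  then show ?case using b by (intro exI[of _ b] exI[of _ "model_graph b n []"]) (auto simp: model_graph_def)
next
  case (Cons e es)
  obtain i j where e: "e = (i, j)" by (cases e)
  define k where "k = 2 ^ Suc (length es) * n"
  have k: "k \<ge> 1" "k = 2 * (2 ^ length es * n)" using Cons.prems(3) by (auto simp: k_def Suc_le_eq)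
  define good where "good W \<longleftrightarrow> W \<subseteq> V \<and> W \<noteq> {} \<and> 2 * k * card W \<le> card (arcs_on W)" for W
  have "good V" using Cons.prems by (simp add: good_def k_def)
  then obtain W where W: "good W" "\<And>W'. card W' < card W \<Longrightarrow> \<not> good W'"
    using ex_has_least_nat[of good V card] by (metis not_less)
  have finW: "finite W" using W(1) Cons.prems(1) by (auto simp: good_def intro: finite_subset)
  have min: "card (arcs_on W') < 2 * k * card W'" if "W' \<subset> W" "W' \<noteq> {}" for W'
  proof -
    have "\<not> good W'" using that finW by (intro W(2) psubset_card_mono)
    then show ?thesis using that W(1) by (auto simp: good_def)
  qed
  have Wd: "W \<noteq> {}" "2 * k * card W \<le> card (arcs_on W)" using W(1) by (auto simp: good_def)
  obtain U N where UN: "U \<subseteq> W" "N \<subseteq> W - U" "N \<noteq> {}" "path_connected_in U"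
      "\<And>x. x \<in> N \<Longrightarrow> \<exists>u\<in>U. E u x" "\<And>x. x \<in> N \<Longrightarrow> k \<le> card (nb N x)"
    using dense_boundary_of_connected[OF finW Wd(1) k(1) Wd(2) min] by blast
  have finN: "finite N" using UN(2) finW by (meson Diff_subset finite_subset)
  have "card N * k \<le> (\<Sum>x\<in>N. card (nb N x))" using sum_bounded_below[of N k "\<lambda>x. card (nb N x)"] UN(6) by simp
  then have "2 * (2 ^ length es * n) * card N \<le> card (arcs_on N)"
    unfolding card_arcs_on_eq_sum[OF finN] using k(2) by (simp add: mult.commute)
  moreover have "\<forall>(i, j)\<in>set es. i < n \<and> j < n \<and> i \<noteq> j \<and> (j, i) \<notin> set es" "distinct es" using Cons.prems(5,6) by auto
  ultimately obtain b S where b: "inj_on b {..<n}" "b ` {..<n} \<subseteq> N" "subdivision_pair (model_graph b n es) S"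
      "pverts S \<subseteq> N" "parcs S \<subseteq> {(x, y). E x y}"
    using Cons.IH[OF finN UN(3) Cons.prems(3)] by blast
  have ij: "i < n" "j < n" "i \<noteq> j" "(j, i) \<notin> set es" "(i, j) \<notin> set es" using Cons.prems(5,6) e by auto
  obtain u1 u2 where u: "u1 \<in> U" "E u1 (b i)" "u2 \<in> U" "E u2 (b j)"
    using UN(5)[of "b i"] UN(5)[of "b j"] b(2) ij by blast
  obtain p where p: "p \<noteq> []" "distinct p" "set p \<subseteq> U" "hd p = u1" "last p = u2" "path_arcs p \<subseteq> {(a, b). E a b}"
    using UN(4) u(1,3) unfolding path_connected_in_def by blast
  let ?S = "\<lparr>pverts = pverts S \<union> set p, parcs = parcs S \<union> path_arcs (b i # p @ [b j])\<rparr>"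
  have sd: "subdivision_pair \<lparr>pverts = b ` {..<n}, parcs = parcs (model_graph b n es) \<union> {(b i, b j), (b j, b i)}\<rparr> ?S"
  proof (rule subdivision_pair_add_path)
    show "subdivision_pair \<lparr>pverts = b ` {..<n}, parcs = parcs (model_graph b n es)\<rparr> S"
      using b(3) by (simp add: model_graph_def)
    show "b i \<noteq> b j" using b(1) ij by (auto dest: inj_onD)
    show "(b i, b j) \<notin> parcs (model_graph b n es)"
    proof
      assume "(b i, b j) \<in> parcs (model_graph b n es)"
      then obtain i' j' where *: "(i', j') \<in> set es" "(b i = b i' \<and> b j = b j') \<or> (b i = b j' \<and> b j = b i')"
        by (auto simp: model_graph_def)
      have "i' < n" "j' < n" using *(1) Cons.prems(5) by auto
      then have "(i = i' \<and> j = j') \<or> (i = j' \<and> j = i')"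
        using *(2) ij inj_on_eq_iff[OF b(1), of i i'] inj_on_eq_iff[OF b(1), of j j']
          inj_on_eq_iff[OF b(1), of i j'] inj_on_eq_iff[OF b(1), of j i'] by auto
      then show False using *(1) ij by auto
    qed
    show "set p \<inter> pverts S = {}" using p(3) b(4) UN(2) by blast
  qed (use ij p in auto)
  have eq: "\<lparr>pverts = b ` {..<n}, parcs = parcs (model_graph b n es) \<union> {(b i, b j), (b j, b i)}\<rparr> = model_graph b n (e # es)"
    by (auto simp: model_graph_def e)
  have sd': "subdivision_pair (model_graph b n (e # es)) ?S" using sd unfolding eq .
  have "path_arcs (b i # p @ [b j]) \<subseteq> {(x, y). E x y}"
    using p u sym by (auto simp: path_arcs_Cons path_arcs_snoc)
  then have arcs: "parcs ?S \<subseteq> {(x, y). E x y}" using b(5) by simp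
  have "W \<subseteq> V" using W(1) by (simp add: good_def)
  then have bV: "b ` {..<n} \<subseteq> V" and "pverts S \<union> set p \<subseteq> V" using b(2,4) p(3) UN(1,2) by blast+
  then have SV: "pverts ?S \<subseteq> V" by simp
  show ?case by (rule exI[of _ b], rule exI[of _ ?S], intro conjI b(1) bV sd' SV arcs)
qed

lemma dense_has_subdivided_Krt:
  assumes "finite V" "V \<noteq> {}" "r \<ge> 1" "2 * (2 ^ (r * t) * (r + t)) * card V \<le> card (arcs_on V)"
  shows "\<exists>K S. complete_bipartite_digraph r t (with_proj K) \<and> subdivision_pair K S \<and> pverts S \<subseteq> V \<and> parcs S \<subseteq> {(x, y). E x y}"
proof -
  define es where "es = List.product [0..<r] [r..<r + t]"
  have "length es = r * t" by (simp add: es_def)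
  then have "\<exists>b S. inj_on b {..<r + t} \<and> b ` {..<r + t} \<subseteq> V \<and> subdivision_pair (model_graph b (r + t) es) S \<and>
      pverts S \<subseteq> V \<and> parcs S \<subseteq> {(x, y). E x y}"
    using assms by (intro dense_has_subdivision) (auto simp: es_def distinct_product)
  then obtain b S where b: "inj_on b {..<r + t}" "subdivision_pair (model_graph b (r + t) es) S"
      "pverts S \<subseteq> V" "parcs S \<subseteq> {(x, y). E x y}" by blast
  define A B where "A = b ` {..<r}" and "B = b ` {r..<r + t}"
  have "b ` {..<r + t} = A \<union> B" unfolding A_def B_def image_Un[symmetric] by (rule arg_cong[where f = "\<lambda>X. b ` X"]) auto
  moreover have "A \<inter> B = {}"
    unfolding A_def B_def using inj_on_image_Int[OF b(1), of "{..<r}" "{r..<r + t}"] by (simp add: subset_iff) fastforce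
  moreover have "card A = r" unfolding A_def using card_image[OF inj_on_subset[OF b(1), of "{..<r}"]] by simp
  moreover have "card B = t" unfolding B_def using card_image[OF inj_on_subset[OF b(1), of "{r..<r + t}"]] by (simp add: subset_iff)
  moreover have "parcs (model_graph b (r + t) es) = A \<times> B \<union> B \<times> A"
    by (fastforce simp: model_graph_def es_def A_def B_def)
  moreover have "pverts (model_graph b (r + t) es) = b ` {..<r + t}" by (simp add: model_graph_def)
  ultimately have "finite (pverts (model_graph b (r + t) es)) \<and>
      (\<exists>U V. pverts (model_graph b (r + t) es) = U \<union> V \<and> U \<inter> V = {} \<and> card U = r \<and> card V = t \<and>
        parcs (model_graph b (r + t) es) = U \<times> V \<union> V \<times> U)" by (metis finite_imageI finite_lessThan)
  then have "complete_bipartite_digraph r t (with_proj (model_graph b (r + t) es))"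
    by (simp only: complete_bipartite_digraph_pair_def)
  then show ?thesis using b by blast
qed

end

section \<open>Large independent sets\<close>

text \<open>The loss in \<open>many_indep_sets_of_size\<close> per added vertex: 2 since only half
  of the vertices are known to extend well, \<open>Suc j\<close> since a set arises from each of its
  elements, and \<open>(4 * s) ^ j\<close> since the next vertices come from a fraction 1 / (4 s) of
  the set.\<close>

fun count_loss :: "nat \<Rightarrow> nat \<Rightarrow> nat" where
  "count_loss s 0 = 1"
| "count_loss s (Suc j) = 2 * Suc j * (4 * s) ^ j * count_loss s j"

context sym_rel begin

lemma indep_subset: "indep S \<Longrightarrow> T \<subseteq> S \<Longrightarrow> indep T"
  by (auto simp: indep_def)

text \<open>If \<open>Y\<close> is large, at most half of its independent subsets have size up to
  \<open>4 * k\<close>, so their average size is at least \<open>2 * k\<close>. If \<open>Y\<close>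
  is small, their number is bounded and \<open>d\<close> alone suffices.\<close>

lemma indep_sets_weight:
  assumes fin: "finite Y" and k: "k \<ge> 1"
    and many: "N \<le> card Y \<Longrightarrow> 2 * (card Y + 1) ^ (4 * k) \<le> card {S. S \<subseteq> Y \<and> indep S}"
    and d: "k * (1 + 2 * (N + 1) ^ (4 * k)) \<le> d"
  shows "k * (1 + card {S. S \<subseteq> Y \<and> indep S}) \<le> d + (\<Sum>S\<in>{S. S \<subseteq> Y \<and> indep S}. card S)"
proof -
  define J where "J = {S. S \<subseteq> Y \<and> indep S}"
  have finJ: "finite J" using fin by (simp add: J_def)
  show ?thesis
  proof (cases "2 * (card Y + 1) ^ (4 * k) \<le> card J")
    case True
    define sm where "sm = {S\<in>J. card S \<le> 4 * k}"
    have "card sm \<le> card {Z. Z \<subseteq> Y \<and> card Z \<le> 4 * k}" using fin by (intro card_mono) (auto simp: sm_def J_def)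
    also have "\<dots> \<le> (card Y + 1) ^ (4 * k)" by (rule card_small_subsets[OF fin])
    finally have "2 * card sm \<le> card J" using True by linarith
    moreover have "card (J - sm) = card J - card sm" using finJ by (intro card_Diff_subset) (auto simp: sm_def)
    ultimately have half: "card J \<le> 2 * card (J - sm)" by linarith
    have "2 * k * card J \<le> 4 * k * card (J - sm)" using half by (metis mult_le_mono2 mult.assoc mult.commute mult_2 numeral_Bit0_eq_double)
    also have "\<dots> = (\<Sum>S\<in>J - sm. 4 * k)" by simp
    also have "\<dots> \<le> (\<Sum>S\<in>J - sm. card S)" by (intro sum_mono) (auto simp: sm_def)
    also have "\<dots> \<le> (\<Sum>S\<in>J. card S)" using finJ by (intro sum_mono2) auto
    finally have *: "2 * k * card J \<le> (\<Sum>S\<in>J. card S)" .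
    have "1 \<le> card J" using True by (metis le_trans nat_mult_1 one_le_power le_add2 mult_le_mono one_le_numeral)
    then have "k * (1 + card J) \<le> 2 * k * card J" using k by simp
    then show ?thesis using * unfolding J_def by linarith
  next
    case False
    then have "\<not> N \<le> card Y" using many by (auto simp: J_def)
    then have "(card Y + 1) ^ (4 * k) \<le> (N + 1) ^ (4 * k)" by (intro power_mono) auto
    then have "card J \<le> 2 * (N + 1) ^ (4 * k)" using False by linarith
    then have "k * (1 + card J) \<le> k * (1 + 2 * (N + 1) ^ (4 * k))" by (intro mult_left_mono) auto
    then show ?thesis using d unfolding J_def by linarith
  qed
qed

text \<open>Condition on the part \<open>W0\<close> of \<open>W\<close> outside the closed
  neighbourhood of \<open>v\<close>. The rest of \<open>W\<close> is either \<open>{v}\<close> or an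
  independent set of neighbours of \<open>v\<close> that have no neighbour in \<open>W0\<close>;
  \<open>indep_sets_weight\<close> compares the two.\<close>

lemma indep_sets_weight_at:
  assumes fin: "finite B" and v: "v \<in> B" and k: "k \<ge> 1"
    and many: "\<And>Y. Y \<subseteq> B \<Longrightarrow> N \<le> card Y \<Longrightarrow> 2 * (card Y + 1) ^ (4 * k) \<le> card {S. S \<subseteq> Y \<and> indep S}"
    and d: "k * (1 + 2 * (N + 1) ^ (4 * k)) \<le> d"
  shows "k * card {W. W \<subseteq> B \<and> indep W} \<le> (\<Sum>W\<in>{W. W \<subseteq> B \<and> indep W}. (if v \<in> W then d else 0) + card (nb W v))"
proof -
  define I where "I = {W. W \<subseteq> B \<and> indep W}"
  define g where "g W = (if v \<in> W then d else 0) + card (nb W v)" for W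
  define rest where "rest W = W - insert v (nb B v)" for W
  have finI: "finite I" using fin by (simp add: I_def)
  have fiber: "k * card {W\<in>I. rest W = W0} \<le> (\<Sum>W\<in>{W\<in>I. rest W = W0}. g W)" if W0: "W0 \<in> rest ` I" for W0
  proof -
    have W0p: "W0 \<subseteq> B" "indep W0" "v \<notin> W0" "W0 \<inter> nb B v = {}"
      using W0 by (auto simp: I_def rest_def intro: indep_subset)
    define Y where "Y = {u\<in>nb B v. \<forall>w\<in>W0. \<not> E u w}"
    define J where "J = {S. S \<subseteq> Y \<and> indep S}"
    have Y: "Y \<subseteq> B" "finite Y" "Y \<subseteq> nb B v" using fin by (auto simp: Y_def nb_def)
    have finJ: "finite J" using Y by (simp add: J_def)
    have eq: "{W\<in>I. rest W = W0} = insert (insert v W0) ((\<lambda>S. W0 \<union> S) ` J)"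
    proof (intro equalityI subsetI)
      fix W assume W: "W \<in> {W\<in>I. rest W = W0}"
      then have WB: "W \<subseteq> B" "indep W" "W - insert v (nb B v) = W0" by (auto simp: I_def rest_def)
      show "W \<in> insert (insert v W0) ((\<lambda>S. W0 \<union> S) ` J)"
      proof (cases "v \<in> W")
        case True
        then have "W \<inter> nb B v = {}" using WB(2) by (auto simp: indep_def nb_def)
        then have "W = insert v W0" using WB(3) True by auto
        then show ?thesis by simp
      next
        case False
        then have W: "W = W0 \<union> (W \<inter> nb B v)" using WB(3) by auto
        have "W \<inter> nb B v \<in> J" using WB by (auto simp: J_def Y_def indep_def)
        then show ?thesis using W by blast
      qed
    next
      fix W assume "W \<in> insert (insert v W0) ((\<lambda>S. W0 \<union> S) ` J)"
      then consider "W = insert v W0" | S where "S \<in> J" "W = W0 \<union> S" by blast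
      then show "W \<in> {W\<in>I. rest W = W0}"
      proof cases
        case 1
        have "\<not> E v w" "\<not> E w v" if "w \<in> W0" for w using that W0p sym[of w v] by (auto simp: nb_def)
        then have "indep W" using W0p(2) irrefl 1 by (auto simp: indep_def)
        moreover have "rest W = W0" using W0p by (auto simp: rest_def 1)
        ultimately show ?thesis using W0p v by (simp add: I_def 1)
      next
        case 2
        have S: "S \<subseteq> nb B v" "indep S" "\<And>u w. u \<in> S \<Longrightarrow> w \<in> W0 \<Longrightarrow> \<not> E u w" using 2 by (auto simp: J_def Y_def)
        then have "indep W" using W0p(2) sym unfolding 2 indep_def by blast
        moreover have "rest W = W0" using W0p S(1) by (auto simp: rest_def 2)
        moreover have "W \<subseteq> B" using W0p S(1) nb_subset 2 by blast
        ultimately show ?thesis by (simp add: I_def)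
      qed
    qed
    have inj: "inj_on (\<lambda>S. W0 \<union> S) J" using W0p(4) Y(3) unfolding inj_on_def J_def by blast
    have nv: "insert v W0 \<notin> (\<lambda>S. W0 \<union> S) ` J"
      using Y(3) irrefl W0p(3) by (auto simp: J_def nb_def)
    have "card {W\<in>I. rest W = W0} = 1 + card J" using finJ nv inj by (simp add: eq card_image)
    moreover have "d + (\<Sum>S\<in>J. card S) \<le> (\<Sum>W\<in>{W\<in>I. rest W = W0}. g W)"
    proof -
      have "(\<Sum>W\<in>{W\<in>I. rest W = W0}. g W) = g (insert v W0) + (\<Sum>S\<in>J. g (W0 \<union> S))"
        unfolding eq using finJ nv inj by (simp add: sum.reindex)
      moreover have "d \<le> g (insert v W0)" by (simp add: g_def)
      moreover have "(\<Sum>S\<in>J. card S) \<le> (\<Sum>S\<in>J. g (W0 \<union> S))"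
      proof (rule sum_mono)
        fix S assume S: "S \<in> J"
        then have "S \<subseteq> nb (W0 \<union> S) v" using Y(3) by (auto simp: J_def nb_def)
        moreover have "finite (nb (W0 \<union> S) v)" using S Y(2) W0p(1) fin by (auto simp: J_def intro: finite_subset)
        ultimately have "card S \<le> card (nb (W0 \<union> S) v)" by (rule card_mono[rotated])
        then show "card S \<le> g (W0 \<union> S)" by (simp add: g_def)
      qed
      ultimately show ?thesis by linarith
    qed
    moreover have "k * (1 + card J) \<le> d + (\<Sum>S\<in>J. card S)"
      unfolding J_def using Y(2) k many[OF Y(1)] d by (rule indep_sets_weight)
    ultimately show ?thesis by simp
  qed
  have "k * card I = (\<Sum>W0\<in>rest ` I. k * card {W\<in>I. rest W = W0})"
    using sum.group[of I "rest ` I" rest "\<lambda>_. k"] finI by (simp add: mult.commute)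
  also have "\<dots> \<le> (\<Sum>W0\<in>rest ` I. \<Sum>W\<in>{W\<in>I. rest W = W0}. g W)" using fiber by (rule sum_mono)
  also have "\<dots> = (\<Sum>W\<in>I. g W)" using finI by (intro sum.group) auto
  finally show ?thesis by (simp add: I_def g_def)
qed

text \<open>Shearer's method: in a uniformly random independent set \<open>W\<close>, every vertex \<open>v\<close> has
  \<open>d \<cdot> P(v \<in> W) + E |N(v) \<inter> W| \<ge> k\<close>.\<close>

lemma large_indep_set:
  assumes fin: "finite B" and k: "k \<ge> 1"
    and deg: "\<And>v. v \<in> B \<Longrightarrow> card (nb B v) \<le> d"
    and many: "\<And>Y. Y \<subseteq> B \<Longrightarrow> N \<le> card Y \<Longrightarrow> 2 * (card Y + 1) ^ (4 * k) \<le> card {S. S \<subseteq> Y \<and> indep S}"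
    and d: "k * (1 + 2 * (N + 1) ^ (4 * k)) \<le> d"
  shows "\<exists>W\<subseteq>B. indep W \<and> k * card B \<le> 2 * d * card W"
proof (rule ccontr)
  assume neg: "\<not> ?thesis"
  define I where "I = {W. W \<subseteq> B \<and> indep W}"
  have finI: "finite I" using fin by (simp add: I_def)
  have "{} \<in> I" by (simp add: I_def indep_def)
  then have cI: "0 < card I" using finI by (auto simp: card_gt_0_iff)
  \<comment> \<open>The vertices of \<open>W\<close> contribute \<open>d\<close> each, and by double
    counting the neighbour terms add at most \<open>d\<close> per vertex of \<open>W\<close>.
    Averaging over \<open>W\<close> will contradict the assumption that every independent set is
    small.\<close>
  have W: "(\<Sum>v\<in>B. (if v \<in> W then d else 0) + card (nb W v)) \<le> 2 * d * card W" if "W \<in> I" for W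
  proof -
    have WB: "W \<subseteq> B" using that by (simp add: I_def)
    have "(\<Sum>v\<in>B. if v \<in> W then d else 0) = d * card W"
      using WB fin by (simp add: sum.If_cases Int_absorb1)
    moreover have "(\<Sum>v\<in>B. card (nb W v)) = (\<Sum>w\<in>W. card (nb B w))"
    proof -
      have "(\<Sum>v\<in>B. card (nb W v)) = (\<Sum>v\<in>B. \<Sum>w\<in>W. if E v w then 1 else 0)"
        using WB fin by (intro sum.cong refl) (simp add: nb_def sum.If_cases finite_subset Collect_conj_eq Int_commute)
      also have "\<dots> = (\<Sum>w\<in>W. \<Sum>v\<in>B. if E w v then 1 else 0)"
        by (subst sum.swap) (intro sum.cong refl, use sym in auto)
      also have "\<dots> = (\<Sum>w\<in>W. card (nb B w))"
        using fin by (intro sum.cong refl) (simp add: nb_def sum.If_cases Collect_conj_eq Int_commute)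
      finally show ?thesis .
    qed
    moreover have "(\<Sum>w\<in>W. card (nb B w)) \<le> d * card W"
      using sum_bounded_above[of W "\<lambda>w. card (nb B w)" d] deg WB by (auto simp: mult.commute)
    ultimately show ?thesis by (simp add: sum.distrib)
  qed
  have "card I * (k * card B) = (\<Sum>v\<in>B. k * card I)" by simp
  also have "\<dots> \<le> (\<Sum>v\<in>B. \<Sum>W\<in>I. (if v \<in> W then d else 0) + card (nb W v))"
  proof (rule sum_mono)
    fix v assume v: "v \<in> B"
    show "k * card I \<le> (\<Sum>W\<in>I. (if v \<in> W then d else 0) + card (nb W v))"
      unfolding I_def by (rule indep_sets_weight_at[OF fin v k, where N = N]) (use many d in auto)
  qed
  also have "\<dots> = (\<Sum>W\<in>I. \<Sum>v\<in>B. (if v \<in> W then d else 0) + card (nb W v))" by (rule sum.swap)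
  also have "\<dots> \<le> (\<Sum>W\<in>I. 2 * d * card W)" using W by (rule sum_mono)
  also have "\<dots> < (\<Sum>W\<in>I. k * card B)"
    using finI cI neg by (intro sum_strict_mono) (auto simp: I_def not_le card_gt_0_iff)
  also have "\<dots> = card I * (k * card B)" by simp
  finally show False by simp
qed

text \<open>At least half of the vertices \<open>v\<close> of \<open>Y\<close> have a fraction 1 /
  (4 s) of \<open>Y\<close> as non-neighbours, and the induction hypothesis counts the sets
  \<open>S\<close> among these. The pairs \<open>(v, S)\<close> inject into the independent sets
  with a marked element.\<close>

lemma many_indep_sets_of_size:
  assumes sparse: "\<And>X. X \<subseteq> B \<Longrightarrow> N \<le> card X \<Longrightarrow> 2 * card {v\<in>X. 4 * s * card (X - nb X v - {v}) < card X} \<le> card X"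
    and fin: "finite B" and s: "s \<ge> 1"
    and Y: "Y \<subseteq> B" "N * (4 * s) ^ j \<le> card Y"
  shows "card Y ^ j \<le> count_loss s j * card {S. S \<subseteq> Y \<and> indep S \<and> card S = j}"
  using Y
proof (induction j arbitrary: Y)
  case 0
  have "{S. S \<subseteq> Y \<and> indep S \<and> card S = 0} = {{}}"
    using 0 fin by (auto simp: indep_def dest: finite_subset)
  then show ?case by simp
next
  case (Suc j)
  have finY: "finite Y" using Suc.prems fin finite_subset by blast
  define C where "C X i = {S. S \<subseteq> X \<and> indep S \<and> card S = i}" for X i
  define R where "R v = Y - nb Y v - {v}" for v
  define good where "good = {v\<in>Y. card Y \<le> 4 * s * card (R v)}"
  have p1: "1 \<le> (4 * s) ^ j" "1 \<le> (4 * s) ^ Suc j" using s by auto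
  then have "N \<le> card Y" using Suc.prems(2) by (metis le_trans mult.right_neutral mult_le_mono2)
  then have "2 * card {v\<in>Y. 4 * s * card (R v) < card Y} \<le> card Y" using sparse Suc.prems(1) by (simp add: R_def)
  moreover have "card good + card {v\<in>Y. 4 * s * card (R v) < card Y} = card Y"
  proof -
    have "card (good \<union> {v\<in>Y. 4 * s * card (R v) < card Y}) = card good + card {v\<in>Y. 4 * s * card (R v) < card Y}"
      using finY by (intro card_Un_disjoint) (auto simp: good_def)
    moreover have "good \<union> {v\<in>Y. 4 * s * card (R v) < card Y} = Y" by (auto simp: good_def)
    ultimately show ?thesis by argo
  qed
  ultimately have half: "card Y \<le> 2 * card good" by linarith
  have finC: "finite (C X i)" if "finite X" for X i using that by (simp add: C_def)
  have finR: "finite (R v)" for v using finY by (simp add: R_def)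
  have fing: "finite good" using finY by (simp add: good_def)
  have gv: "card Y ^ j \<le> (4 * s) ^ j * count_loss s j * card (C (R v) j)" if v: "v \<in> good" for v
  proof -
    have ge: "card Y \<le> 4 * s * card (R v)" using v by (simp add: good_def)
    have "4 * s * (N * (4 * s) ^ j) = N * (4 * s) ^ Suc j" by (simp only: power_Suc ac_simps)
    then have "4 * s * (N * (4 * s) ^ j) \<le> 4 * s * card (R v)" using Suc.prems(2) ge by linarith
    then have "N * (4 * s) ^ j \<le> card (R v)" using s by simp
    moreover have "R v \<subseteq> B" using Suc.prems(1) by (auto simp: R_def)
    ultimately have IH: "card (R v) ^ j \<le> count_loss s j * card (C (R v) j)" unfolding C_def by (rule Suc.IH[rotated])
    have "card Y ^ j \<le> (4 * s * card (R v)) ^ j" using ge by (rule power_mono) simp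
    also have "\<dots> = (4 * s) ^ j * card (R v) ^ j" by (rule power_mult_distrib)
    also have "\<dots> \<le> (4 * s) ^ j * (count_loss s j * card (C (R v) j))" using IH by (rule mult_left_mono) simp
    finally show ?thesis by (simp only: mult.assoc)
  qed
  have "(\<Sum>v\<in>good. card (C (R v) j)) = card (Sigma good (\<lambda>v. C (R v) j))" using fing finC finR by simp
  also have "\<dots> \<le> card (Sigma (C Y (Suc j)) (\<lambda>S. S))"
  proof (rule card_inj_on_le)
    show "inj_on (\<lambda>(v, S). (insert v S, v)) (Sigma good (\<lambda>v. C (R v) j))"
    proof (rule inj_onI, clarsimp)
      fix v S T assume "v \<in> good" "S \<in> C (R v) j" "T \<in> C (R v) j" "insert v S = insert v T"
      moreover have "v \<notin> S" "v \<notin> T" using calculation by (auto simp: C_def R_def)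
      ultimately show "S = T" by (simp add: insert_ident)
    qed
    show "(\<lambda>(v, S). (insert v S, v)) ` Sigma good (\<lambda>v. C (R v) j) \<subseteq> Sigma (C Y (Suc j)) (\<lambda>S. S)"
    proof clarsimp
      fix v S assume v: "v \<in> good" and S: "S \<in> C (R v) j"
      have S': "S \<subseteq> Y" "v \<notin> S" "indep S" "card S = j" "\<And>u. u \<in> S \<Longrightarrow> \<not> E v u" "finite S"
        using S finR[of v] finite_subset by (auto simp: C_def R_def nb_def)
      have "indep (insert v S)" using S'(3,5) irrefl sym[of _ v] unfolding indep_def by blast
      then show "insert v S \<in> C Y (Suc j)" using S' v by (simp add: C_def good_def)
    qed
    show "finite (Sigma (C Y (Suc j)) (\<lambda>S. S))"
      using finY finC by (intro finite_SigmaI) (auto simp: C_def intro: finite_subset)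
  qed
  also have "\<dots> = (\<Sum>S\<in>C Y (Suc j). card S)" using finY finC by (intro card_SigmaI) (auto simp: C_def intro: finite_subset)
  also have "\<dots> = Suc j * card (C Y (Suc j))" by (simp add: C_def)
  finally have cnt: "(\<Sum>v\<in>good. card (C (R v) j)) \<le> Suc j * card (C Y (Suc j))" .
  have "card Y ^ Suc j \<le> 2 * card good * card Y ^ j" using half by (simp add: mult_right_mono)
  also have "\<dots> = 2 * (\<Sum>v\<in>good. card Y ^ j)" by simp
  also have "\<dots> \<le> 2 * (\<Sum>v\<in>good. (4 * s) ^ j * count_loss s j * card (C (R v) j))"
    using gv by (intro mult_left_mono sum_mono) auto
  also have "\<dots> = 2 * ((4 * s) ^ j * count_loss s j) * (\<Sum>v\<in>good. card (C (R v) j))" by (simp add: sum_distrib_left mult.assoc)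
  also have "\<dots> \<le> 2 * ((4 * s) ^ j * count_loss s j) * (Suc j * card (C Y (Suc j)))" using cnt by (rule mult_left_mono) simp
  also have "\<dots> = count_loss s (Suc j) * card (C Y (Suc j))" by (simp only: count_loss.simps ac_simps)
  finally show ?case by (simp only: C_def)
qed

text \<open>Sets of size \<open>Suc k\<close> suffice: their number grows with one more power of
  \<open>card Y\<close>, which absorbs \<open>count_loss\<close> and the factor \<open>2 ^ k\<close>
  from estimating \<open>card Y + 1\<close> by \<open>2 * card Y\<close>.\<close>

lemma many_indep_sets:
  assumes sparse: "\<And>X. X \<subseteq> B \<Longrightarrow> N \<le> card X \<Longrightarrow> 2 * card {v\<in>X. 4 * s * card (X - nb X v - {v}) < card X} \<le> card X"
    and fin: "finite B" and s: "s \<ge> 1" and Y: "Y \<subseteq> B"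
    and big: "N * (4 * s) ^ Suc k + 2 * 2 ^ k * count_loss s (Suc k) \<le> card Y"
  shows "2 * (card Y + 1) ^ k \<le> card {S. S \<subseteq> Y \<and> indep S}"
proof -
  have finY: "finite Y" using Y fin finite_subset by blast
  have clp: "count_loss s j \<ge> 1" for j using s by (induction j) (auto simp: Suc_le_eq)
  have "1 \<le> 2 * 2 ^ k * count_loss s (Suc k)" using clp[of "Suc k"] by (simp add: Suc_le_eq del: count_loss.simps)
  then have Y1: "1 \<le> card Y" using big by linarith
  have "(2 * 2 ^ k * count_loss s (Suc k)) * card Y ^ k \<le> card Y * card Y ^ k" using big by (intro mult_right_mono) auto
  also have "\<dots> = card Y ^ Suc k" by simp
  also have "\<dots> \<le> count_loss s (Suc k) * card {S. S \<subseteq> Y \<and> indep S \<and> card S = Suc k}"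
    using sparse fin s Y big by (intro many_indep_sets_of_size[where B = B and N = N]) auto
  finally have "count_loss s (Suc k) * (2 * (2 * card Y) ^ k) \<le> count_loss s (Suc k) * card {S. S \<subseteq> Y \<and> indep S \<and> card S = Suc k}"
    by (simp only: power_mult_distrib ac_simps)
  moreover have "0 < count_loss s (Suc k)" using clp[of "Suc k"] by linarith
  ultimately have "2 * (2 * card Y) ^ k \<le> card {S. S \<subseteq> Y \<and> indep S \<and> card S = Suc k}"
    by (rule mult_le_cancel1[THEN iffD1, THEN mp])
  also have "\<dots> \<le> card {S. S \<subseteq> Y \<and> indep S}" using finY by (intro card_mono) auto
  finally have *: "2 * (2 * card Y) ^ k \<le> card {S. S \<subseteq> Y \<and> indep S}" .
  have "(card Y + 1) ^ k \<le> (2 * card Y) ^ k" using Y1 by (intro power_mono) auto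
  then show ?thesis using * by linarith
qed

end

section \<open>Sampling\<close>

text \<open>Maximize the number of edges minus \<open>k\<close> per element of \<open>A1\<close> and
  \<open>l\<close> per element of \<open>W1\<close>. Deleting a vertex of too small degree would
  increase this value, and its being positive forces \<open>A1\<close> to be nonempty.\<close>

lemma bipartite_min_degree_core:
  fixes H :: "'b \<Rightarrow> 'c \<Rightarrow> bool"
  assumes fin: "finite W" "finite V" and big: "k * card V + l * card W < card {(w, a) \<in> W \<times> V. H w a}"
  shows "\<exists>W1\<subseteq>W. \<exists>A1\<subseteq>V. A1 \<noteq> {} \<and> (\<forall>a\<in>A1. k \<le> card {w\<in>W1. H w a}) \<and> (\<forall>w\<in>W1. l \<le> card {a\<in>A1. H w a})"
proof -
  define e where "e W A = {(w, a) \<in> W \<times> A. H w a}" for W A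
  define f where "f = (\<lambda>(W, A). int (card (e W A)) - int (k * card A) - int (l * card W))"
  have "\<exists>p\<in>Pow W \<times> Pow V. \<forall>p'\<in>Pow W \<times> Pow V. f p' \<le> f p" using fin by (intro ex_maximizer) auto
  then obtain W1 A1 where max: "W1 \<subseteq> W" "A1 \<subseteq> V" "\<And>W' A'. W' \<subseteq> W \<Longrightarrow> A' \<subseteq> V \<Longrightarrow> f (W', A') \<le> f (W1, A1)" by auto
  have fin1: "finite W1" "finite A1" using max fin by (auto intro: finite_subset)
  have fine: "finite (e W1 A1)" using fin1 by (auto simp: e_def intro: finite_subset[of _ "W1 \<times> A1"])
  have "int (k * card V) + int (l * card W) < int (card (e W V))"
    using big unfolding e_def by (simp only: of_nat_add[symmetric] of_nat_less_iff)
  then have "0 < f (W, V)" by (simp add: f_def)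
  then have pos: "0 < f (W1, A1)" using max(3)[of W V] by simp
  have "A1 \<noteq> {}"
  proof
    assume "A1 = {}"
    then have "f (W1, A1) = - int (l * card W1)" by (simp add: f_def e_def)
    then show False using pos by linarith
  qed
  moreover have "k \<le> card {w\<in>W1. H w a}" if a: "a \<in> A1" for a
  proof -
    have "f (W1, A1 - {a}) \<le> f (W1, A1)" by (rule max(3)) (use max(1,2) in blast)+
    moreover have "card (A1 - {a}) + 1 = card A1" using a fin1 by (metis Suc_eq_plus1 card_Suc_Diff1)
    then have "int (k * card A1) = int (k * card (A1 - {a})) + int k" by (metis mult.right_neutral distrib_left of_nat_add)
    moreover have "card (e W1 A1) = card (e W1 (A1 - {a})) + card {w\<in>W1. H w a}"
    proof -
      have "e W1 A1 = e W1 (A1 - {a}) \<union> {w\<in>W1. H w a} \<times> {a}" using a by (auto simp: e_def)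
      moreover have "card (e W1 (A1 - {a}) \<union> {w\<in>W1. H w a} \<times> {a}) = card (e W1 (A1 - {a})) + card ({w\<in>W1. H w a} \<times> {a})"
        using fine by (intro card_Un_disjoint) (auto simp: e_def fin1 intro: finite_subset[of _ "e W1 A1"])
      ultimately show ?thesis by (simp add: card_cartesian_product)
    qed
    ultimately show ?thesis unfolding f_def prod.case by linarith
  qed
  moreover have "l \<le> card {a\<in>A1. H w a}" if w: "w \<in> W1" for w
  proof -
    have "f (W1 - {w}, A1) \<le> f (W1, A1)" by (rule max(3)) (use max(1,2) in blast)+
    moreover have "card (W1 - {w}) + 1 = card W1" using w fin1 by (metis Suc_eq_plus1 card_Suc_Diff1)
    then have "int (l * card W1) = int (l * card (W1 - {w})) + int l" by (metis mult.right_neutral distrib_left of_nat_add)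
    moreover have "card (e W1 A1) = card (e (W1 - {w}) A1) + card {a\<in>A1. H w a}"
    proof -
      have "e W1 A1 = e (W1 - {w}) A1 \<union> {w} \<times> {a\<in>A1. H w a}" using w by (auto simp: e_def)
      moreover have "card (e (W1 - {w}) A1 \<union> {w} \<times> {a\<in>A1. H w a}) = card (e (W1 - {w}) A1) + card ({w} \<times> {a\<in>A1. H w a})"
        using fine by (intro card_Un_disjoint) (auto simp: e_def fin1 intro: finite_subset[of _ "e W1 A1"])
      ultimately show ?thesis by (simp add: card_cartesian_product)
    qed
    ultimately show ?thesis unfolding f_def prod.case by linarith
  qed
  ultimately show ?thesis using max(1,2) by blast
qed

text \<open>The sixth power of (1 + 1 / (D - 1)) ^ D \<le> 2 e \<le> 6. It bounds from below the
  probability that up to 6 D given elements are all discarded, if each is kept with probability 1 /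
  D.\<close>

lemma power_le_six_pred_power:
  fixes D :: nat
  assumes D: "D \<ge> 2" and m: "m \<le> 6 * D"
  shows "D ^ m \<le> 6 ^ 6 * (D - 1) ^ m"
proof -
  define x where "x = 1 + 1 / real (D - 1)"
  have x: "x = real D / real (D - 1)" "1 \<le> x" "x \<le> 2" using D by (auto simp: x_def field_simps of_nat_diff)
  have "x ^ (D - 1) \<le> exp (1 / real (D - 1)) ^ (D - 1)"
    unfolding x_def by (intro power_mono) (auto simp: exp_ge_add_one_self)
  also have "\<dots> = exp 1" using D by (simp add: exp_of_nat_mult[symmetric])
  also have "\<dots> \<le> 3" by (rule exp_le)
  finally have "x ^ (D - 1) * x \<le> 3 * 2" using x by (intro mult_mono) auto
  also have "x ^ (D - 1) * x = x ^ D" using D by (metis One_nat_def Suc_diff_1 less_le_trans pos2 power_Suc2)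
  finally have "x ^ D \<le> 6" by simp
  have "x ^ m \<le> x ^ (D * 6)" using x m by (intro power_increasing) auto
  also have "\<dots> = (x ^ D) ^ 6" by (rule power_mult)
  also have "\<dots> \<le> 6 ^ 6" using \<open>x ^ D \<le> 6\<close> x by (intro power_mono) auto
  finally have "real D ^ m \<le> 6 ^ 6 * real (D - 1) ^ m" using D by (simp add: x power_divide divide_le_eq)
  then have "real (D ^ m) \<le> real (6 ^ 6 * (D - 1) ^ m)" by simp
  then show ?thesis using of_nat_le_iff by blast
qed

text \<open>The functions \<open>g\<close> model a random subset \<open>{a. g a = 0}\<close> in which every element is kept
  independently with probability \<open>1 / D\<close>.\<close>

lemma card_sample_pair_isolated:
  fixes D :: nat
  assumes fin: "finite A" and a: "a \<in> A" "a' \<in> A" "a \<noteq> a'" and D: "D \<ge> 2"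
    and Q: "Q \<subseteq> A - {a, a'}" "card Q \<le> 6 * D"
  shows "D ^ card A \<le> 6 ^ 6 * D\<^sup>2 * card {g \<in> PiE A (\<lambda>_. {..<D}). g a = 0 \<and> g a' = 0 \<and> (\<forall>x\<in>Q. g x \<noteq> 0)}"
proof -
  define S where "S x = (if x = a \<or> x = a' then {0} else if x \<in> Q then {1..<D} else {..<D})" for x
  have "{g \<in> PiE A (\<lambda>_. {..<D}). g a = 0 \<and> g a' = 0 \<and> (\<forall>x\<in>Q. g x \<noteq> 0)} = PiE A S" (is "?G = _")
  proof (intro equalityI subsetI)
    fix g assume g: "g \<in> ?G"
    then show "g \<in> PiE A S" using Q by (auto simp: S_def PiE_iff Suc_le_eq)
  next
    fix g assume g: "g \<in> PiE A S"
    then have gS: "\<And>x. x \<in> A \<Longrightarrow> g x \<in> S x" "g \<in> extensional A" by (auto simp: PiE_iff)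
    have "g x < D" if "x \<in> A" for x using gS(1)[OF that] D by (auto simp: S_def split: if_splits)
    moreover have "g a = 0" "g a' = 0" using gS(1)[of a] gS(1)[of a'] a by (auto simp: S_def)
    moreover have "g x \<noteq> 0" if "x \<in> Q" for x
    proof -
      have "x \<in> A" "x \<noteq> a" "x \<noteq> a'" using Q that by auto
      then show ?thesis using gS(1)[of x] that by (auto simp: S_def)
    qed
    ultimately show "g \<in> ?G" using gS(2) by (auto simp: PiE_iff)
  qed
  moreover have "card (PiE A S) = (\<Prod>x\<in>A. card (S x))" using fin by (simp add: card_PiE)
  moreover have "(\<Prod>x\<in>A. card (S x)) = (D - 1) ^ card Q * D ^ (card (A - {a, a'}) - card Q)"
  proof -
    have "(\<Prod>x\<in>A. card (S x)) = card (S a) * (card (S a') * (\<Prod>x\<in>A - {a} - {a'}. card (S x)))"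
      using fin a prod.remove[of A a "\<lambda>x. card (S x)"] prod.remove[of "A - {a}" a' "\<lambda>x. card (S x)"] by simp
    also have "A - {a} - {a'} = A - {a, a'}" by auto
    also have "(\<Prod>x\<in>A - {a, a'}. card (S x)) = (\<Prod>x\<in>A - {a, a'} - Q. card (S x)) * (\<Prod>x\<in>Q. card (S x))"
      using fin Q by (intro prod.subset_diff) auto
    also have "(\<Prod>x\<in>Q. card (S x)) = (\<Prod>x\<in>Q. D - 1)" using Q by (intro prod.cong) (auto simp: S_def)
    also have "(\<Prod>x\<in>A - {a, a'} - Q. card (S x)) = (\<Prod>x\<in>A - {a, a'} - Q. D)" by (intro prod.cong) (auto simp: S_def)
    also have "(\<Prod>x\<in>A - {a, a'} - Q. D) = D ^ (card (A - {a, a'}) - card Q)"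
      using fin Q card_Diff_subset[of Q "A - {a, a'}"] by (simp add: finite_subset)
    finally show ?thesis by (simp add: S_def)
  qed
  moreover have "D ^ card A \<le> 6 ^ 6 * D\<^sup>2 * ((D - 1) ^ card Q * D ^ (card (A - {a, a'}) - card Q))"
  proof -
    have c2: "card A = 2 + card (A - {a, a'})"
    proof -
      have "card {a, a'} \<le> card A" using fin a by (intro card_mono) auto
      then show ?thesis using fin a by (simp add: card_Diff_subset)
    qed
    have cQ: "card Q \<le> card (A - {a, a'})" using fin Q by (intro card_mono) auto
    then have "D ^ card A = D\<^sup>2 * (D ^ card Q * D ^ (card (A - {a, a'}) - card Q))"
      by (simp only: c2 power_add[symmetric] le_add_diff_inverse)
    also have "\<dots> \<le> D\<^sup>2 * ((6 ^ 6 * (D - 1) ^ card Q) * D ^ (card (A - {a, a'}) - card Q))"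
      using power_le_six_pred_power[OF D Q(2)] by (intro mult_left_mono mult_right_mono) auto
    finally show ?thesis by (simp only: ac_simps)
  qed
  ultimately show ?thesis by simp
qed

lemma card_sample_member:
  assumes fin: "finite A" and a: "a \<in> A" and D: "D \<ge> (1::nat)"
  shows "D * card {g \<in> PiE A (\<lambda>_. {..<D}). g a = 0} = D ^ card A"
proof -
  have "{g \<in> PiE A (\<lambda>_. {..<D}). g a = 0} = PiE A (\<lambda>x. if x = a then {0} else {..<D})"
    using a D by (auto simp: PiE_iff extensional_def split: if_splits)
  moreover have "card (PiE A (\<lambda>x. if x = a then {0::nat} else {..<D})) = D ^ (card A - 1)"
  proof -
    have "card (PiE A (\<lambda>x. if x = a then {0::nat} else {..<D})) = (\<Prod>x\<in>A. card (if x = a then {0::nat} else {..<D}))"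
      using fin by (simp add: card_PiE)
    also have "\<dots> = 1 * (\<Prod>x\<in>A - {a}. card (if x = a then {0::nat} else {..<D}))" using fin a by (subst prod.remove[of _ a]) auto
    also have "(\<Prod>x\<in>A - {a}. card (if x = a then {0::nat} else {..<D})) = (\<Prod>x\<in>A - {a}. D)" by (intro prod.cong) auto
    finally show ?thesis using fin a by simp
  qed
  moreover have "0 < card A" using fin a by (auto simp: card_gt_0_iff)
  ultimately show ?thesis by (metis Suc_diff_1 power_Suc)
qed

section \<open>Orientations of degenerate graphs\<close>

context sym_rel begin

text \<open>Remove a vertex of small degree and direct its remaining edges away from it. Single
  degrees may be huge; outdegrees are a bounded substitute.\<close>

lemma degenerate_orientation:
  assumes "finite V" "\<And>W. W \<subseteq> V \<Longrightarrow> W \<noteq> {} \<Longrightarrow> \<exists>v\<in>W. card (nb W v) \<le> D"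
  shows "\<exists>out. (\<forall>v\<in>V. out v \<subseteq> nb V v \<and> card (out v) \<le> D) \<and> (\<forall>u\<in>V. \<forall>v\<in>V. E u v \<longrightarrow> u \<in> out v \<or> v \<in> out u)"
  using assms
proof (induction "card V" arbitrary: V)
  case 0
  then show ?case by simp
next
  case (Suc n)
  then have "V \<noteq> {}" by auto
  then obtain v where v: "v \<in> V" "card (nb V v) \<le> D" using Suc.prems(2)[of V] by blast
  have "\<exists>out. (\<forall>u\<in>V - {v}. out u \<subseteq> nb (V - {v}) u \<and> card (out u) \<le> D) \<and>
      (\<forall>u\<in>V - {v}. \<forall>w\<in>V - {v}. E u w \<longrightarrow> u \<in> out w \<or> w \<in> out u)"
  proof (rule Suc.hyps(1))
    show "n = card (V - {v})" using Suc.hyps(2) v Suc.prems(1) by simp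
    show "\<exists>v\<in>W. card (nb W v) \<le> D" if "W \<subseteq> V - {v}" "W \<noteq> {}" for W using Suc.prems(2)[of W] that by blast
  qed (use Suc.prems in simp)
  then obtain out where out: "\<And>u. u \<in> V - {v} \<Longrightarrow> out u \<subseteq> nb (V - {v}) u \<and> card (out u) \<le> D"
      "\<And>u w. u \<in> V - {v} \<Longrightarrow> w \<in> V - {v} \<Longrightarrow> E u w \<Longrightarrow> u \<in> out w \<or> w \<in> out u" by blast
  show ?case
  proof (intro exI[of _ "out(v := nb V v)"] conjI ballI impI)
    fix u assume "u \<in> V"
    then show "(out(v := nb V v)) u \<subseteq> nb V u" "card ((out(v := nb V v)) u) \<le> D"
      using out(1)[of u] v by (auto simp: nb_def)
  next
    fix u w assume "u \<in> V" "w \<in> V" "E u w"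
    then show "u \<in> (out(v := nb V v)) w \<or> w \<in> (out(v := nb V v)) u"
      using out(2)[of u w] sym[of u w] irrefl by (auto simp: nb_def)
  qed
qed

text \<open>The average degree is at most \<open>2 * D\<close>, so Markov's inequality
  applies.\<close>

lemma half_small_degree:
  assumes fin: "finite V" and D: "D \<ge> 1"
    and out: "\<And>v. v \<in> V \<Longrightarrow> out v \<subseteq> nb V v \<and> card (out v) \<le> D"
    and ori: "\<And>u v. u \<in> V \<Longrightarrow> v \<in> V \<Longrightarrow> E u v \<Longrightarrow> u \<in> out v \<or> v \<in> out u"
  shows "card V \<le> 2 * card {v\<in>V. card (nb V v) \<le> 4 * D}"
proof -
  have fino: "finite (out v)" if "v \<in> V" for v using out[OF that] fin by (auto intro: finite_subset)
  let ?S = "Sigma V out"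
  have finS: "finite ?S" using fin fino by auto
  have "arcs_on V \<subseteq> ?S \<union> prod.swap ` ?S" 
  proof
    fix p assume "p \<in> arcs_on V"
    then obtain a b where ab: "p = (a, b)" "a \<in> V" "b \<in> V" "E a b" by (auto simp: arcs_on_def)
    then have "(a, b) \<in> ?S \<or> (b, a) \<in> ?S" using ori[of a b] by auto
    then show "p \<in> ?S \<union> prod.swap ` ?S" using ab(1) by (metis UnI1 UnI2 image_eqI swap_simp)
  qed
  then have "card (arcs_on V) \<le> card (?S \<union> prod.swap ` ?S)" using finS by (intro card_mono) auto
  also have "\<dots> \<le> card ?S + card (prod.swap ` ?S)" by (rule card_Un_le)
  also have "\<dots> \<le> 2 * card ?S" using card_image_le[OF finS, of prod.swap] by simp
  also have "card ?S = (\<Sum>v\<in>V. card (out v))" using fin fino by simp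
  also have "\<dots> \<le> (\<Sum>v\<in>V. D)" using out by (intro sum_mono) auto
  finally have tot: "card (arcs_on V) \<le> 2 * (card V * D)" by simp
  define B where "B = {v\<in>V. card (nb V v) \<le> 4 * D}"
  have "card (V - B) * (4 * D) \<le> (\<Sum>v\<in>V - B. card (nb V v))"
  proof -
    have "4 * D \<le> card (nb V v)" if "v \<in> V - B" for v using that by (auto simp: B_def)
    then show ?thesis using sum_bounded_below[of "V - B" "4 * D" "\<lambda>v. card (nb V v)"] by simp
  qed
  also have "\<dots> \<le> (\<Sum>v\<in>V. card (nb V v))" using fin by (intro sum_mono2) auto
  also have "\<dots> = card (arcs_on V)" using fin by (simp add: card_arcs_on_eq_sum)
  finally have "card (V - B) * (4 * D) \<le> 2 * (card V * D)" using tot by linarith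
  moreover have "(2 * D) * (2 * card (V - B)) = card (V - B) * (4 * D)" "(2 * D) * card V = 2 * (card V * D)" by simp_all
  ultimately have "(2 * D) * (2 * card (V - B)) \<le> (2 * D) * card V" by linarith
  then have "2 * card (V - B) \<le> card V" by (rule mult_le_cancel1[THEN iffD1, THEN mp]) (use D in simp)
  moreover have "card (V - B) = card V - card B" using fin by (intro card_Diff_subset) (auto simp: B_def)
  ultimately show ?thesis unfolding B_def by linarith
qed

end

section \<open>Pairs of vertices joined through an independent set\<close>

context sym_rel begin

definition codegree :: "'a set \<Rightarrow> 'a \<Rightarrow> 'a \<Rightarrow> nat" where "codegree V x y = card (nb V x \<inter> nb V y)"

lemma codegree_commute: "codegree V x y = codegree V y x"
  by (simp add: codegree_def Int_commute)

text \<open>Each of \<open>k\<close> common neighbours \<open>w\<close> contributes many partners of \<open>a\<close> of its own, since the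
  neighbourhoods of the \<open>w\<close> nearly are pairwise disjoint.\<close>

lemma many_partners:
  assumes fin: "finite V" "A \<subseteq> V" and k: "k \<ge> 1" and D: "D \<ge> 32"
    and W: "\<And>w w'. w \<in> W \<Longrightarrow> w' \<in> W \<Longrightarrow> w \<noteq> w' \<Longrightarrow> 32 * k * codegree V w w' < D"
    and H: "\<And>w a. H w a \<longleftrightarrow> E w a \<and> 32 * k * codegree V w a < D"
    and finW: "finite W" and a: "a \<in> A" "k \<le> card {w\<in>W. H w a}"
    and w: "\<And>w. w \<in> W \<Longrightarrow> D \<le> 8 * card {a\<in>A. H w a}"
  shows "k * D \<le> 16 * card {a'\<in>A. a' \<noteq> a \<and> \<not> E a a' \<and> (\<exists>w\<in>W. E w a \<and> E w a')}" (is "_ \<le> 16 * card ?P")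
proof -
  obtain K where K: "K \<subseteq> {w\<in>W. H w a}" "card K = k" using a(2) by (meson obtain_subset_with_card_n)
  have finK: "finite K" using finite_subset[OF K(1)] finW by simp
  have finA: "finite A" using fin finite_subset by blast
  define N where "N w = {a\<in>A. H w a}" for w
  \<comment> \<open>The partners of \<open>a\<close> that come from \<open>w\<close> alone. Of at
    least D / 8 vertices in \<open>N w\<close>, the \<open>k\<close> overlaps, each below D / (32
    k), remove at most D / 32, and \<open>a\<close> itself is at most another D / 32, so D / 16
    remain.\<close>
  define M where "M w = N w - ((\<Union>w'\<in>K - {w}. N w \<inter> N w') \<union> (N w \<inter> nb V a) \<union> {a})" for w
  have finN: "finite (N w)" for w using finA by (simp add: N_def)
  have M: "D \<le> 16 * card (M w)" if wK: "w \<in> K" for w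
  proof -
    have ww: "w \<in> W" "H w a" using K wK by auto
    let ?U = "(\<Union>w'\<in>K - {w}. N w \<inter> N w')"
    have N_nb: "N v \<subseteq> nb V v" for v using fin H by (auto simp: N_def nb_def)
    have finnb: "finite (nb V v)" for v using fin by simp
    have "32 * k * card ?U \<le> 32 * k * (\<Sum>w'\<in>K - {w}. card (N w \<inter> N w'))"
      using finK by (intro mult_left_mono card_UN_le) auto
    also have "\<dots> = (\<Sum>w'\<in>K - {w}. 32 * k * card (N w \<inter> N w'))" by (rule sum_distrib_left)
    also have "\<dots> \<le> (\<Sum>w'\<in>K - {w}. D)"
    proof (rule sum_mono)
      fix w' assume w': "w' \<in> K - {w}"
      have "card (N w \<inter> N w') \<le> codegree V w w'"
        unfolding codegree_def using N_nb finnb by (intro card_mono) auto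
      then have "32 * k * card (N w \<inter> N w') \<le> 32 * k * codegree V w w'" by (rule mult_left_mono) simp
      also have "\<dots> < D" using W[of w w'] ww w' K by auto
      finally show "32 * k * card (N w \<inter> N w') \<le> D" by simp
    qed
    also have "\<dots> = (k - 1) * D" using K(2) wK finK by simp
    finally have 1: "32 * k * card ?U \<le> (k - 1) * D" .
    have "card (N w \<inter> nb V a) \<le> codegree V w a"
      unfolding codegree_def using N_nb finnb by (intro card_mono) auto
    then have "32 * k * card (N w \<inter> nb V a) \<le> 32 * k * codegree V w a" by (rule mult_left_mono) simp
    moreover have "32 * k * codegree V w a < D" using H ww by blast
    ultimately have 2: "32 * k * card (N w \<inter> nb V a) \<le> D" by linarith
    have "card (?U \<union> (N w \<inter> nb V a) \<union> {a}) \<le> card ?U + card (N w \<inter> nb V a) + card {a}"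
      by (meson card_Un_le add_le_mono le_trans order_refl)
    moreover have "card (N w) - card (?U \<union> (N w \<inter> nb V a) \<union> {a}) \<le> card (M w)"
      unfolding M_def using finK finN by (intro diff_card_le_card_Diff) auto
    ultimately have "card (N w) \<le> card (M w) + card ?U + card (N w \<inter> nb V a) + 1" by simp
    then have "32 * k * card (N w) \<le> 32 * k * (card (M w) + card ?U + card (N w \<inter> nb V a) + 1)" by (rule mult_left_mono) simp
    also have "\<dots> = 32 * k * card (M w) + 32 * k * card ?U + 32 * k * card (N w \<inter> nb V a) + 32 * k" by (simp add: algebra_simps)
    also have "\<dots> \<le> 32 * k * card (M w) + (k - 1) * D + D + k * D" using 1 2 D by (intro add_mono) auto
    also have "(k - 1) * D + D = k * D" using k by (metis Suc_diff_1 add.commute less_le_trans mult_Suc zero_less_one)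
    then have "32 * k * card (M w) + (k - 1) * D + D + k * D = 32 * k * card (M w) + 2 * (k * D)" by simp
    finally have "32 * k * card (N w) \<le> 32 * k * card (M w) + 2 * (k * D)" .
    then have "32 * (k * card (N w)) \<le> 32 * (k * card (M w)) + 2 * (k * D)" by (simp only: mult.assoc)
    moreover have "k * D \<le> k * (8 * card (N w))" using w[OF ww(1)] unfolding N_def by (rule mult_left_mono) simp
    moreover have "k * (8 * card (N w)) = 8 * (k * card (N w))" "k * (16 * card (M w)) = 16 * (k * card (M w))" by simp_all
    ultimately have "k * D \<le> k * (16 * card (M w))" by linarith
    then show ?thesis by (rule mult_le_cancel1[THEN iffD1, THEN mp]) (use k in simp)
  qed
  have disj: "M w \<inter> M w' = {}" if "w \<in> K" "w' \<in> K" "w \<noteq> w'" for w w' using that by (auto simp: M_def)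
  have finM: "finite (M w)" for w using finN by (simp add: M_def)
  have "(\<Union>w\<in>K. M w) \<subseteq> ?P"
  proof
    fix b assume "b \<in> (\<Union>w\<in>K. M w)"
    then obtain w where w: "w \<in> K" "b \<in> M w" by blast
    then have "w \<in> W" "H w a" "b \<in> A" "H w b" "b \<notin> nb V a" "b \<noteq> a" using K by (auto simp: M_def N_def)
    moreover have "b \<in> V" using \<open>b \<in> A\<close> fin by blast
    ultimately show "b \<in> ?P" using H by (auto simp: nb_def)
  qed
  then have "card (\<Union>w\<in>K. M w) \<le> card ?P" using finA by (intro card_mono) auto
  moreover have "card (\<Union>w\<in>K. M w) = (\<Sum>w\<in>K. card (M w))"
    using finK finM disj by (intro card_UN_disjoint) auto
  moreover have "(\<Sum>w\<in>K. D) \<le> (\<Sum>w\<in>K. 16 * card (M w))" using M by (rule sum_mono)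
  ultimately show ?thesis using K(2) by (simp add: sum_distrib_left[symmetric])
qed

text \<open>Sampling \<open>A\<close> with density \<open>1 / D\<close> turns pairs with a common neighbour in \<open>W\<close> into
  subdivided edges.\<close>

lemma has_Krt_of_partners:
  assumes fin: "finite V" "A \<subseteq> V" "A \<noteq> {}" and WV: "W \<subseteq> V" "indep W" and D: "D \<ge> 2" and rt: "r \<ge> 1"
    and deg: "\<And>w. w \<in> W \<Longrightarrow> card (nb V w) \<le> 4 * D"
    and out: "\<And>v. v \<in> V \<Longrightarrow> out v \<subseteq> nb V v \<and> card (out v) \<le> D"
    and ori: "\<And>u v. u \<in> V \<Longrightarrow> v \<in> V \<Longrightarrow> E u v \<Longrightarrow> u \<in> out v \<or> v \<in> out u"
    and part: "\<And>a. a \<in> A \<Longrightarrow> k * D \<le> 16 * card {a'\<in>A. a' \<noteq> a \<and> \<not> E a a' \<and> (\<exists>w\<in>W. E w a \<and> E w a')}"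
    and k: "k > 16 * 6 ^ 6 * (2 * (2 ^ (r * t) * (r + t)))"
  shows "has_Krt r t V"
proof -
  have finA: "finite A" using fin finite_subset by blast
  define \<kappa> where "\<kappa> = 2 * (2 ^ (r * t) * (r + t))"
  define c where "c = (6::nat) ^ 6"
  define R where "R = {(a, a'). a \<in> A \<and> a' \<in> A \<and> a' \<noteq> a \<and> \<not> E a a' \<and> (\<exists>w\<in>W. E w a \<and> E w a')}"
  define wit where "wit a a' = (SOME w. w \<in> W \<and> E w a \<and> E w a')" for a a'
  have wit_sym: "wit a a' = wit a' a" for a a' unfolding wit_def by (rule arg_cong[where f = Eps]) auto
  have wit: "wit a a' \<in> W" "E (wit a a') a" "E (wit a a') a'" if "(a, a') \<in> R" for a a'
  proof -
    have "\<exists>w. w \<in> W \<and> E w a \<and> E w a'" using that by (auto simp: R_def)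
    then have "wit a a' \<in> W \<and> E (wit a a') a \<and> E (wit a a') a'" unfolding wit_def by (rule someI_ex)
    then show "wit a a' \<in> W" "E (wit a a') a" "E (wit a a') a'" by auto
  qed
  have R_sym: "(a', a) \<in> R" if "(a, a') \<in> R" for a a' using that sym by (auto simp: R_def)
  define G where "G = PiE A (\<lambda>_. {..<D})"
  have finG: "finite G" unfolding G_def using finA by (intro finite_PiE) auto
  \<comment> \<open>What must be discarded for \<open>a\<close> and \<open>a'\<close> to form an
    edge: the other neighbours of the witness, at most \<open>4 * D\<close>, and the out-neighbours
    of both ends, at most \<open>D\<close> each. In-neighbours, whose number is not bounded, are
    handled from their own side by \<open>A'\<close>.\<close>
  define Q where "Q a a' = ((nb V (wit a a') \<union> out a \<union> out a') \<inter> A) - {a, a'}" for a a'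
  have Q_sym: "Q a a' = Q a' a" for a a' unfolding Q_def wit_sym[of a a'] by auto
  define F where "F g a a' \<longleftrightarrow> (a, a') \<in> R \<and> g a = (0::nat) \<and> g a' = 0 \<and> (\<forall>x\<in>Q a a'. g x \<noteq> 0)" for g a a'
  have finR: "finite R" using finA by (auto simp: R_def intro: finite_subset[of _ "A \<times> A"])
  have F_sym: "F g a' a" if "F g a a'" for g a a' using that R_sym Q_sym[of a a'] by (auto simp: F_def)
  have fo: "finite (out v)" if "v \<in> V" for v using out[OF that] fin finite_subset[of "out v" "nb V v"] by simp
  have cF: "D ^ card A \<le> c * D\<^sup>2 * card {g\<in>G. F g a a'}" if aR: "(a, a') \<in> R" for a a'
  proof -
    have aA: "a \<in> A" "a' \<in> A" "a \<noteq> a'" using aR by (auto simp: R_def)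
    have "card (Q a a') \<le> card (nb V (wit a a') \<union> out a \<union> out a')"
      using fo[of a] fo[of a'] fin aA by (intro card_mono) (auto simp: Q_def)
    also have "\<dots> \<le> card (nb V (wit a a')) + card (out a) + card (out a')"
      by (meson card_Un_le add_le_mono le_trans order_refl)
    also have "\<dots> \<le> 4 * D + D + D" using deg[OF wit(1)[OF aR]] out[of a] out[of a'] aA fin by (intro add_mono) auto
    finally have "card (Q a a') \<le> 6 * D" by simp
    moreover have "Q a a' \<subseteq> A - {a, a'}" by (auto simp: Q_def)
    ultimately have "D ^ card A \<le> 6 ^ 6 * D\<^sup>2 * card {g \<in> PiE A (\<lambda>_. {..<D}). g a = 0 \<and> g a' = 0 \<and> (\<forall>x\<in>Q a a'. g x \<noteq> 0)}"
      by (intro card_sample_pair_isolated finA aA D)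
    then show ?thesis using aR by (simp add: F_def G_def c_def)
  qed
  \<comment> \<open>On average |A| / D vertices are kept, while each of at least k D |A| / 16 pairs
    in \<open>R\<close> survives with probability at least 1 / (6 ^ 6 D ^ 2). The lower bound on
    \<open>k\<close> makes the average number of surviving pairs exceed \<open>\<kappa>\<close>
    times that of kept vertices.\<close>
  have "\<exists>g\<in>G. \<kappa> * card {a\<in>A. g a = 0} < card {(a, a'). F g a a'}"
  proof (rule ccontr)
    assume "\<not> ?thesis"
    then have le: "card {(a, a'). F g a a'} \<le> \<kappa> * card {a\<in>A. g a = 0}" if "g \<in> G" for g using that by (meson not_le)
    have cA: "0 < card A" using fin finA by (simp add: card_gt_0_iff)
    have cR: "card A * (k * D) \<le> 16 * card R"
    proof -
      have "R = Sigma A (\<lambda>a. {a'\<in>A. a' \<noteq> a \<and> \<not> E a a' \<and> (\<exists>w\<in>W. E w a \<and> E w a')})" by (auto simp: R_def)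
      then have "card R = (\<Sum>a\<in>A. card {a'\<in>A. a' \<noteq> a \<and> \<not> E a a' \<and> (\<exists>w\<in>W. E w a \<and> E w a')})" using finA by simp
      then have "16 * card R = (\<Sum>a\<in>A. 16 * card {a'\<in>A. a' \<noteq> a \<and> \<not> E a a' \<and> (\<exists>w\<in>W. E w a \<and> E w a')})"
        by (simp only: sum_distrib_left)
      moreover have "(\<Sum>a\<in>A. k * D) \<le> \<dots>" using part by (rule sum_mono)
      ultimately show ?thesis by simp
    qed
    have swapF: "(\<Sum>p\<in>R. card {g\<in>G. F g (fst p) (snd p)}) = (\<Sum>g\<in>G. card {(a, a'). F g a a'})"
    proof -
      have "(\<Sum>p\<in>R. card {g\<in>G. F g (fst p) (snd p)}) = card (Sigma R (\<lambda>p. {g\<in>G. F g (fst p) (snd p)}))"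
        using finR finG by simp
      also have "\<dots> = card (Sigma G (\<lambda>g. {(a, a'). F g a a'}))"
        by (rule bij_betw_same_card[of prod.swap], rule bij_betwI[where g = prod.swap]) (auto simp: F_def)
      also have "\<dots> = (\<Sum>g\<in>G. card {(a, a'). F g a a'})"
      proof -
        have "finite {(a, a'). F g a a'}" for g by (rule finite_subset[OF _ finR]) (auto simp: F_def)
        then show ?thesis using finG by simp
      qed
      finally show ?thesis .
    qed
    have swapA: "(\<Sum>a\<in>A. card {g\<in>G. g a = 0}) = (\<Sum>g\<in>G. card {a\<in>A. g a = 0})"
    proof -
      have "(\<Sum>a\<in>A. card {g\<in>G. g a = 0}) = card (Sigma A (\<lambda>a. {g\<in>G. g a = 0}))" using finA finG by simp
      also have "\<dots> = card (Sigma G (\<lambda>g. {a\<in>A. g a = 0}))"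
        by (rule bij_betw_same_card[of prod.swap], rule bij_betwI[where g = prod.swap]) auto
      also have "\<dots> = (\<Sum>g\<in>G. card {a\<in>A. g a = 0})" using finA finG by simp
      finally show ?thesis .
    qed
    define P where "P = D ^ card A"
    have Ppos: "0 < P" using D by (simp add: P_def)
    have "card R * P = (\<Sum>p\<in>R. P)" by simp
    also have "\<dots> \<le> (\<Sum>p\<in>R. c * D\<^sup>2 * card {g\<in>G. F g (fst p) (snd p)})" unfolding P_def using cF by (intro sum_mono) auto
    also have "\<dots> = c * D\<^sup>2 * (\<Sum>g\<in>G. card {(a, a'). F g a a'})" by (simp only: sum_distrib_left[symmetric] swapF)
    also have "\<dots> \<le> c * D\<^sup>2 * (\<Sum>g\<in>G. \<kappa> * card {a\<in>A. g a = 0})" using le by (intro mult_left_mono sum_mono) auto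
    also have "\<dots> = c * D * \<kappa> * (\<Sum>a\<in>A. D * card {g\<in>G. g a = 0})"
      by (simp only: sum_distrib_left[symmetric] swapA power2_eq_square ac_simps)
    also have "(\<Sum>a\<in>A. D * card {g\<in>G. g a = 0}) = (\<Sum>a\<in>A. P)"
      unfolding G_def P_def using card_sample_member[OF finA] D by (intro sum.cong refl) auto
    also have "\<dots> = card A * P" by simp
    finally have "card R * P \<le> c * D * \<kappa> * (card A * P)" .
    then have "card R * P \<le> (c * D * \<kappa> * card A) * P" by (simp only: mult.assoc)
    then have "card R \<le> c * D * \<kappa> * card A" using Ppos by simp
    then have "card A * (k * D) \<le> 16 * (c * D * \<kappa> * card A)" using cR by linarith
    then have "(card A * D) * k \<le> (card A * D) * (16 * c * \<kappa>)" by (simp only: ac_simps)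
    then have "k \<le> 16 * c * \<kappa>" using cA D by simp
    then show False using k unfolding c_def \<kappa>_def by linarith
  qed
  then obtain g where g: "g \<in> G" "\<kappa> * card {a\<in>A. g a = 0} < card {(a, a'). F g a a'}" by blast
  \<comment> \<open>Dropping the kept vertices that have a kept out-neighbour makes
    \<open>A'\<close> independent. Surviving pairs stay inside \<open>A'\<close>, because
    \<open>Q\<close> contains the out-neighbours of their ends.\<close>
  define A' where "A' = {a\<in>A. g a = 0 \<and> (\<forall>x\<in>out a \<inter> A. g x \<noteq> 0)}"
  have finA': "finite A'" "A' \<subseteq> A" using finA by (auto simp: A'_def)
  have FA': "a \<in> A' \<and> a' \<in> A'" if F: "F g a a'" for a a'
  proof -
    have *: "(a, a') \<in> R" "g a = 0" "g a' = 0" "\<And>x. x \<in> Q a a' \<Longrightarrow> g x \<noteq> 0" using F by (auto simp: F_def)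
    then have aA: "a \<in> A" "a' \<in> A" "\<not> E a a'" "\<not> E a' a" using sym by (auto simp: R_def)
    have "out a \<subseteq> nb V a" "out a' \<subseteq> nb V a'" using out aA fin by auto
    then have "a \<notin> out a" "a' \<notin> out a" "a \<notin> out a'" "a' \<notin> out a'" using aA irrefl by (auto simp: nb_def)
    then have "out a \<inter> A \<subseteq> Q a a'" "out a' \<inter> A \<subseteq> Q a a'" by (auto simp: Q_def)
    then show ?thesis using * aA by (auto simp: A'_def)
  qed
  interpret FF: sym_rel "F g"
  proof
    show "F g x y \<Longrightarrow> F g y x" for x y by (rule F_sym)
    show "\<not> F g x x" for x by (simp add: F_def R_def)
  qed
  have arcs: "FF.arcs_on A' = {(a, a'). F g a a'}" using FA' by (auto simp: FF.arcs_on_def)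
  have "card A' \<le> card {a\<in>A. g a = 0}" using finA by (intro card_mono) (auto simp: A'_def)
  then have "\<kappa> * card A' \<le> \<kappa> * card {a\<in>A. g a = 0}" by (rule mult_left_mono) simp
  then have dense: "\<kappa> * card A' \<le> card (FF.arcs_on A')" using g(2) unfolding arcs by linarith
  have "0 < card (FF.arcs_on A')" using g(2) unfolding arcs by linarith
  then have "A' \<noteq> {}" by (auto simp: FF.arcs_on_def)
  then have "\<exists>K S. complete_bipartite_digraph r t (with_proj K) \<and> subdivision_pair K S \<and> pverts S \<subseteq> A' \<and> parcs S \<subseteq> {(x, y). F g x y}"
    using finA' rt dense unfolding \<kappa>_def by (intro FF.dense_has_subdivided_Krt) auto
  then obtain K S where KS: "complete_bipartite_digraph r t (with_proj K)" "subdivision_pair K S" "pverts S \<subseteq> A'"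
      "parcs S \<subseteq> {(x, y). F g x y}" by blast
  have FR: "(a, a') \<in> R" if "F g a a'" for a a' using that by (simp add: F_def)
  have "subdivided A' (F g) wit" unfolding subdivided_def
  proof (intro conjI allI impI)
    show "indep A'" unfolding indep_def
    proof (intro ballI notI)
      fix a b assume ab: "a \<in> A'" "b \<in> A'" "E a b"
      then have "a \<in> V" "b \<in> V" using finA' fin by auto
      then have "a \<in> out b \<or> b \<in> out a" using ori ab(3) by blast
      moreover have "a \<in> A" "g a = 0" "b \<in> A" "g b = 0" "\<forall>x\<in>out a \<inter> A. g x \<noteq> 0" "\<forall>x\<in>out b \<inter> A. g x \<noteq> 0"
        using ab unfolding A'_def by blast+
      ultimately show False by blast
    qed
  next
    fix a b assume F: "F g a b"
    show "a \<in> A'" "b \<in> A'" using FA'[OF F] by auto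
    show "a \<noteq> b" using FR[OF F] by (auto simp: R_def)
    show "F g b a" using F by (rule F_sym)
    show "wit a b = wit b a" by (rule wit_sym)
    show "nb A' (wit a b) = {a, b}"
    proof (intro equalityI subsetI)
      fix x assume "x \<in> nb A' (wit a b)"
      then have x: "x \<in> A" "g x = 0" "E (wit a b) x" using finA' by (auto simp: nb_def A'_def)
      then have "x \<in> nb V (wit a b)" using fin by (auto simp: nb_def)
      then have "x \<in> {a, b} \<or> x \<in> Q a b" using x by (auto simp: Q_def)
      then show "x \<in> {a, b}" using F x(2) by (auto simp: F_def)
    next
      fix x assume "x \<in> {a, b}"
      then show "x \<in> nb A' (wit a b)" using FA'[OF F] wit[OF FR[OF F]] by (auto simp: nb_def)
    qed
  next
    fix a b c d assume "F g a b" "F g c d"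
    then have "wit a b \<in> W" "wit c d \<in> W" using wit(1) FR by auto
    then show "\<not> E (wit a b) (wit c d)" using WV(2) by (auto simp: indep_def)
  qed
  moreover have "A' \<subseteq> V" using finA' fin by blast
  moreover have "wit a b \<in> V" if "F g a b" for a b using wit(1)[OF FR[OF that]] WV by blast
  ultimately show ?thesis unfolding has_Krt_def using KS finA' by blast
qed

end

section \<open>Degenerate graphs\<close>

context sym_rel begin

text \<open>The factor 100 in \<open>\<kappa>\<close> pays for the degree bound \<open>5 * D\<close>
  of the enlarged graph \<open>U\<close> and for restricting to the half \<open>B\<close> of small
  degrees, and still gives \<open>5 * (k * card V) \<le> D * card W\<close>. Every \<open>w\<close>
  has at least D / 2 neighbours of small codegree, so deleting vertices of small degree leaves
  \<open>k\<close> neighbours for each \<open>a\<close> and at least D / 8 for each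
  \<open>w\<close>.\<close>

lemma has_Krt_of_degenerate:
  fixes r t s D q :: nat
  defines "k \<equiv> 16 * 6 ^ 6 * (2 * (2 ^ (r * t) * (r + t))) + 1"
  defines "\<kappa> \<equiv> 100 * k"
  defines "N \<equiv> 4 * s * (q + 1) * (4 * s) ^ Suc (4 * \<kappa>) + 2 * 2 ^ (4 * \<kappa>) * count_loss s (Suc (4 * \<kappa>))"
  assumes fin: "finite V" and ne: "V \<noteq> {}" and bf: "biclique_free s" and s: "s \<ge> 1" and r: "r \<ge> 1"
    and mindeg: "\<And>v. v \<in> V \<Longrightarrow> D \<le> card (nb V v)"
    and degen: "\<And>W. W \<subseteq> V \<Longrightarrow> W \<noteq> {} \<Longrightarrow> \<exists>v\<in>W. card (nb W v) \<le> D"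
    and heavy: "\<And>b. b \<in> V \<Longrightarrow> card (nb V b) \<le> 4 * D \<Longrightarrow> card {x\<in>V. D \<le> 32 * k * codegree V b x} \<le> q"
    and D: "32 \<le> D" "2 * q \<le> D" "\<kappa> * (1 + 2 * (N + 1) ^ (4 * \<kappa>)) \<le> D"
  shows "has_Krt r t V"
proof -
  have k: "k \<ge> 1" by (simp add: k_def)
  obtain out where out: "\<forall>v\<in>V. out v \<subseteq> nb V v \<and> card (out v) \<le> D"
      and ori: "\<forall>u\<in>V. \<forall>v\<in>V. E u v \<longrightarrow> u \<in> out v \<or> v \<in> out u"
    using degenerate_orientation[OF fin degen] by blast
  define B where "B = {v\<in>V. card (nb V v) \<le> 4 * D}"
  have finB: "finite B" "B \<subseteq> V" using fin by (auto simp: B_def)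
  have cB: "card V \<le> 2 * card B" unfolding B_def by (rule half_small_degree[OF fin, where out = out]) (use out ori D in auto)
  define hv where "hv b = {x\<in>V. D \<le> 32 * k * codegree V b x}" for b
  have hvB: "card (hv b) \<le> q" if "b \<in> B" for b using heavy that by (simp add: hv_def B_def)
  have finhv: "finite (hv b)" for b using fin by (simp add: hv_def)
  define U where "U x y \<longleftrightarrow> x \<noteq> y \<and> (E x y \<or> D \<le> 32 * k * codegree V x y)" for x y
  interpret U: sym_rel U
    by unfold_locales (auto simp: U_def codegree_commute intro: sym)
  have Udeg: "card (U.nb B v) \<le> 5 * D" if v: "v \<in> B" for v
  proof -
    have "U.nb B v \<subseteq> nb V v \<union> hv v" using finB by (auto simp: U.nb_def nb_def hv_def U_def)
    then have "card (U.nb B v) \<le> card (nb V v \<union> hv v)" using fin finhv by (intro card_mono) auto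
    also have "\<dots> \<le> card (nb V v) + card (hv v)" by (rule card_Un_le)
    also have "\<dots> \<le> 4 * D + q" using hvB[OF v] v by (intro add_mono) (auto simp: B_def)
    finally show ?thesis using D by linarith
  qed
  \<comment> \<open>Passing from \<open>E\<close> to \<open>U\<close> costs \<open>v\<close> at most
    \<open>q\<close> non-neighbours, itself included, which is little against a set of size
    \<open>4 * s * (q + 1)\<close>. So a vertex that nearly dominates \<open>X\<close> under
    \<open>U\<close> also does so under \<open>E\<close>, and \<open>few_dominating\<close>
    applies.\<close>
  have sparse: "2 * card {v\<in>X. 4 * s * card (X - U.nb X v - {v}) < card X} \<le> card X"
    if X: "X \<subseteq> B" "4 * s * (q + 1) \<le> card X" for X
  proof -
    have finX: "finite X" using X finB finite_subset by blast
    have "4 * s \<le> 4 * s * (q + 1)" by simp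
    then have big: "4 * s \<le> card X" using X(2) by linarith
    have "{v\<in>X. 4 * s * card (X - U.nb X v - {v}) < card X} \<subseteq> {v\<in>X. 2 * s * card (X - nb X v) < card X}"
    proof (rule subsetI, rule ccontr)
      fix v assume v: "v \<in> {v\<in>X. 4 * s * card (X - U.nb X v - {v}) < card X}" and "v \<notin> {v\<in>X. 2 * s * card (X - nb X v) < card X}"
      then have ge: "card X \<le> 2 * s * card (X - nb X v)" by auto
      have vB: "v \<in> B" using v X by auto
      \<comment> \<open>The codegree of \<open>v\<close> with itself is its degree, so the bound
        \<open>q\<close> on \<open>hv v\<close> already covers the removal of
        \<open>v\<close>.\<close>
      have "v \<in> hv v"
      proof -
        have "D \<le> codegree V v v" using mindeg vB finB by (auto simp: codegree_def)
        also have "\<dots> \<le> 32 * k * codegree V v v" using k by simp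
        finally show ?thesis using vB finB by (auto simp: hv_def)
      qed
      then have "X - nb X v \<subseteq> (X - U.nb X v - {v}) \<union> hv v" using X finB by (auto simp: U.nb_def nb_def hv_def U_def)
      then have "card (X - nb X v) \<le> card ((X - U.nb X v - {v}) \<union> hv v)" using finX finhv by (intro card_mono) auto
      also have "\<dots> \<le> card (X - U.nb X v - {v}) + card (hv v)" by (rule card_Un_le)
      also have "\<dots> \<le> card (X - U.nb X v - {v}) + q" using hvB[OF vB] by simp
      finally have "2 * s * card (X - nb X v) \<le> 2 * s * (card (X - U.nb X v - {v}) + q)" by (rule mult_left_mono) simp
      then have "2 * card X \<le> 4 * s * card (X - U.nb X v - {v}) + 4 * s * q" using ge by (simp add: algebra_simps)
      moreover have "4 * s * q \<le> card X" using X(2) by (simp add: algebra_simps)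
      ultimately show False using v by simp
    qed
    then have "card {v\<in>X. 4 * s * card (X - U.nb X v - {v}) < card X} \<le> card {v\<in>X. 2 * s * card (X - nb X v) < card X}"
      using finX by (intro card_mono) auto
    moreover have "card {v\<in>X. 2 * s * card (X - nb X v) < card X} < s"
      using big by (intro few_dominating bf s finX) auto
    ultimately show ?thesis using big by linarith
  qed
  have "\<exists>W\<subseteq>B. U.indep W \<and> \<kappa> * card B \<le> 2 * (5 * D) * card W"
  proof (rule U.large_indep_set[where N = N])
    show "finite B" by fact
    show "1 \<le> \<kappa>" using k by (simp add: \<kappa>_def)
    show "card (U.nb B v) \<le> 5 * D" if "v \<in> B" for v using Udeg[OF that] .
    show "2 * (card Y + 1) ^ (4 * \<kappa>) \<le> card {S. S \<subseteq> Y \<and> U.indep S}" if Y: "Y \<subseteq> B" "N \<le> card Y" for Y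
    proof (rule U.many_indep_sets[where B = B and N = "4 * s * (q + 1)" and s = s])
      fix X assume "X \<subseteq> B" "4 * s * (q + 1) \<le> card X"
      then show "2 * card {v\<in>X. 4 * s * card (X - U.nb X v - {v}) < card X} \<le> card X" by (rule sparse)
    qed (use Y finB s in \<open>simp_all add: N_def del: count_loss.simps\<close>)
    show "\<kappa> * (1 + 2 * (N + 1) ^ (4 * \<kappa>)) \<le> 5 * D" using D(3) by linarith
  qed
  then obtain W where W: "W \<subseteq> B" "U.indep W" "\<kappa> * card B \<le> 10 * D * card W" by auto
  have finW: "finite W" "W \<subseteq> V" using W(1) finB finite_subset by blast+
  have Vpos: "0 < card V" using fin ne by (simp add: card_gt_0_iff)
  have WV: "5 * (k * card V) \<le> D * card W"
  proof -
    have "k * card V \<le> k * (2 * card B)" using cB by (rule mult_left_mono) simp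
    moreover have "k * (2 * card B) = 2 * (k * card B)" by simp
    moreover have "100 * (k * card B) \<le> 10 * (D * card W)" using W(3) by (simp only: \<kappa>_def mult.assoc)
    ultimately show ?thesis by linarith
  qed
  have Wpos: "0 < card W" using WV k Vpos by (metis gr0I le_zero_eq mult_is_0 not_one_le_zero zero_neq_numeral)
  have indW: "indep W" using W(2) irrefl unfolding indep_def U.indep_def U_def by metis
  define H where "H w a \<longleftrightarrow> E w a \<and> 32 * k * codegree V w a < D" for w a
  define l where "l = D div 8 + 1"
  have l: "D \<le> 8 * l" "8 * l \<le> D + 8" by (auto simp: l_def)
  have "D * card W \<le> 2 * card {(w, a) \<in> W \<times> V. H w a}"
  proof -
    have "{(w, a) \<in> W \<times> V. H w a} = Sigma W (\<lambda>w. {a\<in>V. H w a})" by auto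
    then have "card {(w, a) \<in> W \<times> V. H w a} = (\<Sum>w\<in>W. card {a\<in>V. H w a})" using finW fin by simp
    moreover have "(\<Sum>w\<in>W. D) \<le> (\<Sum>w\<in>W. 2 * card {a\<in>V. H w a})"
    proof (rule sum_mono)
      fix w assume w: "w \<in> W"
      then have wB: "w \<in> B" "w \<in> V" using W finW by auto
      have "nb V w - hv w \<subseteq> {a\<in>V. H w a}" by (auto simp: nb_def hv_def H_def not_le)
      then have "card (nb V w - hv w) \<le> card {a\<in>V. H w a}" using fin by (intro card_mono) auto
      moreover have "card (nb V w) - card (hv w) \<le> card (nb V w - hv w)" using finhv by (rule diff_card_le_card_Diff)
      ultimately show "D \<le> 2 * card {a\<in>V. H w a}" using hvB[OF wB(1)] mindeg[OF wB(2)] D(2) by linarith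
    qed
    ultimately show ?thesis by (simp add: sum_distrib_left[symmetric] mult.commute)
  qed
  moreover have "8 * (l * card W) \<le> D * card W + 8 * card W" using mult_right_mono[OF l(2), of "card W"] by (simp add: algebra_simps)
  moreover have "32 * card W \<le> D * card W" using D(1) by (rule mult_right_mono) simp
  ultimately have "k * card V + l * card W < card {(w, a) \<in> W \<times> V. H w a}" using WV Wpos by linarith
  then obtain W1 A where WA: "W1 \<subseteq> W" "A \<subseteq> V" "A \<noteq> {}" "\<And>a. a \<in> A \<Longrightarrow> k \<le> card {w\<in>W1. H w a}"
      "\<And>w. w \<in> W1 \<Longrightarrow> l \<le> card {a\<in>A. H w a}"
    using bipartite_min_degree_core[OF finW(1) fin, of k l H] by blast
  show ?thesis
  proof (rule has_Krt_of_partners[where A = A and W = W1 and D = D and out = out and k = k])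
    show "card (nb V w) \<le> 4 * D" if "w \<in> W1" for w using that WA(1) W(1) by (auto simp: B_def)
    show "indep W1" using indW WA(1) by (rule indep_subset)
    show "k * D \<le> 16 * card {a'\<in>A. a' \<noteq> a \<and> \<not> E a a' \<and> (\<exists>w\<in>W1. E w a \<and> E w a')}" if a: "a \<in> A" for a
    proof (rule many_partners[where V = V and H = H])
      show "32 * k * codegree V w w' < D" if "w \<in> W1" "w' \<in> W1" "w \<noteq> w'" for w w'
        using that WA(1) W(2) by (auto simp: U.indep_def U_def not_le)
      show "D \<le> 8 * card {a\<in>A. H w a}" if "w \<in> W1" for w using WA(5)[OF that] l(1) by linarith
      show "finite W1" using WA(1) finW finite_subset by blast
    qed (use fin WA a k D H_def in auto)
    show "16 * 6 ^ 6 * (2 * (2 ^ (r * t) * (r + t))) < k" by (simp add: k_def)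
  qed (use fin WA finW out ori D r in auto)
qed

section \<open>Ramsey bound and greedy colouring\<close>

lemma has_Krt_mono: "has_Krt r t W \<Longrightarrow> W \<subseteq> V \<Longrightarrow> has_Krt r t V"
  unfolding has_Krt_def by (meson order_trans subsetD)

text \<open>Polynomial in \<open>k\<close> for fixed \<open>h\<close>. If some vertex has
  \<open>k ^ h\<close> non-neighbours besides itself, continue among them with smaller
  \<open>h\<close>. Otherwise each vertex rules out at most \<open>k ^ h\<close> vertices, itself
  included, and a clique of size \<open>k\<close> can be built greedily.\<close>

lemma indep_or_clique:
  assumes "finite X" "k ^ h \<le> card X" "k \<ge> 1"
  shows "(\<exists>S\<subseteq>X. indep S \<and> card S = h) \<or> (\<exists>S\<subseteq>X. card S = k \<and> (\<forall>x\<in>S. \<forall>y\<in>S. x \<noteq> y \<longrightarrow> E x y))"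
  using assms
proof (induction h arbitrary: X)
  case 0
  then show ?case by (auto simp: indep_def intro!: exI[of _ "{}"])
next
  case (Suc h)
  show ?case
  proof (cases "\<exists>v\<in>X. k ^ h \<le> card (X - nb X v - {v})")
    case True
    then obtain v where v: "v \<in> X" "k ^ h \<le> card (X - nb X v - {v})" by blast
    then consider S where "S \<subseteq> X - nb X v - {v}" "indep S" "card S = h"
      | S where "S \<subseteq> X - nb X v - {v}" "card S = k" "\<forall>x\<in>S. \<forall>y\<in>S. x \<noteq> y \<longrightarrow> E x y"
      using Suc.IH[of "X - nb X v - {v}"] Suc.prems by auto
    then show ?thesis
    proof cases
      case 1
      have "finite S" using 1 Suc.prems by (meson Diff_subset finite_subset)
      moreover have "v \<notin> S" "\<And>u. u \<in> S \<Longrightarrow> \<not> E v u" using 1 by (auto simp: nb_def)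
      moreover have "\<And>u. u \<in> S \<Longrightarrow> \<not> E u v" using calculation(3) sym by blast
      ultimately have "insert v S \<subseteq> X" "indep (insert v S)" "card (insert v S) = Suc h"
        using 1 v irrefl by (auto simp: indep_def)
      then show ?thesis by blast
    next
      case 2
      have "S \<subseteq> X" using 2(1) by blast
      then show ?thesis using 2(2,3) by blast
    qed
  next
    case False
    have few: "card (X - nb X v) \<le> k ^ h" if "v \<in> X" for v
    proof -
      have "v \<in> X - nb X v" using that irrefl by (auto simp: nb_def)
      then have "card (X - nb X v) = Suc (card (X - nb X v - {v}))" using Suc.prems(1) by (metis card_Suc_Diff1 finite_Diff)
      moreover have "card (X - nb X v - {v}) < k ^ h" using False that by (meson not_less)
      ultimately show ?thesis by simp
    qed
    have "\<exists>S\<subseteq>X. card S = i \<and> (\<forall>x\<in>S. \<forall>y\<in>S. x \<noteq> y \<longrightarrow> E x y)" if "i \<le> k" for i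
      using that
    proof (induction i)
      case 0
      then show ?case by (intro exI[of _ "{}"]) auto
    next
      case (Suc i)
      then obtain S where S: "S \<subseteq> X" "card S = i" "\<forall>x\<in>S. \<forall>y\<in>S. x \<noteq> y \<longrightarrow> E x y" by auto
      have finS: "finite S" using S(1) Suc.prems \<open>finite X\<close> finite_subset by blast
      have "card (\<Union>v\<in>S. X - nb X v) \<le> (\<Sum>v\<in>S. card (X - nb X v))" using finS by (rule card_UN_le)
      also have "\<dots> \<le> (\<Sum>v\<in>S. k ^ h)" using few S(1) by (intro sum_mono) auto
      also have "\<dots> = i * k ^ h" using S(2) by simp
      also have "\<dots> < k * k ^ h" using Suc.prems assms(3) by (intro mult_strict_right_mono) auto
      also have "\<dots> \<le> card X" using \<open>k ^ Suc h \<le> card X\<close> by simp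
      finally have "\<not> X \<subseteq> (\<Union>v\<in>S. X - nb X v)" using finS \<open>finite X\<close>
        by (metis card_mono finite_Diff finite_UN not_less)
      then obtain x where x: "x \<in> X" "\<And>v. v \<in> S \<Longrightarrow> E v x" by (auto simp: nb_def)
      have "x \<notin> S" using x(2) irrefl by blast
      then have "card (insert x S) = Suc i" using finS S(2) by simp
      moreover have "\<forall>u\<in>insert x S. \<forall>v\<in>insert x S. u \<noteq> v \<longrightarrow> E u v" using S(3) x(2) sym by auto
      ultimately show ?case using S(1) x(1) by (intro exI[of _ "insert x S"]) auto
    qed
    then show ?thesis by blast
  qed
qed

lemma degenerate_colouring:
  assumes "finite V" "\<And>W. W \<subseteq> V \<Longrightarrow> W \<noteq> {} \<Longrightarrow> \<exists>v\<in>W. card (nb W v) < k"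
  shows "\<exists>c :: 'a \<Rightarrow> nat. (\<forall>u\<in>V. \<forall>v\<in>V. E u v \<longrightarrow> c u \<noteq> c v) \<and> c ` V \<subseteq> {..<k}"
  using assms
proof (induction "card V" arbitrary: V)
  case 0
  then show ?case by simp
next
  case (Suc n)
  then have "V \<noteq> {}" by auto
  then obtain v where v: "v \<in> V" "card (nb V v) < k" using Suc.prems(2)[of V] by blast
  have "\<exists>c :: 'a \<Rightarrow> nat. (\<forall>u\<in>V - {v}. \<forall>w\<in>V - {v}. E u w \<longrightarrow> c u \<noteq> c w) \<and> c ` (V - {v}) \<subseteq> {..<k}"
  proof (rule Suc.hyps(1))
    show "n = card (V - {v})" using Suc.hyps(2) v Suc.prems(1) by simp
    show "\<exists>v\<in>W. card (nb W v) < k" if "W \<subseteq> V - {v}" "W \<noteq> {}" for W using Suc.prems(2)[of W] that by blast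
  qed (use Suc.prems in simp)
  then obtain c :: "'a \<Rightarrow> nat" where c: "\<forall>u\<in>V - {v}. \<forall>w\<in>V - {v}. E u w \<longrightarrow> c u \<noteq> c w" "c ` (V - {v}) \<subseteq> {..<k}" by blast
  have "card (c ` nb V v) < card {..<k}" using card_image_le[of "nb V v" c] v(2) Suc.prems(1) by simp
  then have "\<not> {..<k} \<subseteq> c ` nb V v" using Suc.prems(1) by (metis card_mono finite_imageI finite_nb not_less)
  then obtain i where i: "i < k" "i \<notin> c ` nb V v" by auto
  show ?case
  proof (intro exI[of _ "c(v := i)"] conjI ballI impI)
    fix u w assume uw: "u \<in> V" "w \<in> V" "E u w"
    consider "u = v" "w \<in> nb V v" | "w = v" "u \<in> nb V v" | "u \<noteq> v" "w \<noteq> v"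
      using uw sym by (auto simp: nb_def)
    then show "(c(v := i)) u \<noteq> (c(v := i)) w"
      using c(1) i(2) uw irrefl by cases (auto simp: nb_def)
  next
    show "(c(v := i)) ` V \<subseteq> {..<k}" using c(2) i(1) by auto
  qed
qed

end

section \<open>The polynomial bound\<close>

lemma poly_bounded_count_loss: "poly_bounded (\<lambda>s. count_loss s j)"
proof (induction j)
  case 0
  show ?case unfolding count_loss.simps by (rule poly_bounded_const)
next
  case (Suc j)
  then show ?case unfolding count_loss.simps by (intro poly_bounded_intros)
qed

text \<open>\<open>g\<close> and \<open>s0\<close> are quantified before the graph, so that one
  bound serves all graphs on the type.\<close>

lemma has_Krt_of_large_min_degree:
  fixes r t :: nat
  assumes rt: "r \<ge> 1" "t \<ge> 1"
  shows "\<exists>g s0. poly_bounded g \<and> (\<forall>(E :: 'a \<Rightarrow> 'a \<Rightarrow> bool) V s. sym_rel E \<longrightarrow> s0 \<le> s \<longrightarrow> sym_rel.biclique_free E s \<longrightarrow>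
    finite V \<longrightarrow> V \<noteq> {} \<longrightarrow> (\<forall>v\<in>V. g s \<le> card (sym_rel.nb E V v)) \<longrightarrow> sym_rel.has_Krt E r t V)"
proof -
  define k where "k = 16 * 6 ^ 6 * (2 * (2 ^ (r * t) * (r + t))) + (1::nat)"
  define \<kappa> where "\<kappa> = 100 * k"
  \<comment> \<open>A codegree of at least D / (32 k) inside a neighbourhood of size at most 4 D is
    a fraction 1 / (128 k). \<open>q\<close> and \<open>y\<close> below are the numbers of vertices
    that \<open>has_Krt_of_dense_nbs\<close> asks for on its two sides.\<close>
  define c where "c = 128 * k"
  define v where "v = (r + t)\<^sup>2"
  define m where "m s = 2 * c * s * s" for s :: nat
  define M where "M s = (r + t) * (2 * s) ^ (r + t) * (m s + 1) ^ (2 * v)" for s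
  define q where "q s = s * M s" for s
  define y where "y s = 2 * c * s + 2 * (m s ^ v * M s ^ (r + t)) * (r * t * (2 * s) ^ (r * t))" for s
  define N where "N s = 4 * s * (q s + 1) * (4 * s) ^ Suc (4 * \<kappa>) + 2 * 2 ^ (4 * \<kappa>) * count_loss s (Suc (4 * \<kappa>))" for s
  define g where "g s = 32 + 2 * q s + \<kappa> * (1 + 2 * (N s + 1) ^ (4 * \<kappa>)) + y s" for s
  have pM: "poly_bounded M" unfolding M_def m_def by (intro poly_bounded_intros)
  have pq: "poly_bounded q" unfolding q_def by (intro poly_bounded_intros pM)
  have py: "poly_bounded y" unfolding y_def m_def by (intro poly_bounded_intros pM)
  have pN: "poly_bounded N" unfolding N_def by (intro poly_bounded_intros pq poly_bounded_count_loss)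
  have pg: "poly_bounded g" unfolding g_def by (intro poly_bounded_intros pq py pN)
  have "poly_bounded (\<lambda>s. 2 * (M s)\<^sup>2)" by (intro poly_bounded_intros pM)
  then obtain s0 where s0: "\<And>s. s \<ge> s0 \<Longrightarrow> 2 * (M s)\<^sup>2 \<le> 2 ^ s" using poly_bounded_le_exp by blast
  have k: "k \<ge> 1" by (simp add: k_def)
  show ?thesis
  proof (rule exI[of _ g], rule exI[of _ "max s0 1"], intro conjI pg allI impI)
    fix E :: "'a \<Rightarrow> 'a \<Rightarrow> bool" and V s
    assume E: "sym_rel E" and s: "max s0 1 \<le> s" and bf: "sym_rel.biclique_free E s" and fin: "finite V" and ne: "V \<noteq> {}"
      and "\<forall>v\<in>V. g s \<le> card (sym_rel.nb E V v)"
    then have deg: "\<And>v. v \<in> V \<Longrightarrow> g s \<le> card (sym_rel.nb E V v)" by blast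
    interpret sym_rel E by fact
    have s1: "s \<ge> 1" using s by simp
    \<comment> \<open>A subgraph of largest minimum degree \<open>D\<close> also has degeneracy at
      most \<open>D\<close>, since no subset has minimum degree \<open>Suc D\<close>. The range
      \<open>{..card V}\<close> keeps the choice finite.\<close>
    define P where "P = {(W, d) \<in> Pow V \<times> {..card V}. W \<noteq> {} \<and> (\<forall>v\<in>W. d \<le> card (nb W v))}"
    obtain v0 where v0: "v0 \<in> V" using ne by blast
    have nble: "card (nb W v) \<le> card V" if "W \<subseteq> V" for W v
      using that fin by (intro card_mono) (auto simp: nb_def)
    have "(V, g s) \<in> P" using deg ne le_trans[OF deg[OF v0] nble[OF subset_refl]] by (auto simp: P_def)
    moreover have "finite P" using fin by (auto simp: P_def intro: finite_subset[of _ "Pow V \<times> {..card V}"])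
    ultimately have "\<exists>p\<in>P. \<forall>p'\<in>P. snd p' \<le> snd p" by (intro ex_maximizer) auto
    then obtain W D where WD: "(W, D) \<in> P" "\<And>W' D'. (W', D') \<in> P \<Longrightarrow> D' \<le> D" by force
    have gD: "g s \<le> D" using WD(2)[OF \<open>(V, g s) \<in> P\<close>] .
    have W: "W \<subseteq> V" "W \<noteq> {}" "\<And>v. v \<in> W \<Longrightarrow> D \<le> card (nb W v)" using WD(1) by (auto simp: P_def)
    have finW: "finite W" using W(1) fin finite_subset by blast
    have degen: "\<exists>v\<in>W'. card (nb W' v) \<le> D" if W': "W' \<subseteq> W" "W' \<noteq> {}" for W'
    proof (rule ccontr)
      assume "\<not> ?thesis"
      then have *: "\<forall>v\<in>W'. Suc D \<le> card (nb W' v)" by (meson not_less_eq_eq)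
      obtain v where "v \<in> W'" using W' by blast
      then have "Suc D \<le> card V" using * nble[of W' v] W' W(1) by (meson le_trans order_trans)
      then have "(W', Suc D) \<in> P" using * W' W(1) by (auto simp: P_def)
      then show False using WD(2) by fastforce
    qed
    have "has_Krt r t W"
    proof (rule ccontr)
      assume no: "\<not> has_Krt r t W"
      have heavy: "card {x\<in>W. D \<le> 32 * k * codegree W b x} \<le> q s" if b: "b \<in> W" "card (nb W b) \<le> 4 * D" for b
      proof (rule ccontr)
        assume neg: "\<not> ?thesis"
        have "has_Krt r t W"
        proof (rule has_Krt_of_dense_nbs[where s = s and c = c and A = "{x\<in>W. D \<le> 32 * k * codegree W b x}" and Y = "nb W b"])
          show "c \<ge> 1" using k by (simp add: c_def)
          show "2 * ((r + t) * (2 * s) ^ (r + t) * (2 * c * s * s + 1) ^ (2 * (r + t)\<^sup>2))\<^sup>2 \<le> 2 ^ s"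
            using s0[of s] s by (simp add: M_def m_def v_def)
          show "card (nb W b) \<le> c * card (nb (nb W b) a)" if "a \<in> {x\<in>W. D \<le> 32 * k * codegree W b x}" for a
          proof -
            have "nb (nb W b) a = nb W b \<inter> nb W a" by (auto simp: nb_def)
            then have "D \<le> 32 * k * card (nb (nb W b) a)" using that by (simp add: codegree_def)
            then show ?thesis using b(2) by (simp add: c_def)
          qed
          show "s * ((r + t) * (2 * s) ^ (r + t) * (2 * c * s * s + 1) ^ (2 * (r + t)\<^sup>2)) \<le> card {x\<in>W. D \<le> 32 * k * codegree W b x}"
            using neg by (simp add: q_def M_def m_def v_def)
          have yb: "y s \<le> card (nb W b)" using gD W(3)[OF b(1)] by (simp add: g_def)
          then show "2 * c * s \<le> card (nb W b)" by (simp add: y_def)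
          show "2 * ((2 * c * s * s) ^ (r + t)\<^sup>2 * ((r + t) * (2 * s) ^ (r + t) * (2 * c * s * s + 1) ^ (2 * (r + t)\<^sup>2)) ^ (r + t)) *
              (r * t * (2 * s) ^ (r * t)) \<le> card (nb W b)"
            using yb unfolding y_def M_def m_def v_def by linarith
        qed (use finW bf s1 rt nb_subset in auto)
        then show False using no by blast
      qed
      have "has_Krt r t W"
      proof (rule has_Krt_of_degenerate[where s = s and D = D and q = "q s"])
        show "card {x\<in>W. D \<le> 32 * (16 * 6 ^ 6 * (2 * (2 ^ (r * t) * (r + t))) + 1) * codegree W b x} \<le> q s"
          if "b \<in> W" "card (nb W b) \<le> 4 * D" for b using heavy[OF that] unfolding k_def .
        have "\<kappa> * (1 + 2 * (N s + 1) ^ (4 * \<kappa>)) \<le> D" using gD by (simp add: g_def)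
        then show "100 * (16 * 6 ^ 6 * (2 * (2 ^ (r * t) * (r + t))) + 1) *
          (1 + 2 * (4 * s * (q s + 1) * (4 * s) ^ Suc (4 * (100 * (16 * 6 ^ 6 * (2 * (2 ^ (r * t) * (r + t))) + 1))) +
            2 * 2 ^ (4 * (100 * (16 * 6 ^ 6 * (2 * (2 ^ (r * t) * (r + t))) + 1))) *
              count_loss s (Suc (4 * (100 * (16 * 6 ^ 6 * (2 * (2 ^ (r * t) * (r + t))) + 1)))) + 1) ^
            (4 * (100 * (16 * 6 ^ 6 * (2 * (2 ^ (r * t) * (r + t))) + 1)))) \<le> D"
          unfolding N_def \<kappa>_def k_def .
        show "2 * q s \<le> D" "32 \<le> D" using gD by (simp_all add: g_def)
      qed (use finW W bf s1 rt degen in auto)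
      then show False using no by blast
    qed
    then show "has_Krt r t V" using W(1) by (rule has_Krt_mono)
  qed
qed

section \<open>From relations back to induced subdivisions in digraphs\<close>

lemma digraph_iso_refl:
  assumes "wf_digraph G" shows "digraph_iso G G"
proof -
  define f where "f = \<lparr>iso_verts = id, iso_arcs = id, iso_head = head G, iso_tail = tail G\<rparr>"
  have "pre_digraph.digraph_isomorphism G f" using assms by (simp add: pre_digraph.digraph_isomorphism_def f_def)
  moreover have "G = app_iso f G" by (simp add: app_iso_def f_def)
  ultimately show ?thesis unfolding digraph_iso_def by blast
qed

lemma has_induced_subdivisionI:
  assumes G: "pair_graph G" and K: "complete_bipartite_digraph r t (with_proj K)" and S: "subdivision_pair K S"
    and sub: "pverts S \<subseteq> pverts G" and ind: "parcs S = {(u, v) \<in> parcs G. u \<in> pverts S \<and> v \<in> pverts S}"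
  shows "has_induced_subdivision_of_Krt r t G"
proof -
  interpret G: pair_graph G by fact
  interpret S: pair_bidirected_digraph S using S by (rule bidirected_digraphI_subdivision)
  have "induced_subgraph (with_proj S) (with_proj G)"
  proof
    show "subgraph (with_proj S) (with_proj G)"
    proof (rule subgraphI)
      show "verts (with_proj S) \<subseteq> verts (with_proj G)" "arcs (with_proj S) \<subseteq> arcs (with_proj G)" using sub ind by auto
      show "wf_digraph (with_proj S)" "wf_digraph (with_proj G)" by unfold_locales
    qed (rule compatibleI_with_proj)
    show "arcs (with_proj S) = {e \<in> arcs (with_proj G). tail (with_proj G) e \<in> verts (with_proj S) \<and> head (with_proj G) e \<in> verts (with_proj S)}"
      using ind by auto
  qed
  moreover have "digraph_iso (with_proj S) (with_proj S)" by (rule digraph_iso_refl) unfold_locales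
  ultimately show ?thesis unfolding has_induced_subdivision_of_Krt_def using K S by blast
qed

text \<open>Arcs enter \<open>Y\<close> one at a time, so \<open>Y\<close> may contain one or both
  arcs of an edge; both must go in either case, hence \<open>Y \<union> Y\<inverse>\<close>.\<close>

definition subdivide_edges :: "'a pair_pre_digraph \<Rightarrow> ('a \<Rightarrow> 'a \<Rightarrow> 'a) \<Rightarrow> ('a \<times> 'a) set \<Rightarrow> 'a pair_pre_digraph" where
  "subdivide_edges S w Y = \<lparr>pverts = pverts S \<union> (\<lambda>(a, b). w a b) ` Y,
     parcs = (parcs S - (Y \<union> Y\<inverse>)) \<union> (\<Union>(a, b)\<in>Y. {(a, w a b), (w a b, a), (b, w a b), (w a b, b)})\<rparr>"

text \<open>The second of two opposite arcs changes nothing. Any other arc receives a fresh vertex,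
  since \<open>w\<close> separates distinct edges.\<close>

lemma subdivision_pair_subdivide_edges:
  assumes S: "pair_bidirected_digraph S" and w: "\<And>a b. (a, b) \<in> parcs S \<Longrightarrow> w a b \<notin> pverts S \<and> w a b = w b a"
    and inj: "\<And>a b c d. (a, b) \<in> parcs S \<Longrightarrow> (c, d) \<in> parcs S \<Longrightarrow> w a b = w c d \<Longrightarrow> {a, b} = {c, d}"
    and Y: "finite Y" "Y \<subseteq> parcs S"
  shows "subdivision_pair S (subdivide_edges S w Y)"
  using Y
proof (induction Y rule: finite_induct)
  case empty
  have "subdivide_edges S w {} = S" by (simp add: subdivide_edges_def)
  then show ?case using subdivision_pair_base[OF S] by simp
next
  case (insert e Y)
  obtain a b where e: "e = (a, b)" by (cases e)
  have IH: "subdivision_pair S (subdivide_edges S w Y)" using insert by simp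
  have ab: "(a, b) \<in> parcs S" "(b, a) \<in> parcs S" "a \<in> pverts S" "b \<in> pverts S" "a \<noteq> b"
    using insert.prems e pair_bidirected_digraphD[OF S, of a b] by auto
  show ?case
  proof (cases "(b, a) \<in> Y")
    case True
    have "w a b = w b a" using w ab by blast
    then have "subdivide_edges S w (insert e Y) = subdivide_edges S w Y"
      using True unfolding subdivide_edges_def e by (auto simp: image_iff intro!: bexI[of _ "(b, a)"])
    then show ?thesis using IH by simp
  next
    case False
    have nY: "(a, b) \<notin> Y" using insert.hyps e by simp
    have fresh: "w a b \<noteq> w c d" if "(c, d) \<in> Y" for c d
    proof
      assume "w a b = w c d"
      then have "{a, b} = {c, d}" using inj ab(1) that insert.prems by blast
      then have "(c, d) = (a, b) \<or> (c, d) = (b, a)" by (auto simp: doubleton_eq_iff)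
      then show False using that nY False by auto
    qed
    have wab: "w a b \<notin> pverts (subdivide_edges S w Y)" using w[OF ab(1)] fresh by (auto simp: subdivide_edges_def)
    have "(a, b) \<in> parcs (subdivide_edges S w Y)" using ab nY False by (auto simp: subdivide_edges_def)
    then have "subdivision_pair S (subdivide (subdivide_edges S w Y) (a, b) (w a b))"
      using wab IH by (rule subdivision_pair_divide)
    moreover have "subdivide (subdivide_edges S w Y) (a, b) (w a b) = subdivide_edges S w (insert e Y)"
    proof -
      have out: "w c d \<notin> pverts S" if "(c, d) \<in> Y" for c d using w insert.prems that by blast
      define X where "X = (\<Union>(c, d)\<in>Y. {(c, w c d), (w c d, c), (d, w c d), (w c d, d)})"
      have "X \<inter> {(a, b), (b, a)} = {}" using out ab(3,4) unfolding X_def by fastforce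
      then have "(parcs S - (Y \<union> Y\<inverse>) \<union> X) - {(a, b), (b, a)} = (parcs S - (insert e Y \<union> (insert e Y)\<inverse>)) \<union> X"
        by (auto simp: e)
      then show ?thesis unfolding subdivide_edges_def subdivide.simps X_def[symmetric]
        by (simp add: e X_def[symmetric]) blast
    qed
    ultimately show ?thesis by simp
  qed
qed

lemma sym_rel_pair_graph:
  assumes "pair_graph G" shows "sym_rel (\<lambda>u v. (u, v) \<in> parcs G)"
proof -
  interpret pair_graph G by fact
  show ?thesis by unfold_locales (use no_loops' arcs_symmetric in blast)+
qed

text \<open>Subdividing \<open>S\<close> through \<open>w\<close> gives an induced subgraph:
  \<open>A\<close> is independent, the vertices \<open>w a b\<close> are pairwise non-adjacent, and
  \<open>w a b\<close> sees only \<open>a\<close> and \<open>b\<close> in \<open>A\<close>.\<close>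

lemma has_induced_subdivision_of_has_Krt:
  assumes G: "pair_graph G" and V: "V \<subseteq> pverts G" and "sym_rel.has_Krt (\<lambda>u v. (u, v) \<in> parcs G) r t V"
  shows "has_induced_subdivision_of_Krt r t G"
proof -
  interpret sym_rel "\<lambda>u v. (u, v) \<in> parcs G" by (rule sym_rel_pair_graph[OF G])
  obtain A F w K S where A: "finite A" "A \<subseteq> V" "\<And>a b. F a b \<Longrightarrow> w a b \<in> V" "subdivided A F w"
      and K: "complete_bipartite_digraph r t (with_proj K)" "subdivision_pair K S" "pverts S \<subseteq> A" "parcs S \<subseteq> {(a, b). F a b}"
    using assms(3) unfolding has_Krt_def by blast
  have ind: "indep A" and F: "\<And>a b. F a b \<Longrightarrow> a \<in> A \<and> b \<in> A \<and> a \<noteq> b \<and> F b a \<and> w a b = w b a \<and> nb A (w a b) = {a, b}"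
    and ww: "\<And>a b c d. F a b \<Longrightarrow> F c d \<Longrightarrow> (w a b, w c d) \<notin> parcs G"
    using A(4) unfolding subdivided_def by blast+
  have bd: "pair_bidirected_digraph S" using K(2) by (rule bidirected_digraphI_subdivision)
  have SF: "F a b" if "(a, b) \<in> parcs S" for a b using K(4) that by auto
  have adj: "(w a b, x) \<in> parcs G \<longleftrightarrow> x = a \<or> x = b" if "F a b" "x \<in> A" for a b x
  proof -
    have "nb A (w a b) = {a, b}" using F[OF that(1)] by blast
    then have "x \<in> nb A (w a b) \<longleftrightarrow> x = a \<or> x = b" by simp
    then show ?thesis using that(2) unfolding nb_def by blast
  qed
  have wA: "w a b \<notin> A" if f: "F a b" for a b
  proof
    assume "w a b \<in> A"
    moreover have "(w a b, a) \<in> parcs G" "a \<in> A" using adj[OF f, of a] F[OF f] by auto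
    ultimately show False using ind by (auto simp: indep_def)
  qed
  have finS: "finite (parcs S)"
  proof (rule finite_subset)
    show "parcs S \<subseteq> A \<times> A" using SF F by auto
  qed (use A(1) in simp)
  define S' where "S' = subdivide_edges S w (parcs S)"
  have sdS: "subdivision_pair S S'" unfolding S'_def
  proof (rule subdivision_pair_subdivide_edges[OF bd])
    show "w a b \<notin> pverts S \<and> w a b = w b a" if "(a, b) \<in> parcs S" for a b using wA[OF SF[OF that]] F[OF SF[OF that]] K(3) by auto
    show "{a, b} = {c, d}" if "(a, b) \<in> parcs S" "(c, d) \<in> parcs S" "w a b = w c d" for a b c d
      using F[OF SF[OF that(1)]] F[OF SF[OF that(2)]] that(3) by auto
  qed (use finS in auto)
  have vS: "pverts S' = pverts S \<union> (\<lambda>(a, b). w a b) ` parcs S" by (simp add: S'_def subdivide_edges_def)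
  have aS: "parcs S' = (\<Union>(a, b)\<in>parcs S. {(a, w a b), (w a b, a), (b, w a b), (w a b, b)})"
  proof -
    have e: "parcs S - (parcs S \<union> (parcs S)\<inverse>) = {}" by blast
    show ?thesis by (simp only: S'_def subdivide_edges_def pair_pre_digraph.select_convs e Un_empty_left)
  qed
  show ?thesis
  proof (rule has_induced_subdivisionI[OF G K(1)])
    show "subdivision_pair K S'" by (rule subdivision_pair_trans[OF K(2) sdS])
    show "pverts S' \<subseteq> pverts G" using K(3) A(2,3) SF V unfolding vS by fastforce
    show "parcs S' = {(u, v) \<in> parcs G. u \<in> pverts S' \<and> v \<in> pverts S'}"
    proof (intro equalityI subsetI)
      fix p assume "p \<in> parcs S'"
      then obtain a b where ab: "(a, b) \<in> parcs S" "p \<in> {(a, w a b), (w a b, a), (b, w a b), (w a b, b)}"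
        unfolding aS by blast
      have "a \<in> pverts S" "b \<in> pverts S" using pair_bidirected_digraphD[OF bd ab(1)] by auto
      moreover have "w a b \<in> pverts S'" using ab(1) unfolding vS by force
      moreover have "(w a b, a) \<in> parcs G" "(w a b, b) \<in> parcs G" using adj[OF SF[OF ab(1)]] F[OF SF[OF ab(1)]] by auto
      ultimately show "p \<in> {(u, v) \<in> parcs G. u \<in> pverts S' \<and> v \<in> pverts S'}" using ab(2) sym unfolding vS by blast
    next
      fix p assume p: "p \<in> {(u, v) \<in> parcs G. u \<in> pverts S' \<and> v \<in> pverts S'}"
      then obtain u v where uv: "p = (u, v)" "(u, v) \<in> parcs G" "u \<in> pverts S'" "v \<in> pverts S'" by blast
      have edge: "(w a b, x) \<in> parcs S' \<and> (x, w a b) \<in> parcs S'"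
        if "(a, b) \<in> parcs S" "(w a b, x) \<in> parcs G" "x \<in> pverts S" for a b x
      proof -
        have "x = a \<or> x = b" using adj[OF SF[OF that(1)], of x] that K(3) by blast
        then show ?thesis using that(1) unfolding aS by blast
      qed
      consider "u \<in> pverts S" "v \<in> pverts S"
        | a b where "(a, b) \<in> parcs S" "u = w a b" "v \<in> pverts S"
        | a b where "(a, b) \<in> parcs S" "v = w a b" "u \<in> pverts S"
        | a b c d where "(a, b) \<in> parcs S" "u = w a b" "(c, d) \<in> parcs S" "v = w c d"
        using uv(3,4) unfolding vS by auto
      then show "p \<in> parcs S'"
      proof cases
        case 1
        then show ?thesis using ind uv(2) K(3) by (auto simp: indep_def)
      next
        case 2
        then show ?thesis using edge[OF 2(1), of v] uv by simp
      next
        case 3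
        then show ?thesis using edge[OF 3(1), of u] uv sym by simp
      next
        case 4
        then show ?thesis using ww[OF SF SF] uv(2) by blast
      qed
    qed
  qed
qed

lemma card_le_clique_number:
  assumes "finite (verts G)" "clique G S"
  shows "card S \<le> clique_number G"
proof -
  have "{S. clique G S} \<subseteq> Pow (verts G)" by (auto simp: clique_def)
  then have "finite {S. clique G S}" using assms(1) finite_subset by blast
  then show ?thesis unfolding clique_number_def using assms(2) by (intro Max_ge) auto
qed

text \<open>Ramsey's theorem finds independent sets of size \<open>r + t\<close> on both sides of a
  biclique; subsets of sizes \<open>r\<close> and \<open>t\<close> induce
  \<open>K\<^sub>r\<^sub>,\<^sub>t\<close>, which is a subdivision of itself.\<close>

lemma biclique_free_of_no_induced_subdivision:
  assumes G: "pair_graph G" and no: "\<not> has_induced_subdivision_of_Krt r t G" and s: "(clique_number (with_proj G) + 1) ^ (r + t) \<le> s" "s \<ge> 1"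
  shows "sym_rel.biclique_free (\<lambda>u v. (u, v) \<in> parcs G) s"
proof -
  interpret G: pair_graph G by fact
  interpret sym_rel "\<lambda>u v. (u, v) \<in> parcs G" by (rule sym_rel_pair_graph[OF G])
  let ?\<omega> = "clique_number (with_proj G)"
  have large: "\<exists>S\<subseteq>X. indep S \<and> card S = r + t" if X: "X \<subseteq> pverts G" "card X = s" for X
  proof -
    have "finite X" using X(1) G.pair_finite_verts finite_subset by blast
    then consider S where "S \<subseteq> X" "indep S" "card S = r + t"
      | S where "S \<subseteq> X" "card S = ?\<omega> + 1" "\<forall>x\<in>S. \<forall>y\<in>S. x \<noteq> y \<longrightarrow> (x, y) \<in> parcs G"
      using indep_or_clique[of X "?\<omega> + 1" "r + t"] X(2) s by auto
    then show ?thesis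
    proof cases
      case 1
      then show ?thesis by blast
    next
      case 2
      then have "clique (with_proj G) S" using X(1) by (auto simp: clique_def)
      then have "card S \<le> ?\<omega>" using G.pair_finite_verts by (intro card_le_clique_number) auto
      then show ?thesis using 2 by simp
    qed
  qed
  show ?thesis unfolding biclique_free_def
  proof (intro allI impI, rule ccontr)
    fix P Q assume P: "card P = s" and Q: "card Q = s" and "\<not> (\<exists>p\<in>P. \<exists>q\<in>Q. (p, q) \<notin> parcs G)"
    then have PQ: "\<And>p q. p \<in> P \<Longrightarrow> q \<in> Q \<Longrightarrow> (p, q) \<in> parcs G" by blast
    have "P \<noteq> {}" "Q \<noteq> {}" using P Q s(2) by auto
    then have sub: "P \<subseteq> pverts G" "Q \<subseteq> pverts G" using PQ G.in_arcsD1 G.in_arcsD2 by blast+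
    obtain P1 where P1: "P1 \<subseteq> P" "indep P1" "card P1 = r + t" using large[OF sub(1) P] by blast
    obtain Q1 where Q1: "Q1 \<subseteq> Q" "indep Q1" "card Q1 = r + t" using large[OF sub(2) Q] by blast
    obtain A where A: "A \<subseteq> P1" "card A = r" using P1(3) by (metis le_add1 obtain_subset_with_card_n)
    obtain B where B: "B \<subseteq> Q1" "card B = t" using Q1(3) by (metis le_add2 obtain_subset_with_card_n)
    have AB: "(a, b) \<in> parcs G" "(b, a) \<in> parcs G" if "a \<in> A" "b \<in> B" for a b
      using PQ[of a b] sym[of a b] that A B P1 Q1 by blast+
    have disj: "A \<inter> B = {}" using AB irrefl by blast
    have subV: "A \<subseteq> pverts G" "B \<subseteq> pverts G" using A B P1 Q1 sub by blast+
    have iA: "(x, y) \<notin> parcs G" if "x \<in> A" "y \<in> A" for x y using that A(1) P1(2) by (auto simp: indep_def)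
    have iB: "(x, y) \<notin> parcs G" if "x \<in> B" "y \<in> B" for x y using that B(1) Q1(2) by (auto simp: indep_def)
    define K where "K = \<lparr>pverts = A \<union> B, parcs = A \<times> B \<union> B \<times> A\<rparr>"
    have K: "complete_bipartite_digraph r t (with_proj K)"
      unfolding complete_bipartite_digraph_pair_def
    proof
      show "finite (pverts K)" using finite_subset[OF _ G.pair_finite_verts] subV by (simp add: K_def)
      show "\<exists>U V. pverts K = U \<union> V \<and> U \<inter> V = {} \<and> card U = r \<and> card V = t \<and> parcs K = U \<times> V \<union> V \<times> U"
        by (rule exI[of _ A], rule exI[of _ B]) (use disj A B in \<open>simp add: K_def\<close>)
    qed
    have "pair_bidirected_digraph K"
    proof -
      interpret pair_graph K by (rule pair_graphI_complete_bipartite[OF K])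
      show ?thesis by unfold_locales
    qed
    then have "subdivision_pair K K" by (rule subdivision_pair_base)
    moreover have "parcs K = {(u, v) \<in> parcs G. u \<in> pverts K \<and> v \<in> pverts K}"
      using AB iA iB by (auto simp: K_def)
    moreover have "pverts K \<subseteq> pverts G" using subV by (simp add: K_def)
    ultimately have "has_induced_subdivision_of_Krt r t G" using has_induced_subdivisionI[OF G K] by blast
    then show False using no by blast
  qed
qed

theorem theorem1p2:
  fixes r t :: nat
  assumes "r \<ge> 1" and "t \<ge> 1"
  shows "polynomially_chi_bounded
    {G :: 'a pair_pre_digraph. pair_graph G \<and> \<not> has_induced_subdivision_of_Krt r t G}"
proof -
  obtain g s0 where g: "poly_bounded g" "\<forall>(E :: 'a \<Rightarrow> 'a \<Rightarrow> bool) V s. sym_rel E \<longrightarrow> s0 \<le> s \<longrightarrow>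
      sym_rel.biclique_free E s \<longrightarrow> finite V \<longrightarrow> V \<noteq> {} \<longrightarrow> (\<forall>v\<in>V. g s \<le> card (sym_rel.nb E V v)) \<longrightarrow> sym_rel.has_Krt E r t V"
    using has_Krt_of_large_min_degree[OF assms] by blast
  obtain C where C: "\<And>s. s \<ge> 2 \<Longrightarrow> g s \<le> s ^ C" using g(1) by (auto simp: poly_bounded_def)
  \<comment> \<open>Chosen so that its value at the clique number is \<open>s ^ C\<close> for the
    \<open>s\<close> below.\<close>
  define f :: "real poly" where "f = ([:1, 1:] ^ (r + t) + [:real (s0 + 2):]) ^ C"
  show ?thesis unfolding polynomially_chi_bounded_def
  proof (intro exI[of _ f] ballI)
    fix G :: "'a pair_pre_digraph" assume "G \<in> {G. pair_graph G \<and> \<not> has_induced_subdivision_of_Krt r t G}"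
    then have G: "pair_graph G" and no: "\<not> has_induced_subdivision_of_Krt r t G" by auto
    interpret G: pair_graph G by fact
    interpret sym_rel "\<lambda>u v. (u, v) \<in> parcs G" by (rule sym_rel_pair_graph[OF G])
    define \<omega> where "\<omega> = clique_number (with_proj G)"
    \<comment> \<open>The power is the Ramsey bound that excludes bicliques, \<open>s0\<close> is
      the threshold for the minimum degree bound, and 2 is the least argument at which
      \<open>poly_bounded\<close> controls \<open>g\<close>.\<close>
    define s where "s = (\<omega> + 1) ^ (r + t) + (s0 + 2)"
    have s: "s \<ge> 2" "s \<ge> 1" "s0 \<le> s" "(\<omega> + 1) ^ (r + t) \<le> s" by (auto simp: s_def)
    have bf: "biclique_free s" using G no s unfolding \<omega>_def by (intro biclique_free_of_no_induced_subdivision) auto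
    have degen: "\<exists>v\<in>W. card (nb W v) < g s" if W: "W \<subseteq> pverts G" "W \<noteq> {}" for W
    proof (rule ccontr)
      assume "\<not> ?thesis"
      then have "\<forall>v\<in>W. g s \<le> card (nb W v)" by (meson not_less)
      moreover have "finite W" using W(1) G.pair_finite_verts finite_subset by blast
      ultimately have "has_Krt r t W" using g(2) sym_rel_axioms W(2) bf s(3) by blast
      then show False using has_induced_subdivision_of_has_Krt[OF G W(1)] no by blast
    qed
    obtain c :: "'a \<Rightarrow> nat" where c: "\<forall>u\<in>pverts G. \<forall>v\<in>pverts G. (u, v) \<in> parcs G \<longrightarrow> c u \<noteq> c v" "c ` pverts G \<subseteq> {..<g s}"
      using degenerate_colouring[OF G.pair_finite_verts degen] by blast
    then have "proper_colouring (with_proj G) c \<and> c ` verts (with_proj G) \<subseteq> {..<g s}" by (simp add: proper_colouring_def)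
    then have "chromatic_number (with_proj G) \<le> g s" unfolding chromatic_number_def by (intro Least_le) blast
    also have "\<dots> \<le> s ^ C" using C s by simp
    finally have "real (chromatic_number (with_proj G)) \<le> real (s ^ C)" by (simp only: of_nat_le_iff)
    also have "real (s ^ C) = poly f (real \<omega>)" by (simp add: f_def s_def add_ac)
    finally show "real (chromatic_number (with_proj G)) \<le> poly f (real (clique_number (with_proj G)))" by (simp add: \<omega>_def)
  qed
qed

end
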